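(* Let $f\in L^2(\mathcal X,\mu)$ with $\mathbb V_\mu[f]>0$, and suppose the design points $x_1,\dots,x_n$ ($n\ge2$) are sampled i.i.d. from $\mu$. Let $r>0$ be fixed and suppose that $N$ and $n$ satisfy $$K_N\le\kappa_r\cdot\frac{n}{\ln n},\qquad\kappa_r=\frac{3\ln(3/2)-1}{2+2r}.$$ Let $\hat f^{LS}$ be the ordinary least squares approximation of $f$ with truncation set $\mathcal L_N$, and put $$\mathcal R_{LS}^2=\frac{1.2}{\mathbb V_\mu[f]}\cdot\|e_N\|_\mu^2+\frac{4\sigma^2}{\mathbb V_\mu[f]}\cdot\frac Nn,\qquad\mathcal R_{LS}\ge0.$$ Let $(S_U,\hat S^{LS}_U)$ denote either the Sobol' indices of $f$ and $\hat f^{LS}$ for $U$, or (for all $U$ simultaneously) the total-effect indices of $f$ and $\hat f^{LS}$ for $U$. Then in both cases $$\max_{U\subseteq\{1,\dots,d\}}\mathbb E\big(S_U-\hat S_U^{LS}\big)^2\le\mathcal R_{LS}^2+2n^{-r},$$ and for every $U\subseteq\{1,\dots,d\}$ $$\mathbb E\big|S_U-\hat S_U^{LS}\big|\le\mathcal R_{LS}\big(\mathcal R_{LS}+2\sqrt{S_U}\big)+2n^{-r}.$$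
   Context: $\mathcal X=\mathcal X_1\times\dots\times\mathcal X_d$ with $\mathcal X_i\subseteq\mathbb R$, and $\mu=\mu_1\otimes\dots\otimes\mu_d$ is a product of probability measures $\mu_i$ on $\mathcal X_i$. $\|g\|_\mu$ is the $L^2(\mathcal X,\mu)$ norm; $\mathbb E_\mu,\mathbb V_\mu$ are mean and variance under $\mu$. Every $f\in L^2(\mathcal X,\mu)$ has a unique Sobol-Hoeffding decomposition $f(x)=\sum_{U\subseteq\{1,\dots,d\}}f_U(x_U)$, where $f_U$ depends only on $x_U=(x_i)_{i\in U}$, $f_\emptyset=\mathbb E_\mu[f]$, and $\int_{\mathcal X_i}f_U(x_U)\,d\mu_i(x_i)=0$ for every $i\in U$. When $\mathbb V_\mu[f]>0$, the Sobol' index of $U$ is $S_U=\mathbb V_\mu[f_U]/\mathbb V_\mu[f]$, and the total-effect index is $T_U=\sum_{V:\,V\cap U\ne\emptyset}S_V$ ($S_\emptyset=T_\emptyset=0$). If an approximation $\hat f$ has $\mathbb V_\mu[\hat f]=0$, its indices are by convention all set equal to $2^{-d}$. Regressors: for each $i$, $\{\psi^{(i)}_\alpha\}_{\alpha\in\mathbb N}$ ($\mathbb N=\{0,1,2,\dots\}$) is a $\mu_i$-orthonormal family with $\psi^{(i)}_0=1$, and $\Psi_\alpha(x)=\prod_{i=1}^d\psi^{(i)}_{\alpha_i}(x_i)$ for $\alpha\in\mathbb N^d$. Fixed nested sets $\{\mathbf 0\}=\mathcal L_1\subset\mathcal L_2\subset\dots\subset\mathbb N^d$ with $|\mathcal L_N|=N$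 are given; $V_N=\mathrm{span}\{\Psi_\alpha:\alpha\in\mathcal L_N\}$; $f_N$ is the $\mu$-orthogonal projection of $f$ onto $V_N$ and $e_N=f-f_N$. $K_N=\sup_{x\in\mathcal X}\sum_{\alpha\in\mathcal L_N}\Psi_\alpha^2(x)$. Training sample: $y_i=f(x_i)+\eta_i$, $i=1,\dots,n$, with $\eta_i$ i.i.d., $\mathbb E\eta_i=0$, $\mathbb V\eta_i=\sigma^2<\infty$ ($\sigma^2=0$ allowed), independent of the design; $Y=(y_1,\dots,y_n)^T$. Let $\Phi\in\mathbb R^{n\times N}$ be the design matrix with entries $\Psi_\alpha(x_i)$ ($\alpha\in\mathcal L_N$). Ordinary least squares: $\hat f^{LS}=\sum_{\alpha\in\mathcal L_N}\hat c_\alpha\Psi_\alpha$ with $\hat c=(\Phi^T\Phi)^{-1}\Phi^TY$ if $\det(\Phi^T\Phi)\ne0$, and $\hat c=0$ otherwise. $\mathbb E$ without subscript is expectation over design and noise. *)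

theory Defs
  imports
    "HOL-Probability.Probability"
    "Jordan_Normal_Form.Gauss_Jordan_Elimination"
    "Jordan_Normal_Form.Determinant"
begin

definition square_integrable :: "'a measure \<Rightarrow> ('a \<Rightarrow> real) \<Rightarrow> bool" where
  "square_integrable M g \<longleftrightarrow> g \<in> borel_measurable M \<and> integrable M (\<lambda>x. (g x)\<^sup>2)"

definition l2_norm :: "'a measure \<Rightarrow> ('a \<Rightarrow> real) \<Rightarrow> real" where
  "l2_norm M g = sqrt (\<integral>x. (g x)\<^sup>2 \<partial>M)"

(* The coordinate set {1,...,d} is a finite type 'd, so d = CARD('d).  The one-dimensional
   measures carry their own spaces X_i, hence X = space (prod_measure mu). *)

abbreviation prod_measure :: "('d::finite \<Rightarrow> real measure) \<Rightarrow> ('d \<Rightarrow> real) measure" where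
  "prod_measure \<mu> \<equiv> Pi\<^sub>M UNIV \<mu>"

(* F U is a function of the full point x which depends only on the coordinates in U.
   Identities in L^2 are meant almost everywhere. *)
definition sobol_hoeffding ::
  "('d::finite \<Rightarrow> real measure) \<Rightarrow> (('d \<Rightarrow> real) \<Rightarrow> real) \<Rightarrow> ('d set \<Rightarrow> ('d \<Rightarrow> real) \<Rightarrow> real) \<Rightarrow> bool"
where
  "sobol_hoeffding \<mu> f F \<longleftrightarrow>
     (\<forall>U. square_integrable (prod_measure \<mu>) (F U)) \<and>
     (\<forall>U. \<forall>x\<in>space (prod_measure \<mu>). \<forall>y\<in>space (prod_measure \<mu>).
        (\<forall>i\<in>U. x i = y i) \<longrightarrow> F U x = F U y) \<and>
     (AE x in prod_measure \<mu>. f x = (\<Sum>U\<in>UNIV. F U x)) \<and>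
     (\<forall>x\<in>space (prod_measure \<mu>). F {} x = (\<integral>z. f z \<partial>prod_measure \<mu>)) \<and>
     (\<forall>U. \<forall>i\<in>U. AE x in prod_measure \<mu>. (\<integral>t. F U (x(i := t)) \<partial>\<mu> i) = 0)"

(* For square-integrable f the decomposition exists and is unique up to null sets. *)
definition sobol_component ::
  "('d::finite \<Rightarrow> real measure) \<Rightarrow> (('d \<Rightarrow> real) \<Rightarrow> real) \<Rightarrow> 'd set \<Rightarrow> ('d \<Rightarrow> real) \<Rightarrow> real" where
  "sobol_component \<mu> f = (SOME F. sobol_hoeffding \<mu> f F)"

(* The first branch of the two indices below is the convention for approximations of
   variance zero: all indices, of both kinds and including U = {}, equal 2^(-d). *)

definition sobol_index ::
  "('d::finite \<Rightarrow> real measure) \<Rightarrow> (('d \<Rightarrow> real) \<Rightarrow> real) \<Rightarrow> 'd set \<Rightarrow> real" where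
  "sobol_index \<mu> f U =
     (if prob_space.variance (prod_measure \<mu>) f = 0 then 1 / 2 ^ CARD('d)
      else prob_space.variance (prod_measure \<mu>) (sobol_component \<mu> f U) /
           prob_space.variance (prod_measure \<mu>) f)"

definition total_effect_index ::
  "('d::finite \<Rightarrow> real measure) \<Rightarrow> (('d \<Rightarrow> real) \<Rightarrow> real) \<Rightarrow> 'd set \<Rightarrow> real" where
  "total_effect_index \<mu> f U =
     (if prob_space.variance (prod_measure \<mu>) f = 0 then 1 / 2 ^ CARD('d)
      else (\<Sum>V | V \<inter> U \<noteq> {}. sobol_index \<mu> f V))"

definition tensor_regressor ::
  "('d::finite \<Rightarrow> nat \<Rightarrow> real \<Rightarrow> real) \<Rightarrow> ('d \<Rightarrow> nat) \<Rightarrow> ('d \<Rightarrow> real) \<Rightarrow> real" where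
  "tensor_regressor \<psi> \<alpha> x = (\<Prod>i\<in>UNIV. \<psi> i (\<alpha> i) (x i))"

(* The linear span of the functions Psi a, a in A, for finite A. *)
definition regressor_span :: "('b \<Rightarrow> 'a \<Rightarrow> real) \<Rightarrow> 'b set \<Rightarrow> ('a \<Rightarrow> real) set" where
  "regressor_span \<Psi> A = {g. \<exists>c. g = (\<lambda>x. \<Sum>\<alpha>\<in>A. c \<alpha> * \<Psi> \<alpha> x)}"

definition orthogonal_projection ::
  "'a measure \<Rightarrow> ('a \<Rightarrow> real) set \<Rightarrow> ('a \<Rightarrow> real) \<Rightarrow> ('a \<Rightarrow> real) \<Rightarrow> bool" where
  "orthogonal_projection M V f g \<longleftrightarrow>
     g \<in> V \<and> (\<forall>h\<in>V. (\<integral>x. (f x - g x) * h x \<partial>M) = 0)"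

(* The constant K_N; extended-valued, since the supremum may be infinite. *)
definition regressor_sup :: "'a measure \<Rightarrow> ('b \<Rightarrow> 'a \<Rightarrow> real) \<Rightarrow> 'b set \<Rightarrow> ennreal" where
  "regressor_sup M \<Psi> A = (SUP x\<in>space M. ennreal (\<Sum>\<alpha>\<in>A. (\<Psi> \<alpha> x)\<^sup>2))"

(* Regressors phi 0, ..., phi (N-1), design points x 0, ..., x (n-1), responses y 0, ..., y (n-1).
   When the Gram matrix has nonzero determinant, mat_inverse returns Some of its inverse. *)

definition design_matrix :: "(nat \<Rightarrow> 'a \<Rightarrow> real) \<Rightarrow> nat \<Rightarrow> nat \<Rightarrow> (nat \<Rightarrow> 'a) \<Rightarrow> real mat" where
  "design_matrix \<phi> n N x = mat n N (\<lambda>(k, j). \<phi> j (x k))"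

definition ols_coeffs ::
  "(nat \<Rightarrow> 'a \<Rightarrow> real) \<Rightarrow> nat \<Rightarrow> nat \<Rightarrow> (nat \<Rightarrow> 'a) \<Rightarrow> (nat \<Rightarrow> real) \<Rightarrow> real vec" where
  "ols_coeffs \<phi> n N x y =
     (let \<Phi> = design_matrix \<phi> n N x; G = transpose_mat \<Phi> * \<Phi>
      in if Determinant.det G \<noteq> 0
         then the (mat_inverse G) *\<^sub>v (transpose_mat \<Phi> *\<^sub>v Matrix.vec n y)
         else 0\<^sub>v N)"

definition ols_approx ::
  "(nat \<Rightarrow> 'a \<Rightarrow> real) \<Rightarrow> nat \<Rightarrow> nat \<Rightarrow> (nat \<Rightarrow> 'a) \<Rightarrow> (nat \<Rightarrow> real) \<Rightarrow> 'a \<Rightarrow> real" where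
  "ols_approx \<phi> n N x y t = (\<Sum>j<N. vec_index (ols_coeffs \<phi> n N x y) j * \<phi> j t)"

end

theory Submission
  imports Defs
begin

text \<open>The indices of \<open>f\<close> and of an approximation \<open>g\<close> are squared norms of the projections of the
  normalised centred functions onto the same closed subspace, so they differ by at most the sine
  \<open>s\<close> of the angle between these functions, and by at most \<open>s\<^sup>2 + 2 s \<surd>S\<^sub>U\<close>; here
  \<open>s\<close> is at most the \<open>L\<^sup>2\<close> error relative to the standard deviation of \<open>f\<close>.

  On samples whose normalised Gram matrix has smallest eigenvalue at least \<open>1/2\<close>, the least squares
  coefficients differ from those of the projection by at most \<open>2/n\<close> times the norm of
  \<open>\<Phi>\<^sup>T(e\<^sub>N + \<eta>)\<close>, whose expected square is at most \<open>n (K\<^sub>N \<parallel>e\<^sub>N\<parallel>\<^sup>2 + N \<sigma>\<^sup>2)\<close>.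
  On the remaining samples the indices differ by at most \<open>1\<close>.

  The remaining samples have probability at most about \<open>N exp(-n/(8 K\<^sub>N))\<close> by the lower tail of the
  matrix Chernoff bound.  Since the summands have rank one, its trace-exponential argument needs the
  Golden--Thompson inequality only for rank-one perturbations, and there it follows from the
  log-convexity of the moments \<open>\<langle>v, A\<^sup>k v\<rangle>\<close>, without any spectral theory.\<close>

section \<open>Sobol indices\<close>

text \<open>The constant \<open>(3 ln(3/2) - 1)/2\<close> is the exponent of the upper matrix
  Chernoff tail at 3/2, as a two-sided control of the Gram matrix would require. Least squares needs
  only the lower tail at 1/2, and \<open>3 ln(3/2) - 1 \<le> 1/4\<close> leaves room to replace its
  exact exponent \<open>(1 - ln 2)/2\<close> by 1/8, which a second-order expansion delivers.

  The expansion is run on \<open>c I - t sum v_i v_i^T\<close>. The shift \<open>c\<close> keeps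
  every partial operator positive, without which the moments need not be log-convex. Orthonormality
  makes the mean of \<open>v v^T\<close> the identity, so each new sample multiplies the expected
  trace exponential by at most \<open>1 - g\<close>, up to a remainder of the truncated series. Of
  the two terms \<open>n^(-r)\<close> in the claim, one pays for the tail and one for this
  remainder.

  The factor 1.2 bounds \<open>1 + 4 K / n\<close>, because the stability condition forces
  \<open>20 K \<le> n\<close>. The indices of the estimator are not shown to be measurable in the
  sample; all expectations are bounded through integrable majorants.\<close>

lemma square_integrable_measurable: "square_integrable M f \<Longrightarrow> f \<in> borel_measurable M"
  and square_integrable_square: "square_integrable M f \<Longrightarrow> integrable M (\<lambda>x. (f x)\<^sup>2)"
  by (auto simp: square_integrable_def)

lemma square_integrable_mult:
  assumes f: "square_integrable M f" and g: "square_integrable M g"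
  shows "integrable M (\<lambda>x. f x * g x)"
proof (rule Bochner_Integration.integrable_bound)
  show "integrable M (\<lambda>x. (f x)\<^sup>2 + (g x)\<^sup>2)"
    using f g by (simp add: square_integrable_def)
  show "(\<lambda>x. f x * g x) \<in> borel_measurable M"
    using f g by (intro borel_measurable_times) (auto simp: square_integrable_def)
  have "\<bar>a * b\<bar> \<le> a\<^sup>2 + b\<^sup>2" for a b :: real
    using sum_squares_bound[of "\<bar>a\<bar>" "\<bar>b\<bar>"] mult_nonneg_nonneg[of "\<bar>a\<bar>" "\<bar>b\<bar>"]
    unfolding abs_mult power2_abs by linarith
  then show "AE x in M. norm (f x * g x) \<le> norm ((f x)\<^sup>2 + (g x)\<^sup>2)"
    by (intro AE_I2) simp
qed

lemma square_integrable_add: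
  assumes f: "square_integrable M f" and g: "square_integrable M g"
  shows "square_integrable M (\<lambda>x. f x + g x)"
  unfolding square_integrable_def
proof
  show "(\<lambda>x. f x + g x) \<in> borel_measurable M"
    using f g by (intro borel_measurable_add square_integrable_measurable)
  show "integrable M (\<lambda>x. (f x + g x)\<^sup>2)"
    using f g square_integrable_mult[OF f g] by (simp add: square_integrable_def power2_sum mult.assoc)
qed

lemma square_integrable_scale: "square_integrable M f \<Longrightarrow> square_integrable M (\<lambda>x. c * f x)"
  by (auto simp: square_integrable_def power_mult_distrib intro!: borel_measurable_times)

lemma square_integrable_diff:
  assumes f: "square_integrable M f" and g: "square_integrable M g"
  shows "square_integrable M (\<lambda>x. f x - g x)"
  using square_integrable_add[OF f square_integrable_scale[OF g, of "-1"]] by simp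

lemma square_integrable_sum:
  "(\<And>i. i \<in> I \<Longrightarrow> square_integrable M (f i)) \<Longrightarrow> square_integrable M (\<lambda>x. \<Sum>i\<in>I. f i x)"
proof (induction I rule: infinite_finite_induct)
  case (insert i I)
  then show ?case by (simp add: square_integrable_add)
qed (simp_all add: square_integrable_def)

lemma (in prob_space) square_integrable_const: "square_integrable M (\<lambda>_. c)"
  by (simp add: square_integrable_def)

lemma (in prob_space) square_integrable_integrable:
  "square_integrable M f \<Longrightarrow> integrable M f"
  using square_integrable_imp_integrable by (auto simp: square_integrable_def)

lemma integral_Cauchy_Schwarz:
  assumes f: "square_integrable M f" and g: "square_integrable M g"
  shows "(\<integral>x. f x * g x \<partial>M)\<^sup>2 \<le> (\<integral>x. (f x)\<^sup>2 \<partial>M) * (\<integral>x. (g x)\<^sup>2 \<partial>M)"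
proof -
  let ?a = "\<integral>x. (f x)\<^sup>2 \<partial>M" and ?b = "\<integral>x. f x * g x \<partial>M" and ?c = "\<integral>x. (g x)\<^sup>2 \<partial>M"
  have q: "0 \<le> ?a - 2 * s * ?b + s\<^sup>2 * ?c" for s
  proof -
    have "0 \<le> (\<integral>x. (f x - s * g x)\<^sup>2 \<partial>M)" by simp
    also have "\<dots> = (\<integral>x. (f x)\<^sup>2 - 2 * s * (f x * g x) + s\<^sup>2 * (g x)\<^sup>2 \<partial>M)"
      by (intro Bochner_Integration.integral_cong refl) (simp add: power2_eq_square algebra_simps)
    also have "\<dots> = ?a - 2 * s * ?b + s\<^sup>2 * ?c"
      using f g square_integrable_mult[OF f g] by (simp add: square_integrable_def)
    finally show ?thesis .
  qed
  show ?thesis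
  proof (cases "?c = 0")
    case True
    have "?b = 0"
    proof (rule ccontr)
      assume "?b \<noteq> 0"
      \<comment> \<open>With \<open>?c = 0\<close> the polynomial in \<open>q\<close> is affine in
        \<open>s\<close>; the chosen \<open>s\<close> gives it the value -1.\<close>
      then show False using q[of "(?a + 1) / (2 * ?b)"] True by simp
    qed
    then show ?thesis using True by simp
  next
    case False
    moreover have "0 \<le> ?c" by simp
    ultimately have "?c > 0" by linarith
    then show ?thesis
      using q[of "?b / ?c"] by (simp add: field_simps power2_eq_square)
  qed
qed

section \<open>Moebius inversion over subsets\<close>

definition moebius_sum :: "('d set \<Rightarrow> real) \<Rightarrow> 'd set \<Rightarrow> real" where
  "moebius_sum g U = (\<Sum>W\<in>Pow U. (-1) ^ card (U - W) * g W)"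

text \<open>Subsets of \<open>insert i U\<close> are sorted by whether they contain
  \<open>i\<close>; the sign flips for those that do not. This difference form drives both the
  inversion formula and the vanishing of the partial integrals.\<close>

lemma moebius_sum_insert:
  assumes "finite U" "i \<notin> U"
  shows "moebius_sum g (insert i U) = moebius_sum (\<lambda>W. g (insert i W)) U - moebius_sum g U"
proof -
  have inj: "inj_on (insert i) (Pow U)"
    using assms(2) by (auto simp: inj_on_def)
  have c1: "(-1) ^ card (insert i U - W) = - ((-1) ^ card (U - W) :: real)" if "W \<in> Pow U" for W
  proof -
    have "insert i U - W = insert i (U - W)" "i \<notin> U - W" using that assms(2) by auto
    then show ?thesis using assms(1) by simp
  qed
  have c2: "insert i U - insert i W = U - W" if "W \<in> Pow U" for W using that assms(2) by auto
  have "moebius_sum g (insert i U) = (\<Sum>W\<in>Pow U. (-1) ^ card (insert i U - W) * g W)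
      + (\<Sum>W\<in>insert i ` Pow U. (-1) ^ card (insert i U - W) * g W)"
    unfolding moebius_sum_def Pow_insert using assms by (intro sum.union_disjoint) auto
  also have "(\<Sum>W\<in>insert i ` Pow U. (-1) ^ card (insert i U - W) * g W)
      = moebius_sum (\<lambda>W. g (insert i W)) U"
    unfolding moebius_sum_def sum.reindex[OF inj] using c2 by (intro sum.cong) auto
  also have "(\<Sum>W\<in>Pow U. (-1) ^ card (insert i U - W) * g W) = - moebius_sum g U"
    unfolding moebius_sum_def sum_negf[symmetric] using c1 by (intro sum.cong) auto
  finally show ?thesis by simp
qed

text \<open>By \<open>moebius_sum_insert\<close> the contributions without \<open>i\<close> cancel,
  and what is left is the same identity for \<open>\<lambda>W. g (insert i W)\<close>.\<close>

lemma sum_moebius_sum: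
  assumes "finite A" shows "(\<Sum>U\<in>Pow A. moebius_sum g U) = g A"
  using assms
proof (induction A arbitrary: g rule: finite_induct)
  case empty
  show ?case by (simp add: moebius_sum_def)
next
  case (insert i A)
  have inj: "inj_on (insert i) (Pow A)"
    using insert.hyps by (auto simp: inj_on_def)
  have "(\<Sum>U\<in>Pow (insert i A). moebius_sum g U)
      = (\<Sum>U\<in>Pow A. moebius_sum g U) + (\<Sum>U\<in>insert i ` Pow A. moebius_sum g U)"
    unfolding Pow_insert using insert.hyps by (intro sum.union_disjoint) auto
  also have "(\<Sum>U\<in>insert i ` Pow A. moebius_sum g U)
      = (\<Sum>U\<in>Pow A. moebius_sum (\<lambda>W. g (insert i W)) U - moebius_sum g U)"
    unfolding sum.reindex[OF inj] using insert.hyps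
    by (intro sum.cong) (auto intro!: moebius_sum_insert intro: finite_subset)
  finally show ?case using insert.IH[of "\<lambda>W. g (insert i W)"] by (simp add: sum_subtractf)
qed

text \<open>With \<open>y\<close> an independent copy of \<open>x\<close>, integrating over
  \<open>y\<close> averages out the coordinates outside \<open>W\<close>. Keeping two full points
  avoids splitting the product measure into a factor for \<open>W\<close> and one for its
  complement.\<close>

definition mix_coords :: "'d set \<Rightarrow> ('d \<Rightarrow> 'a) \<Rightarrow> ('d \<Rightarrow> 'a) \<Rightarrow> 'd \<Rightarrow> 'a" where
  "mix_coords W x y = (\<lambda>i. if i \<in> W then x i else y i)"

section \<open>Conditional means and existence of the decomposition\<close>

context
  fixes \<mu> :: "'d::finite \<Rightarrow> real measure"
  assumes prob_mu: "\<And>i. prob_space (\<mu> i)"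
begin

lemma prob_space_prod: "prob_space (prod_measure \<mu>)"
  by (intro prob_space_PiM prob_mu)

lemma space_prod: "x \<in> space (prod_measure \<mu>) \<longleftrightarrow> (\<forall>i. x i \<in> space (\<mu> i))"
  by (auto simp: space_PiM PiE_iff)

lemma measurable_mix_coords [measurable]:
  "(\<lambda>z. mix_coords W (fst z) (snd z)) \<in> prod_measure \<mu> \<Otimes>\<^sub>M prod_measure \<mu> \<rightarrow>\<^sub>M prod_measure \<mu>"
  unfolding mix_coords_def
  by (rule measurable_PiM_single') (auto simp: space_pair_measure space_PiM PiE_iff)

text \<open>Each coordinate of the spliced point comes from exactly one of two independent points
  with the same law. It suffices to compare rectangles, and the preimage of a rectangle is a product
  of two rectangles.\<close>

lemma distr_mix_coords:
  "distr (prod_measure \<mu> \<Otimes>\<^sub>M prod_measure \<mu>) (prod_measure \<mu>) (\<lambda>z. mix_coords W (fst z) (snd z))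
    = prod_measure \<mu>"
proof -
  interpret mu: prob_space "\<mu> i" for i by (rule prob_mu)
  interpret product_prob_space \<mu> UNIV ..
  show ?thesis
  proof (rule PiM_eqI)
    fix A assume A: "\<And>i. i \<in> UNIV \<Longrightarrow> A i \<in> sets (\<mu> i)"
    define B where "B i = (if i \<in> W then A i else space (\<mu> i))" for i
    define C where "C i = (if i \<in> W then space (\<mu> i) else A i)" for i
    have B: "Pi\<^sub>E UNIV B \<in> sets (prod_measure \<mu>)" and C: "Pi\<^sub>E UNIV C \<in> sets (prod_measure \<mu>)"
      using A by (auto simp: B_def C_def intro!: sets_PiM_I_finite)
    have As: "t \<in> A i \<Longrightarrow> t \<in> space (\<mu> i)" for i t
      using sets.sets_into_space[OF A] by auto
    have "(\<lambda>z. mix_coords W (fst z) (snd z)) -` Pi\<^sub>E UNIV A \<inter> space (prod_measure \<mu> \<Otimes>\<^sub>M prod_measure \<mu>)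
        = Pi\<^sub>E UNIV B \<times> Pi\<^sub>E UNIV C"
      using As by (fastforce simp: B_def C_def mix_coords_def space_pair_measure space_PiM PiE_iff
          split: if_splits)
    then have "emeasure (distr (prod_measure \<mu> \<Otimes>\<^sub>M prod_measure \<mu>) (prod_measure \<mu>)
          (\<lambda>z. mix_coords W (fst z) (snd z))) (Pi\<^sub>E UNIV A)
        = emeasure (prod_measure \<mu> \<Otimes>\<^sub>M prod_measure \<mu>) (Pi\<^sub>E UNIV B \<times> Pi\<^sub>E UNIV C)"
      using A by (subst emeasure_distr) (auto intro!: sets_PiM_I_finite)
    also have "\<dots> = emeasure (prod_measure \<mu>) (Pi\<^sub>E UNIV B) * emeasure (prod_measure \<mu>) (Pi\<^sub>E UNIV C)"
      by (rule sigma_finite_measure.emeasure_pair_measure_Times[OF prob_space_imp_sigma_finite[OF prob_space_prod] B C])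
    also have "\<dots> = (\<Prod>i\<in>UNIV. emeasure (\<mu> i) (B i) * emeasure (\<mu> i) (C i))"
      using A by (subst (1 2) emeasure_PiM) (auto simp: B_def C_def prod.distrib)
    also have "\<dots> = (\<Prod>i\<in>UNIV. emeasure (\<mu> i) (A i))"
      by (intro prod.cong) (auto simp: B_def C_def prob_space.emeasure_space_1[OF prob_mu])
    finally show "emeasure (distr (prod_measure \<mu> \<Otimes>\<^sub>M prod_measure \<mu>) (prod_measure \<mu>)
          (\<lambda>z. mix_coords W (fst z) (snd z))) (Pi\<^sub>E UNIV A) = (\<Prod>i\<in>UNIV. emeasure (\<mu> i) (A i))" .
  qed simp_all
qed

text \<open>Integrals of \<open>f\<close> are pulled back along the measure-preserving splice to the
  pair measure, where Fubini applies.\<close>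

lemma
  fixes f :: "('d \<Rightarrow> real) \<Rightarrow> real"
  assumes f: "integrable (prod_measure \<mu>) f"
  shows AE_integrable_mix_coords: "AE x in prod_measure \<mu>. integrable (prod_measure \<mu>) (\<lambda>y. f (mix_coords W x y))"
    and integrable_integral_mix_coords:
      "integrable (prod_measure \<mu>) (\<lambda>x. \<integral>y. f (mix_coords W x y) \<partial>prod_measure \<mu>)"
    and integral_integral_mix_coords:
      "(\<integral>x. (\<integral>y. f (mix_coords W x y) \<partial>prod_measure \<mu>) \<partial>prod_measure \<mu>) = (\<integral>x. f x \<partial>prod_measure \<mu>)"
    and integrable_integral_mix_coords':
      "integrable (prod_measure \<mu>) (\<lambda>y. \<integral>x. f (mix_coords W x y) \<partial>prod_measure \<mu>)"
    and integral_integral_mix_coords':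
      "(\<integral>y. (\<integral>x. f (mix_coords W x y) \<partial>prod_measure \<mu>) \<partial>prod_measure \<mu>) = (\<integral>x. f x \<partial>prod_measure \<mu>)"
proof -
  interpret nu: prob_space "prod_measure \<mu>" by (rule prob_space_prod)
  interpret pair_prob_space "prod_measure \<mu>" "prod_measure \<mu>" by unfold_locales
  let ?g = "\<lambda>z. f (mix_coords W (fst z) (snd z))"
  have int: "integrable (prod_measure \<mu> \<Otimes>\<^sub>M prod_measure \<mu>) ?g"
    using f by (intro integrable_distr[OF measurable_mix_coords]) (simp add: distr_mix_coords)
  have eq: "integral\<^sup>L (prod_measure \<mu> \<Otimes>\<^sub>M prod_measure \<mu>) ?g = (\<integral>x. f x \<partial>prod_measure \<mu>)"
    using integral_distr[OF measurable_mix_coords borel_measurable_integrable[OF f], of W]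
    by (simp add: distr_mix_coords)
  have int': "integrable (prod_measure \<mu> \<Otimes>\<^sub>M prod_measure \<mu>) (\<lambda>(x, y). f (mix_coords W x y))"
    using int by (simp add: case_prod_unfold)
  show "AE x in prod_measure \<mu>. integrable (prod_measure \<mu>) (\<lambda>y. f (mix_coords W x y))"
    using AE_integrable_fst'[OF int] by simp
  show "integrable (prod_measure \<mu>) (\<lambda>x. \<integral>y. f (mix_coords W x y) \<partial>prod_measure \<mu>)"
    using integrable_fst'[OF int] by simp
  show "(\<integral>x. (\<integral>y. f (mix_coords W x y) \<partial>prod_measure \<mu>) \<partial>prod_measure \<mu>) = (\<integral>x. f x \<partial>prod_measure \<mu>)"
    using integral_fst'[OF int] eq by simp
  show "integrable (prod_measure \<mu>) (\<lambda>y. \<integral>x. f (mix_coords W x y) \<partial>prod_measure \<mu>)"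
    using integrable_snd[OF int'] by simp
  show "(\<integral>y. (\<integral>x. f (mix_coords W x y) \<partial>prod_measure \<mu>) \<partial>prod_measure \<mu>) = (\<integral>x. f x \<partial>prod_measure \<mu>)"
    using integral_snd[OF int'] eq by (simp add: case_prod_unfold)
qed

lemma measurable_update_pair:
  "(\<lambda>z. (snd z)(i := fst z)) \<in> \<mu> i \<Otimes>\<^sub>M prod_measure \<mu> \<rightarrow>\<^sub>M prod_measure \<mu>"
proof (rule measurable_PiM_single')
  fix j
  show "(\<lambda>z. ((snd z)(i := fst z)) j) \<in> \<mu> i \<Otimes>\<^sub>M prod_measure \<mu> \<rightarrow>\<^sub>M \<mu> j"
    by (cases "j = i") auto
qed (auto simp: space_pair_measure space_PiM)

lemma measurable_update:
  assumes x: "x \<in> space (prod_measure \<mu>)"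
  shows "(\<lambda>t. x(i := t)) \<in> \<mu> i \<rightarrow>\<^sub>M prod_measure \<mu>"
proof (rule measurable_PiM_single')
  fix j
  show "(\<lambda>t. (x(i := t)) j) \<in> \<mu> i \<rightarrow>\<^sub>M \<mu> j"
    using x by (cases "j = i") (auto simp: space_prod)
qed (use x in \<open>auto simp: space_PiM\<close>)

lemma integral_coordinate:
  assumes "g \<in> borel_measurable (\<mu> i)"
  shows "(\<integral>y. g (y i) \<partial>prod_measure \<mu>) = (\<integral>t. g t \<partial>\<mu> i :: real)"
  using integral_distr[OF measurable_component_singleton[of i UNIV \<mu>] assms]
  by (simp add: distr_PiM_component prob_mu)

text \<open>The case \<open>W = {i}\<close> of splicing: the outer integrand depends on its point
  only through coordinate \<open>i\<close>, whose law is \<open>\<mu> i\<close>.\<close>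

lemma
  fixes h :: "('d \<Rightarrow> real) \<Rightarrow> real"
  assumes h: "integrable (prod_measure \<mu>) h"
  shows integrable_integral_update: "integrable (\<mu> i) (\<lambda>t. \<integral>y. h (y(i := t)) \<partial>prod_measure \<mu>)"
    and integral_integral_update: "(\<integral>t. (\<integral>y. h (y(i := t)) \<partial>prod_measure \<mu>) \<partial>\<mu> i) = (\<integral>y. h y \<partial>prod_measure \<mu>)"
proof -
  interpret nu: prob_space "prod_measure \<mu>" by (rule prob_space_prod)
  let ?H = "\<lambda>t. \<integral>y. h (y(i := t)) \<partial>prod_measure \<mu>"
  have mH: "?H \<in> borel_measurable (\<mu> i)"
    using nu.borel_measurable_lebesgue_integral[of "\<lambda>t y. h (y(i := t))" "\<mu> i"]
      measurable_compose[OF measurable_update_pair borel_measurable_integrable[OF h]]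
    by (simp add: case_prod_beta)
  have eq: "mix_coords {i} z y = y(i := z i)" for z y :: "'d \<Rightarrow> real"
    by (auto simp: mix_coords_def)
  have "integrable (prod_measure \<mu>) (\<lambda>z. ?H (z i))"
    using integrable_integral_mix_coords[OF h, of "{i}"] by (simp only: eq)
  then show "integrable (\<mu> i) ?H"
    using integrable_distr_eq[OF measurable_component_singleton[of i UNIV \<mu>] mH]
    by (simp add: distr_PiM_component prob_mu)
  show "(\<integral>t. ?H t \<partial>\<mu> i) = (\<integral>y. h y \<partial>prod_measure \<mu>)"
    using integral_integral_mix_coords[OF h, of "{i}"] integral_coordinate[OF mH] by (simp only: eq)
qed

text \<open>A version of the conditional expectation of \<open>f\<close> given the coordinates in
  \<open>W\<close>.\<close>

definition cond_mean :: "(('d \<Rightarrow> real) \<Rightarrow> real) \<Rightarrow> ('d \<Rightarrow> real) \<Rightarrow> 'd set \<Rightarrow> real" where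
  "cond_mean f x W = (\<integral>y. f (mix_coords W x y) \<partial>prod_measure \<mu>)"

text \<open>Jensen's inequality, as Cauchy-Schwarz against 1 on each slice: the squared mean is at
  most the mean of the square.\<close>

lemma square_integrable_cond_mean:
  assumes f: "square_integrable (prod_measure \<mu>) f"
  shows "square_integrable (prod_measure \<mu>) (\<lambda>x. cond_mean f x W)"
  unfolding square_integrable_def
proof
  interpret nu: prob_space "prod_measure \<mu>" by (rule prob_space_prod)
  note f1 = nu.square_integrable_integrable[OF f]
  show m: "(\<lambda>x. cond_mean f x W) \<in> borel_measurable (prod_measure \<mu>)"
    unfolding cond_mean_def by (rule borel_measurable_integrable[OF integrable_integral_mix_coords[OF f1]])
  show "integrable (prod_measure \<mu>) (\<lambda>x. (cond_mean f x W)\<^sup>2)"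
  proof (rule Bochner_Integration.integrable_bound)
    show "integrable (prod_measure \<mu>) (\<lambda>x. \<integral>y. (f (mix_coords W x y))\<^sup>2 \<partial>prod_measure \<mu>)"
      by (rule integrable_integral_mix_coords[OF square_integrable_square[OF f]])
    show "(\<lambda>x. (cond_mean f x W)\<^sup>2) \<in> borel_measurable (prod_measure \<mu>)" using m by simp
    show "AE x in prod_measure \<mu>. norm ((cond_mean f x W)\<^sup>2)
        \<le> norm (\<integral>y. (f (mix_coords W x y))\<^sup>2 \<partial>prod_measure \<mu>)"
      using AE_integrable_mix_coords[OF square_integrable_square[OF f], of W]
        AE_integrable_mix_coords[OF f1, of W]
    proof eventually_elim
      case (elim x)
      then have "square_integrable (prod_measure \<mu>) (\<lambda>y. f (mix_coords W x y))"
        by (simp add: square_integrable_def borel_measurable_integrable)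
      from integral_Cauchy_Schwarz[OF this nu.square_integrable_const[of 1]]
      show ?case by (simp add: cond_mean_def nu.prob_space)
    qed
  qed
qed

text \<open>The tower property of conditional expectation. Since \<open>i\<close> lies outside
  \<open>W\<close>, the update of \<open>x\<close> at \<open>i\<close> can be moved to the
  integrated point \<open>y\<close>.\<close>

lemma AE_integral_cond_mean_update:
  assumes f: "square_integrable (prod_measure \<mu>) f" and i: "i \<notin> W"
  shows "AE x in prod_measure \<mu>. integrable (\<mu> i) (\<lambda>t. cond_mean f (x(i := t)) (insert i W))
    \<and> (\<integral>t. cond_mean f (x(i := t)) (insert i W) \<partial>\<mu> i) = cond_mean f x W"
proof -
  interpret nu: prob_space "prod_measure \<mu>" by (rule prob_space_prod)
  show ?thesis
    using AE_integrable_mix_coords[OF nu.square_integrable_integrable[OF f], of W]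
  proof eventually_elim
    case (elim x)
    have eq: "mix_coords (insert i W) (x(i := t)) y = mix_coords W x (y(i := t))" for t y
      using i by (auto simp: mix_coords_def)
    show ?case
      unfolding cond_mean_def eq
      using integrable_integral_update[OF elim, of i] integral_integral_update[OF elim, of i] by simp
  qed
qed

text \<open>For \<open>i \<in> U\<close> the recursion for \<open>moebius_sum\<close> writes the
  component as a difference of two functions with the same integral over coordinate
  \<open>i\<close>; the other conditions follow from the inversion formula and the shape of
  \<open>cond_mean\<close>.\<close>

lemma sobol_hoeffding_exists:
  assumes f: "square_integrable (prod_measure \<mu>) f"
  shows "sobol_hoeffding \<mu> f (\<lambda>U x. moebius_sum (cond_mean f x) U)"
  unfolding sobol_hoeffding_def
proof (intro conjI allI ballI impI)
  interpret nu: prob_space "prod_measure \<mu>" by (rule prob_space_prod)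
  fix U
  show "square_integrable (prod_measure \<mu>) (\<lambda>x. moebius_sum (cond_mean f x) U)"
    unfolding moebius_sum_def
    by (intro square_integrable_sum square_integrable_scale square_integrable_cond_mean f)
next
  fix U and x y :: "'d \<Rightarrow> real"
  assume xy: "\<forall>i\<in>U. x i = y i"
  have "mix_coords W x z = mix_coords W y z" if "W \<in> Pow U" for W z
    using that xy unfolding mix_coords_def by fastforce
  then show "moebius_sum (cond_mean f x) U = moebius_sum (cond_mean f y) U"
    unfolding moebius_sum_def cond_mean_def by simp
next
  interpret nu: prob_space "prod_measure \<mu>" by (rule prob_space_prod)
  have "(\<Sum>U\<in>UNIV. moebius_sum (cond_mean f x) U) = f x" for x
    using sum_moebius_sum[of UNIV "cond_mean f x"]
    by (simp add: cond_mean_def mix_coords_def nu.prob_space)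
  then show "AE x in prod_measure \<mu>. f x = (\<Sum>U\<in>UNIV. moebius_sum (cond_mean f x) U)" by simp
next
  fix x :: "'d \<Rightarrow> real"
  show "moebius_sum (cond_mean f x) {} = (\<integral>z. f z \<partial>prod_measure \<mu>)"
    by (simp add: moebius_sum_def cond_mean_def mix_coords_def)
next
  fix U i assume "i \<in> (U :: 'd set)"
  then obtain V where U: "U = insert i V" and i: "i \<notin> V" by (meson mk_disjoint_insert)
  have "AE x in prod_measure \<mu>. \<forall>W\<in>Pow V. integrable (\<mu> i) (\<lambda>t. cond_mean f (x(i := t)) (insert i W))
    \<and> (\<integral>t. cond_mean f (x(i := t)) (insert i W) \<partial>\<mu> i) = cond_mean f x W"
    using i by (intro AE_finite_allI AE_integral_cond_mean_update f) auto
  then show "AE x in prod_measure \<mu>. (\<integral>t. moebius_sum (cond_mean f (x(i := t))) U \<partial>\<mu> i) = 0"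
  proof eventually_elim
    case (elim x)
    interpret mui: prob_space "\<mu> i" by (rule prob_mu)
    have const: "moebius_sum (cond_mean f (x(i := t))) V = moebius_sum (cond_mean f x) V" for t
    proof -
      have "mix_coords W (x(i := t)) y = mix_coords W x y" if "W \<in> Pow V" for W y
        using that i unfolding mix_coords_def by fastforce
      then show ?thesis unfolding moebius_sum_def cond_mean_def by simp
    qed
    have int: "integrable (\<mu> i) (\<lambda>t. moebius_sum (\<lambda>W. cond_mean f (x(i := t)) (insert i W)) V)"
      unfolding moebius_sum_def using elim by (intro Bochner_Integration.integrable_sum integrable_mult_right) auto
    have val: "(\<integral>t. moebius_sum (\<lambda>W. cond_mean f (x(i := t)) (insert i W)) V \<partial>\<mu> i)
        = moebius_sum (cond_mean f x) V"
      unfolding moebius_sum_def using elim by (subst Bochner_Integration.integral_sum) auto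
    show ?case
      unfolding U moebius_sum_insert[OF finite i] const
      using int val by (simp add: mui.prob_space)
  qed
qed

section \<open>Orthogonality of the components and the covariance formula\<close>

lemma sobol_component: "square_integrable (prod_measure \<mu>) f \<Longrightarrow> sobol_hoeffding \<mu> f (sobol_component \<mu> f)"
  unfolding sobol_component_def by (rule someI[of "sobol_hoeffding \<mu> f"], rule sobol_hoeffding_exists)

text \<open>Coordinate \<open>i\<close> is integrated first: there \<open>h\<close> is constant and
  the component integrates to zero.\<close>

lemma sobol_hoeffding_orthogonal_indep:
  assumes F: "sobol_hoeffding \<mu> f F" and i: "i \<in> U"
    and h: "square_integrable (prod_measure \<mu>) h"
    and indep: "\<And>x t. x \<in> space (prod_measure \<mu>) \<Longrightarrow> t \<in> space (\<mu> i) \<Longrightarrow> h (x(i := t)) = h x"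
  shows "(\<integral>x. F U x * h x \<partial>prod_measure \<mu>) = 0"
proof -
  have FU: "square_integrable (prod_measure \<mu>) (F U)" using F by (simp add: sobol_hoeffding_def)
  have int: "integrable (prod_measure \<mu>) (\<lambda>x. F U x * h x)" by (rule square_integrable_mult[OF FU h])
  have eq: "mix_coords {i} y x = x(i := y i)" for x y :: "'d \<Rightarrow> real"
    by (auto simp: mix_coords_def)
  have "(\<integral>x. F U x * h x \<partial>prod_measure \<mu>)
      = (\<integral>x. (\<integral>y. F U (x(i := y i)) * h (x(i := y i)) \<partial>prod_measure \<mu>) \<partial>prod_measure \<mu>)"
    using integral_integral_mix_coords'[OF int, of "{i}"] by (simp only: eq)
  also have "\<dots> = 0"
  proof (rule integral_eq_zero_AE)
    have "AE x in prod_measure \<mu>. (\<integral>t. F U (x(i := t)) \<partial>\<mu> i) = 0"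
      using F i by (simp add: sobol_hoeffding_def)
    then show "AE x in prod_measure \<mu>. (\<integral>y. F U (x(i := y i)) * h (x(i := y i)) \<partial>prod_measure \<mu>) = 0"
      using AE_space
    proof eventually_elim
      case (elim x)
      have "(\<integral>y. F U (x(i := y i)) * h (x(i := y i)) \<partial>prod_measure \<mu>)
          = (\<integral>y. F U (x(i := y i)) * h x \<partial>prod_measure \<mu>)"
        using elim indep by (intro Bochner_Integration.integral_cong refl) (simp add: space_prod)
      also have "\<dots> = (\<integral>y. F U (x(i := y i)) \<partial>prod_measure \<mu>) * h x" by simp
      also have "(\<integral>y. F U (x(i := y i)) \<partial>prod_measure \<mu>) = (\<integral>t. F U (x(i := t)) \<partial>\<mu> i)"
        by (rule integral_coordinate)
          (rule measurable_compose[OF measurable_update[OF elim(2)] square_integrable_measurable[OF FU]])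
      finally show ?case using elim(1) by (simp only: mult_zero_left)
    qed
  qed
  finally show ?thesis .
qed

text \<open>Some coordinate lies in exactly one of \<open>U\<close> and \<open>V\<close>, and one of
  the two components does not depend on it. The components may belong to different functions, as the
  covariance formula requires.\<close>

lemma sobol_hoeffding_orthogonal:
  assumes F: "sobol_hoeffding \<mu> f F" and G: "sobol_hoeffding \<mu> g G" and UV: "U \<noteq> V"
  shows "(\<integral>x. F U x * G V x \<partial>prod_measure \<mu>) = 0"
proof -
  have *: "(\<integral>x. F U x * G V x \<partial>prod_measure \<mu>) = 0"
    if F: "sobol_hoeffding \<mu> f F" and G: "sobol_hoeffding \<mu> g G" and i: "i \<in> U" "i \<notin> V"
    for F G f g U V i
  proof (rule sobol_hoeffding_orthogonal_indep[OF F i(1)])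
    show "square_integrable (prod_measure \<mu>) (G V)" using G by (simp add: sobol_hoeffding_def)
    fix x t assume x: "x \<in> space (prod_measure \<mu>)" "t \<in> space (\<mu> i)"
    then have "x(i := t) \<in> space (prod_measure \<mu>)" by (simp add: space_prod)
    moreover have "\<forall>j\<in>V. (x(i := t)) j = x j" using i by auto
    ultimately show "G V (x(i := t)) = G V x" using G x unfolding sobol_hoeffding_def by blast
  qed
  consider i where "i \<in> U" "i \<notin> V" | i where "i \<in> V" "i \<notin> U" using UV by blast
  then show ?thesis
  proof cases
    case 1
    then show ?thesis using *[OF F G] by blast
  next
    case 2
    then show ?thesis using *[OF G F] by (simp add: mult.commute)
  qed
qed

lemma expectation_sobol_component:
  assumes F: "sobol_hoeffding \<mu> f F" and U: "U \<noteq> {}"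
  shows "(\<integral>x. F U x \<partial>prod_measure \<mu>) = 0"
proof -
  interpret nu: prob_space "prod_measure \<mu>" by (rule prob_space_prod)
  obtain i where "i \<in> U" using U by auto
  from sobol_hoeffding_orthogonal_indep[OF F this nu.square_integrable_const[of 1]] show ?thesis by simp
qed

lemma variance_sobol_component:
  assumes F: "sobol_hoeffding \<mu> f F"
  shows "prob_space.variance (prod_measure \<mu>) (F U)
    = (if U = {} then 0 else \<integral>x. (F U x)\<^sup>2 \<partial>prod_measure \<mu>)"
proof (cases "U = {}")
  case True
  interpret nu: prob_space "prod_measure \<mu>" by (rule prob_space_prod)
  define m where "m = (\<integral>z. f z \<partial>prod_measure \<mu>)"
  have F0: "F {} x = m" if "x \<in> space (prod_measure \<mu>)" for x
    using F that unfolding sobol_hoeffding_def m_def by blast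
  have "nu.expectation (F {}) = m"
    using Bochner_Integration.integral_cong[OF refl F0, of "prod_measure \<mu>" "\<lambda>x. x"]
    by (simp add: nu.prob_space)
  moreover have "(\<integral>x. (F {} x - m)\<^sup>2 \<partial>prod_measure \<mu>) = (\<integral>x. 0 \<partial>prod_measure \<mu>)"
    by (rule Bochner_Integration.integral_cong) (simp_all add: F0)
  ultimately show ?thesis using True by simp
next
  case False
  then show ?thesis using expectation_sobol_component[OF F] by simp
qed

text \<open>Parseval's identity for the decomposition. The form with two functions is what expresses
  the distance of \<open>f\<close> and \<open>g\<close> through their components; the empty set is
  left out because its component is the mean.\<close>

lemma covariance_sobol_hoeffding:
  assumes F: "sobol_hoeffding \<mu> f F" and G: "sobol_hoeffding \<mu> g G"
    and f: "f \<in> borel_measurable (prod_measure \<mu>)" and g: "g \<in> borel_measurable (prod_measure \<mu>)"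
  shows "(\<integral>x. (f x - (\<integral>z. f z \<partial>prod_measure \<mu>)) * (g x - (\<integral>z. g z \<partial>prod_measure \<mu>)) \<partial>prod_measure \<mu>)
    = (\<Sum>U\<in>-{{}}. \<integral>x. F U x * G U x \<partial>prod_measure \<mu>)"
proof -
  have FU: "square_integrable (prod_measure \<mu>) (F U)" and GU: "square_integrable (prod_measure \<mu>) (G U)" for U
    using F G by (simp_all add: sobol_hoeffding_def)
  have centered: "AE x in prod_measure \<mu>. f x - (\<integral>z. f z \<partial>prod_measure \<mu>) = (\<Sum>U\<in>-{{}}. F U x)"
    if F: "sobol_hoeffding \<mu> f F" for f F
  proof -
    have "AE x in prod_measure \<mu>. f x = (\<Sum>U\<in>UNIV. F U x)"
      using F unfolding sobol_hoeffding_def by blast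
    then show ?thesis
      using AE_space
    proof eventually_elim
      case (elim x)
      have "(\<Sum>U\<in>UNIV. F U x) = F {} x + (\<Sum>U\<in>-{{}}. F U x)"
      proof -
        have "(UNIV :: 'd set set) = insert {} (-{{}})" by auto
        then show ?thesis using sum.insert[of "- {{}}" "{}" "\<lambda>U. F U x"] by simp
      qed
      moreover have "F {} x = (\<integral>z. f z \<partial>prod_measure \<mu>)"
        using F elim unfolding sobol_hoeffding_def by blast
      ultimately show ?case using elim(1) by linarith
    qed
  qed
  have "(\<integral>x. (f x - (\<integral>z. f z \<partial>prod_measure \<mu>)) * (g x - (\<integral>z. g z \<partial>prod_measure \<mu>)) \<partial>prod_measure \<mu>)
      = (\<integral>x. (\<Sum>U\<in>-{{}}. \<Sum>V\<in>-{{}}. F U x * G V x) \<partial>prod_measure \<mu>)"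
  proof (rule Bochner_Integration.integral_cong_AE)
    show "(\<lambda>x. (f x - (\<integral>z. f z \<partial>prod_measure \<mu>)) * (g x - (\<integral>z. g z \<partial>prod_measure \<mu>)))
        \<in> borel_measurable (prod_measure \<mu>)" using f g by simp
    show "(\<lambda>x. \<Sum>U\<in>-{{}}. \<Sum>V\<in>-{{}}. F U x * G V x) \<in> borel_measurable (prod_measure \<mu>)"
      by (intro borel_measurable_sum borel_measurable_times square_integrable_measurable FU GU)
    show "AE x in prod_measure \<mu>. (f x - (\<integral>z. f z \<partial>prod_measure \<mu>)) * (g x - (\<integral>z. g z \<partial>prod_measure \<mu>))
        = (\<Sum>U\<in>-{{}}. \<Sum>V\<in>-{{}}. F U x * G V x)"
      using centered[OF F] centered[OF G] by eventually_elim (simp only: sum_product)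
  qed
  also have "\<dots> = (\<Sum>U\<in>-{{}}. \<Sum>V\<in>-{{}}. \<integral>x. F U x * G V x \<partial>prod_measure \<mu>)"
    by (subst Bochner_Integration.integral_sum,
        (intro Bochner_Integration.integrable_sum square_integrable_mult FU GU),
        intro sum.cong refl, subst Bochner_Integration.integral_sum, (intro square_integrable_mult FU GU))
      (rule refl)
  also have "\<dots> = (\<Sum>U\<in>-{{}}. \<Sum>V\<in>-{{}}. if U = V then \<integral>x. F U x * G U x \<partial>prod_measure \<mu> else 0)"
    using sobol_hoeffding_orthogonal[OF F G] by (intro sum.cong refl) auto
  also have "\<dots> = (\<Sum>U\<in>-{{}}. \<integral>x. F U x * G U x \<partial>prod_measure \<mu>)" by (simp add: sum.delta)
  finally show ?thesis .
qed

end

text \<open>With \<open>a\<close> and \<open>b\<close> the normalised centred functions split by the indices into two orthogonal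
  parts of norms \<open>p, p'\<close> and \<open>q, q'\<close>, the number \<open>p q' - q p'\<close> is at most the sine of the angle
  between \<open>a\<close> and \<open>b\<close>, which is at most the relative error.\<close>

lemma index_difference_bounds:
  fixes D1 D2 C :: "'b \<Rightarrow> real"
  assumes I: "finite I" "\<A> \<subseteq> I" and D: "\<And>V. 0 \<le> D1 V" "\<And>V. 0 \<le> D2 V"
    and C: "\<And>V. V \<in> I \<Longrightarrow> (C V)\<^sup>2 \<le> D1 V * D2 V"
    and s: "s1 = (\<Sum>V\<in>I. D1 V)" "s2 = (\<Sum>V\<in>I. D2 V)" "0 < s1"
    and e: "s1 - 2 * (\<Sum>V\<in>I. C V) + s2 \<le> e"
    and S1: "S1 = (\<Sum>V\<in>\<A>. D1 V) / s1"
    and S2: "S2 = (if s2 = 0 then k else (\<Sum>V\<in>\<A>. D2 V) / s2)" and k: "0 \<le> k" "k \<le> 1"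
  shows "\<bar>S1 - S2\<bar> \<le> 1" "(S1 - S2)\<^sup>2 \<le> e / s1" "\<bar>S1 - S2\<bar> \<le> e / s1 + 2 * sqrt S1 * sqrt (e / s1)"
    "0 \<le> S1"
proof -
  define A1 where "A1 = (\<Sum>V\<in>\<A>. D1 V)"
  define A2 where "A2 = (\<Sum>V\<in>\<A>. D2 V)"
  define B1 where "B1 = (\<Sum>V\<in>I - \<A>. D1 V)"
  define B2 where "B2 = (\<Sum>V\<in>I - \<A>. D2 V)"
  have nn: "0 \<le> A1" "0 \<le> A2" "0 \<le> B1" "0 \<le> B2"
    using D by (simp_all add: A1_def A2_def B1_def B2_def sum_nonneg)
  have s1: "s1 = A1 + B1" and s2: "s2 = A2 + B2"
    using I by (simp_all add: s A1_def A2_def B1_def B2_def sum.subset_diff add.commute)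
  have S1': "S1 = A1 / s1" by (simp add: S1 A1_def)
  have S1b: "0 \<le> S1" "S1 \<le> 1" using nn s(3) by (simp_all add: S1' s1)
  have S2b: "0 \<le> S2" "S2 \<le> 1"
    using nn k by (simp_all add: S2 s2 A2_def[symmetric] divide_le_eq_1)
  show one: "\<bar>S1 - S2\<bar> \<le> 1" using S1b S2b by linarith
  show "0 \<le> S1" by (rule S1b)
  have cs: "(\<Sum>V\<in>B. C V) \<le> sqrt (\<Sum>V\<in>B. D1 V) * sqrt (\<Sum>V\<in>B. D2 V)" if "B \<subseteq> I" for B
  proof -
    have "(\<Sum>V\<in>B. C V) \<le> (\<Sum>V\<in>B. sqrt (D1 V) * sqrt (D2 V))"
    proof (rule sum_mono)
      fix V assume "V \<in> B"
      then have "(C V)\<^sup>2 \<le> D1 V * D2 V" using C that by auto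
      then have "\<bar>C V\<bar> \<le> sqrt (D1 V * D2 V)" by (metis real_sqrt_abs real_sqrt_le_iff)
      then show "C V \<le> sqrt (D1 V) * sqrt (D2 V)" by (simp add: real_sqrt_mult)
    qed
    also have "\<dots> \<le> \<bar>\<dots>\<bar>" by simp
    also have "\<dots> \<le> sqrt ((\<Sum>V\<in>B. (sqrt (D1 V))\<^sup>2) * (\<Sum>V\<in>B. (sqrt (D2 V))\<^sup>2))"
      using real_sqrt_le_mono[OF Cauchy_Schwarz_ineq_sum[of "\<lambda>V. sqrt (D1 V)" "\<lambda>V. sqrt (D2 V)" B]] by simp
    finally show ?thesis using D by (simp add: real_sqrt_mult)
  qed
  have c: "(\<Sum>V\<in>I. C V) \<le> sqrt A1 * sqrt A2 + sqrt B1 * sqrt B2"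
    using cs[of \<A>] cs[of "I - \<A>"] I by (simp add: A1_def A2_def B1_def B2_def sum.subset_diff[of \<A> I C])
  have "\<exists>\<delta>. \<bar>\<delta>\<bar> \<le> sqrt (e / s1) \<and> \<bar>S1 - S2\<bar> \<le> \<bar>\<delta>\<bar> \<and> \<bar>S1 - S2\<bar> \<le> \<bar>\<delta>\<bar> * (2 * sqrt S1 + \<bar>\<delta>\<bar>)"
  proof (cases "s2 = 0")
    case True
    then have "A2 = 0" "B2 = 0" using nn by (simp_all add: s2)
    \<comment> \<open>A constant approximation has relative error at least 1, so
      \<open>\<delta> = 1\<close> satisfies all three bounds whatever conventional value
      \<open>k\<close> its index has.\<close>
    then have "s1 \<le> e" using c e True by simp
    then have "1 \<le> sqrt (e / s1)" using s(3) by simp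
    moreover have "1 \<le> 2 * sqrt S1 + 1" using S1b by simp
    ultimately show ?thesis using one by (intro exI[of _ "1::real"]) (simp only: abs_one mult_1_left simp_thms)
  next
    case False
    then have s2p: "0 < s2" using nn s2 by simp
    define p where "p = sqrt (A1 / s1)"
    define p' where "p' = sqrt (B1 / s1)"
    define q where "q = sqrt (A2 / s2)"
    define q' where "q' = sqrt (B2 / s2)"
    define \<rho> where "\<rho> = sqrt (s2 / s1)"
    define \<delta> where "\<delta> = p * q' - q * p'"
    define x where "x = p * q + p' * q'"
    have pos: "0 \<le> p" "0 \<le> p'" "0 \<le> q" "0 \<le> q'" "0 \<le> \<rho>"
      using nn s(3) s2p by (simp_all add: p_def p'_def q_def q'_def \<rho>_def)
    have pp: "p\<^sup>2 + p'\<^sup>2 = 1" and qq: "q\<^sup>2 + q'\<^sup>2 = 1"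
      using nn s(3) s2p by (simp_all add: p_def p'_def q_def q'_def s1 s2 add_divide_distrib[symmetric])
    have pS: "p = sqrt S1" "S1 = p\<^sup>2" "S2 = q\<^sup>2"
      using nn s(3) s2p False by (simp_all add: p_def q_def S1' S2 A2_def)
    \<comment> \<open>Lagrange's identity: \<open>x\<close> is the cosine and
      \<open>\<delta>\<close> the sine of the angle between the unit vectors \<open>(p, p')\<close>
      and \<open>(q, q')\<close>.\<close>
    have dx: "\<delta>\<^sup>2 + x\<^sup>2 = 1"
    proof -
      have "\<delta>\<^sup>2 + x\<^sup>2 = (p\<^sup>2 + p'\<^sup>2) * (q\<^sup>2 + q'\<^sup>2)" by (simp add: \<delta>_def x_def power2_eq_square algebra_simps)
      then show ?thesis by (simp add: pp qq)
    qed
    have "sqrt A1 * sqrt A2 + sqrt B1 * sqrt B2 = s1 * \<rho> * x"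
    proof -
      have 1: "sqrt A1 = sqrt s1 * p" "sqrt B1 = sqrt s1 * p'" "sqrt A2 = sqrt s2 * q" "sqrt B2 = sqrt s2 * q'"
        using s(3) s2p by (simp_all add: p_def p'_def q_def q'_def real_sqrt_divide)
      have 2: "sqrt s1 * sqrt s2 = s1 * \<rho>"
        using s(3) by (simp add: \<rho>_def real_sqrt_divide real_div_sqrt field_simps)
      have "sqrt A1 * sqrt A2 + sqrt B1 * sqrt B2 = (sqrt s1 * sqrt s2) * x"
        unfolding 1 by (simp add: x_def algebra_simps)
      then show ?thesis by (simp only: 2)
    qed
    then have "s1 - 2 * (s1 * \<rho> * x) + s1 * \<rho>\<^sup>2 \<le> e"
      using c e s(3) s2p by (simp add: \<rho>_def)
    then have "s1 * (1 - 2 * \<rho> * x + \<rho>\<^sup>2) \<le> e" by (simp add: algebra_simps)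
    then have "1 - 2 * \<rho> * x + \<rho>\<^sup>2 \<le> e / s1" using s(3) by (simp add: pos_le_divide_eq mult.commute)
    \<comment> \<open>The scale \<open>\<rho>\<close> of the approximation is minimised away; the
      minimum \<open>1 - x^2\<close> is \<open>\<delta>^2\<close>.\<close>
    moreover have "1 - x\<^sup>2 \<le> 1 - 2 * \<rho> * x + \<rho>\<^sup>2"
      using zero_le_power2[of "\<rho> - x"] by (simp add: power2_diff)
    ultimately have "\<delta>\<^sup>2 \<le> e / s1" using dx by linarith
    then have "\<bar>\<delta>\<bar> \<le> sqrt (e / s1)" by (metis real_sqrt_abs real_sqrt_le_iff)
    moreover have diff: "S1 - S2 = \<delta> * (p * q' + q * p')"
    proof -
      have "\<delta> * (p * q' + q * p') = p\<^sup>2 * q'\<^sup>2 - q\<^sup>2 * p'\<^sup>2" by (simp add: \<delta>_def power2_eq_square algebra_simps)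
      also have "q'\<^sup>2 = 1 - q\<^sup>2" using qq by linarith
      also have "p'\<^sup>2 = 1 - p\<^sup>2" using pp by linarith
      finally have "\<delta> * (p * q' + q * p') = p\<^sup>2 - q\<^sup>2" by (simp add: algebra_simps)
      then show ?thesis by (simp only: pS(2,3))
    qed
    moreover have w: "0 \<le> p * q' + q * p'" using pos by simp
    moreover have "p * q' + q * p' \<le> 1"
    proof -
      have "(p * q' + q * p')\<^sup>2 + (p * q - p' * q')\<^sup>2 = (p\<^sup>2 + p'\<^sup>2) * (q\<^sup>2 + q'\<^sup>2)"
        by (simp add: power2_eq_square algebra_simps)
      then have "(p * q' + q * p')\<^sup>2 \<le> 1\<^sup>2"
        using zero_le_power2[of "p * q - p' * q'"] unfolding pp qq one_power2 mult_1_left by linarith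
      then show ?thesis by (rule power2_le_imp_le) simp
    qed
    \<comment> \<open>Expressing \<open>q p'\<close> through \<open>\<delta>\<close> leaves
      \<open>2 p q'\<close>, at most \<open>2 sqrt S1\<close>. This produces the bound that improves
      for small \<open>S1\<close>.\<close>
    moreover have "p * q' + q * p' \<le> 2 * sqrt S1 + \<bar>\<delta>\<bar>"
    proof -
      have "q'\<^sup>2 \<le> 1\<^sup>2" using qq zero_le_power2[of q] unfolding one_power2 by linarith
      then have "q' \<le> 1" by (rule power2_le_imp_le) simp
      then have "2 * (p * q') \<le> 2 * p" using pos by (simp add: mult_left_le)
      moreover have "p * q' + q * p' = 2 * (p * q') - \<delta>" by (simp add: \<delta>_def)
      ultimately show ?thesis using pS(1) by linarith
    qed
    ultimately show ?thesis
      by (intro exI[of _ \<delta>]) (simp add: abs_mult mult_left_le mult_left_mono)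
  qed
  then obtain \<delta> where d: "\<bar>\<delta>\<bar> \<le> sqrt (e / s1)" "\<bar>S1 - S2\<bar> \<le> \<bar>\<delta>\<bar>"
      "\<bar>S1 - S2\<bar> \<le> \<bar>\<delta>\<bar> * (2 * sqrt S1 + \<bar>\<delta>\<bar>)" by blast
  have "0 \<le> sqrt (e / s1)" using d(1) by linarith
  then have es: "0 \<le> e / s1" by (simp only: real_sqrt_ge_0_iff)
  then have r: "sqrt (e / s1) * sqrt (e / s1) = e / s1" by (simp only: real_sqrt_mult_self abs_of_nonneg)
  have "(S1 - S2)\<^sup>2 \<le> (sqrt (e / s1))\<^sup>2"
    using d by (intro abs_le_square_iff[THEN iffD1]) linarith
  then show "(S1 - S2)\<^sup>2 \<le> e / s1" using r by (simp add: power2_eq_square)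
  have "\<bar>\<delta>\<bar> * (2 * sqrt S1 + \<bar>\<delta>\<bar>) \<le> sqrt (e / s1) * (2 * sqrt S1 + sqrt (e / s1))"
    using d(1) S1b es by (intro mult_mono) auto
  then show "\<bar>S1 - S2\<bar> \<le> e / s1 + 2 * sqrt S1 * sqrt (e / s1)"
    using d(3) r by (simp add: algebra_simps)
qed

section \<open>Index errors in terms of the relative squared error\<close>

context
  fixes \<mu> :: "'d::finite \<Rightarrow> real measure"
  assumes prob_mu: "\<And>i. prob_space (\<mu> i)"
begin

text \<open>Sobol' and total-effect indices are both sums of component variances over a family of
  index sets, so one statement about an arbitrary family \<open>\<A>\<close> serves both.\<close>

lemma family_index_bounds:
  fixes \<A> :: "'d set set"
  assumes f: "square_integrable (prod_measure \<mu>) f" and g: "square_integrable (prod_measure \<mu>) g"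
    and var: "0 < prob_space.variance (prod_measure \<mu>) f"
  defines "e \<equiv> (\<integral>x. (f x - g x)\<^sup>2 \<partial>prod_measure \<mu>) / prob_space.variance (prod_measure \<mu>) f"
    and "S \<equiv> \<lambda>h. if prob_space.variance (prod_measure \<mu>) h = 0 then 1 / 2 ^ CARD('d)
      else (\<Sum>V\<in>\<A>. prob_space.variance (prod_measure \<mu>) (sobol_component \<mu> h V))
            / prob_space.variance (prod_measure \<mu>) h"
  shows "\<bar>S f - S g\<bar> \<le> 1" "(S f - S g)\<^sup>2 \<le> e" "\<bar>S f - S g\<bar> \<le> e + 2 * sqrt (S f) * sqrt e" "0 \<le> S f"
proof -
  interpret nu: prob_space "prod_measure \<mu>" by (rule prob_space_prod[OF prob_mu])
  define F where "F = sobol_component \<mu> f"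
  define G where "G = sobol_component \<mu> g"
  have F: "sobol_hoeffding \<mu> f F" and G: "sobol_hoeffding \<mu> g G"
    unfolding F_def G_def using f g by (simp_all add: sobol_component[OF prob_mu])
  have FU: "square_integrable (prod_measure \<mu>) (F U)" and GU: "square_integrable (prod_measure \<mu>) (G U)" for U
    using F G by (simp_all add: sobol_hoeffding_def)
  define I where "I = - {{} :: 'd set}"
  define C where "C U = (\<integral>x. F U x * G U x \<partial>prod_measure \<mu>)" for U
  have mf: "f \<in> borel_measurable (prod_measure \<mu>)" and mg: "g \<in> borel_measurable (prod_measure \<mu>)"
    using f g by (simp_all add: square_integrable_measurable)
  have vf: "nu.variance f = (\<Sum>V\<in>I. nu.variance (F V))"
    using covariance_sobol_hoeffding[OF prob_mu F F mf mf]
    by (simp add: power2_eq_square[symmetric] I_def variance_sobol_component[OF prob_mu F])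
  have vg: "nu.variance g = (\<Sum>V\<in>I. nu.variance (G V))"
    using covariance_sobol_hoeffding[OF prob_mu G G mg mg]
    by (simp add: power2_eq_square[symmetric] I_def variance_sobol_component[OF prob_mu G])
  have vfg: "(\<integral>x. (f x - nu.expectation f) * (g x - nu.expectation g) \<partial>prod_measure \<mu>) = (\<Sum>V\<in>I. C V)"
    using covariance_sobol_hoeffding[OF prob_mu F G mf mg] by (simp add: I_def C_def)
  \<comment> \<open>Only an inequality: the left side is the variance of \<open>f - g\<close>, and
    the means of \<open>f\<close> and \<open>g\<close> may differ.\<close>
  have le: "nu.variance f - 2 * (\<Sum>V\<in>I. C V) + nu.variance g \<le> (\<integral>x. (f x - g x)\<^sup>2 \<partial>prod_measure \<mu>)"
  proof -
    let ?f = "\<lambda>x. f x - nu.expectation f" and ?g = "\<lambda>x. g x - nu.expectation g"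
    have cf: "square_integrable (prod_measure \<mu>) ?f" and cg: "square_integrable (prod_measure \<mu>) ?g"
      using f g by (simp_all add: square_integrable_diff nu.square_integrable_const)
    have fg: "square_integrable (prod_measure \<mu>) (\<lambda>x. f x - g x)" using f g by (rule square_integrable_diff)
    note [simp] = square_integrable_square[OF cf] square_integrable_square[OF cg] square_integrable_mult[OF cf cg]
      nu.square_integrable_integrable[OF f] nu.square_integrable_integrable[OF g]
    have "nu.variance f - 2 * (\<Sum>V\<in>I. C V) + nu.variance g
        = (\<integral>x. (?f x)\<^sup>2 - 2 * (?f x * ?g x) + (?g x)\<^sup>2 \<partial>prod_measure \<mu>)"
      unfolding vfg[symmetric] by simp
    also have "\<dots> = nu.variance (\<lambda>x. f x - g x)"
      by (intro Bochner_Integration.integral_cong refl) (simp add: power2_eq_square algebra_simps)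
    also have "\<dots> \<le> (\<integral>x. (f x - g x)\<^sup>2 \<partial>prod_measure \<mu>)"
      using nu.variance_eq[OF nu.square_integrable_integrable[OF fg] square_integrable_square[OF fg]] by simp
    finally show ?thesis .
  qed
  have CI: "(C V)\<^sup>2 \<le> nu.variance (F V) * nu.variance (G V)" if "V \<in> I" for V
    using integral_Cauchy_Schwarz[OF FU GU, of V] that
    by (simp add: C_def I_def variance_sobol_component[OF prob_mu F] variance_sobol_component[OF prob_mu G])
  \<comment> \<open>The component of the empty set has variance zero, so a family may be cut down to
    the non-empty sets \<open>I\<close>.\<close>
  have drop: "(\<Sum>V\<in>\<A>. nu.variance (H V)) = (\<Sum>V\<in>\<A> \<inter> I. nu.variance (H V))"
    if H: "sobol_hoeffding \<mu> h H" for h H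
    using variance_sobol_component[OF prob_mu H, of "{}"]
    by (intro sum.mono_neutral_right) (auto simp: I_def)
  note bounds = index_difference_bounds[of I "\<A> \<inter> I" "\<lambda>V. nu.variance (F V)" "\<lambda>V. nu.variance (G V)" C
      "nu.variance f" "nu.variance g" "\<integral>x. (f x - g x)\<^sup>2 \<partial>prod_measure \<mu>" "S f" "S g" "1 / 2 ^ CARD('d)",
      OF _ _ nu.variance_positive nu.variance_positive CI vf vg var le]
  have Sf: "S f = (\<Sum>V\<in>\<A> \<inter> I. nu.variance (F V)) / nu.variance f"
    using var by (simp add: S_def F_def[symmetric] drop[OF F])
  have Sg: "S g = (if nu.variance g = 0 then 1 / 2 ^ CARD('d) else (\<Sum>V\<in>\<A> \<inter> I. nu.variance (G V)) / nu.variance g)"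
    by (simp add: S_def G_def[symmetric] drop[OF G])
  show "\<bar>S f - S g\<bar> \<le> 1" "(S f - S g)\<^sup>2 \<le> e" "\<bar>S f - S g\<bar> \<le> e + 2 * sqrt (S f) * sqrt e" "0 \<le> S f"
    unfolding e_def using bounds[OF _ _ _ Sf Sg] by simp_all
qed

lemma index_bounds:
  assumes f: "square_integrable (prod_measure \<mu>) f" and g: "square_integrable (prod_measure \<mu>) g"
    and var: "0 < prob_space.variance (prod_measure \<mu>) f"
    and S: "S \<in> {sobol_index \<mu>, total_effect_index \<mu>}"
  defines "e \<equiv> (\<integral>x. (f x - g x)\<^sup>2 \<partial>prod_measure \<mu>) / prob_space.variance (prod_measure \<mu>) f"
  shows "\<bar>S f U - S g U\<bar> \<le> 1" "(S f U - S g U)\<^sup>2 \<le> e"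
    "\<bar>S f U - S g U\<bar> \<le> e + 2 * sqrt (S f U) * sqrt e" "0 \<le> S f U"
proof -
  obtain \<A> where A: "\<And>h. S h U = (if prob_space.variance (prod_measure \<mu>) h = 0 then 1 / 2 ^ CARD('d)
      else (\<Sum>V\<in>\<A>. prob_space.variance (prod_measure \<mu>) (sobol_component \<mu> h V))
            / prob_space.variance (prod_measure \<mu>) h)"
  proof (cases "S = sobol_index \<mu>")
    case True
    then show ?thesis by (intro that[of "{U}"]) (simp add: sobol_index_def)
  next
    case False
    then have "S = total_effect_index \<mu>" using S by simp
    then show ?thesis
      by (intro that[of "{V. V \<inter> U \<noteq> {}}"]) (simp add: total_effect_index_def sobol_index_def sum_divide_distrib)
  qed
  show "\<bar>S f U - S g U\<bar> \<le> 1" "(S f U - S g U)\<^sup>2 \<le> e"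
    "\<bar>S f U - S g U\<bar> \<le> e + 2 * sqrt (S f U) * sqrt e" "0 \<le> S f U"
    unfolding A e_def using family_index_bounds[OF f g var, of \<A>] by blast+
qed

end

section \<open>Traces of positive operators under rank-one perturbations\<close>

text \<open>Vectors are functions of which only the entries below \<open>N\<close> matter, so the
  algebra of operators is expressed through \<open>dot\<close>.\<close>

definition dot :: "nat \<Rightarrow> (nat \<Rightarrow> real) \<Rightarrow> (nat \<Rightarrow> real) \<Rightarrow> real" where
  "dot N x y = (\<Sum>j<N. x j * y j)"

definition unit_vec_fun :: "nat \<Rightarrow> nat \<Rightarrow> real" where
  "unit_vec_fun i = (\<lambda>j. if j = i then 1 else 0)"

lemma dot_commute: "dot N x y = dot N y x"
  by (simp add: dot_def mult.commute)

lemma dot_scale_left: "dot N (\<lambda>j. a * x j) z = a * dot N x z"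
  by (simp add: dot_def algebra_simps sum_distrib_left)

lemma dot_diff_scale_left: "dot N (\<lambda>j. x j - a * y j) z = dot N x z - a * dot N y z"
  by (simp add: dot_def algebra_simps sum_distrib_left sum_subtractf)

lemma dot_diff_scale_right: "dot N z (\<lambda>j. x j - a * y j) = dot N z x - a * dot N z y"
  by (simp add: dot_commute[of N z] dot_diff_scale_left)

lemma dot_self_nonneg [simp]: "0 \<le> dot N x x"
  by (simp add: dot_def sum_nonneg)

lemma dot_unit_vec_left: "j < N \<Longrightarrow> dot N (unit_vec_fun j) x = x j"
  by (simp add: dot_def unit_vec_fun_def if_distrib[of "\<lambda>a. a * _"] cong: if_cong)

lemma dot_cauchy_schwarz: "(dot N x y)\<^sup>2 \<le> dot N x x * dot N y y"
  using Cauchy_Schwarz_ineq_sum[of x y "{..<N}"] by (simp add: dot_def power2_eq_square)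

lemma dot_parseval: "dot N x y = (\<Sum>j<N. dot N x (unit_vec_fun j) * dot N y (unit_vec_fun j))"
  by (simp add: dot_commute[of _ _ "unit_vec_fun _"] dot_unit_vec_left) (simp add: dot_def)

text \<open>Operators are arbitrary maps; self-adjointness already gives all the linearity that is used.\<close>

definition pos_op :: "nat \<Rightarrow> ((nat \<Rightarrow> real) \<Rightarrow> nat \<Rightarrow> real) \<Rightarrow> bool" where
  "pos_op N A \<longleftrightarrow> (\<forall>x y. dot N (A x) y = dot N x (A y)) \<and> (\<forall>x. 0 \<le> dot N x (A x))"

lemma pos_op_adjoint: "pos_op N A \<Longrightarrow> dot N (A x) y = dot N x (A y)"
  and pos_op_nonneg: "pos_op N A \<Longrightarrow> 0 \<le> dot N x (A x)"
  by (auto simp: pos_op_def)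

lemma pos_op_funpow_adjoint: "pos_op N A \<Longrightarrow> dot N ((A ^^ p) x) y = dot N x ((A ^^ p) y)"
  by (induction p arbitrary: x y) (simp_all add: pos_op_adjoint funpow_swap1)

text \<open>The form of \<open>A^(2m)\<close> at \<open>x\<close> is the squared norm of
  \<open>A^m x\<close>, and that of \<open>A^(2m+1)\<close> is the form of \<open>A\<close> at
  \<open>A^m x\<close>.\<close>

lemma pos_op_funpow:
  assumes A: "pos_op N A" shows "pos_op N (A ^^ p)"
proof -
  have "0 \<le> dot N x ((A ^^ p) x)" for x
  proof (cases "even p")
    case True
    then obtain m where p: "p = m + m" by (metis evenE mult_2)
    have "dot N x ((A ^^ p) x) = dot N ((A ^^ m) x) ((A ^^ m) x)"
      unfolding p funpow_add by (simp add: pos_op_funpow_adjoint[OF A])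
    then show ?thesis by simp
  next
    case False
    then obtain m where p: "p = m + Suc m" by (metis oddE mult_2 Suc_eq_plus1 add_Suc_right)
    have "dot N x ((A ^^ p) x) = dot N ((A ^^ m) x) (A ((A ^^ m) x))"
      unfolding p funpow_add by (simp add: pos_op_funpow_adjoint[OF A])
    then show ?thesis by (simp add: pos_op_nonneg[OF A])
  qed
  then show ?thesis
    unfolding pos_op_def using pos_op_funpow_adjoint[OF A] by blast
qed

lemma pos_op_cauchy_schwarz:
  assumes A: "pos_op N A"
  shows "(dot N x (A y))\<^sup>2 \<le> dot N x (A x) * dot N y (A y)"
proof -
  let ?a = "dot N y (A y)" and ?b = "dot N x (A y)" and ?c = "dot N x (A x)"
  have b': "dot N y (A x) = ?b"
    using pos_op_adjoint[OF A, of y x] by (simp add: dot_commute)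
  have q: "0 \<le> ?c - 2 * s * ?b + s\<^sup>2 * ?a" for s
  proof -
    let ?z = "\<lambda>j. x j - s * y j"
    \<comment> \<open>\<open>A\<close> is not assumed linear; moving it to the fixed argument
      \<open>u\<close> makes the form linear in \<open>?z\<close>.\<close>
    have lin: "dot N u (A ?z) = dot N u (A x) - s * dot N u (A y)" for u
      using pos_op_adjoint[OF A, of u ?z] pos_op_adjoint[OF A, of u x] pos_op_adjoint[OF A, of u y]
      by (simp add: dot_diff_scale_right)
    have "0 \<le> dot N ?z (A ?z)" by (rule pos_op_nonneg[OF A])
    also have "\<dots> = ?c - 2 * s * ?b + s\<^sup>2 * ?a"
      by (simp add: lin dot_diff_scale_left b' algebra_simps power2_eq_square)
    finally show ?thesis .
  qed
  show ?thesis
  proof (cases "?a = 0")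
    case True
    have "?b = 0"
    proof (rule ccontr)
      assume "?b \<noteq> 0"
      then show False using q[of "(?c + 1) / (2 * ?b)"] True by simp
    qed
    then show ?thesis using True by simp
  next
    case False
    then have "?a > 0" using pos_op_nonneg[OF A, of y] by simp
    then show ?thesis
      using q[of "?b / ?a"] by (simp add: field_simps power2_eq_square)
  qed
qed

text \<open>Log-convexity says that the ratios \<open>a (k+1) / a k\<close> increase where they are
  defined, so moving two indices apart with their sum kept fixed raises the product;
  \<open>0\<close> and \<open>i + k\<close> are the extreme pair.\<close>

lemma log_convex_mult_le:
  fixes a :: "nat \<Rightarrow> real"
  assumes nn: "\<And>k. 0 \<le> a k" and lc: "\<And>k. (a (Suc k))\<^sup>2 \<le> a k * a (Suc (Suc k))"
  shows "a i * a k \<le> a 0 * a (i + k)"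
proof -
  have step: "a (Suc j) * a k \<le> a j * a (Suc k)" if "j \<le> k" for j k
    using that
  proof (induction k rule: dec_induct)
    case base
    show ?case by simp
  next
    case (step k)
    show ?case
    proof (cases "a (Suc k) = 0")
      case True
      then show ?thesis using nn by simp
    next
      case False
      then have p: "a (Suc k) > 0" using nn[of "Suc k"] by simp
      have "a k \<noteq> 0"
      proof
        assume "a k = 0"
        then have "(a (Suc k))\<^sup>2 \<le> 0" using lc[of k] by simp
        then show False using p by simp
      qed
      then have pk: "a k > 0" using nn[of k] by simp
      have "(a (Suc j) * a (Suc k)) * a k \<le> (a j * a (Suc k)) * a (Suc k)"
        using mult_right_mono[OF step.IH, of "a (Suc k)"] p by (simp add: mult_ac)
      also have "\<dots> = a j * (a (Suc k))\<^sup>2" by (simp add: power2_eq_square)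
      also have "\<dots> \<le> a j * (a k * a (Suc (Suc k)))"
        by (rule mult_left_mono[OF lc nn])
      finally have "(a (Suc j) * a (Suc k)) * a k \<le> (a j * a (Suc (Suc k))) * a k"
        by (simp add: mult_ac)
      then show ?thesis using pk by simp
    qed
  qed
  have le: "a i * a k \<le> a 0 * a (i + k)" if "i \<le> k" for i k
    using that
  proof (induction i arbitrary: k)
    case 0
    show ?case by simp
  next
    case (Suc i)
    have "a (Suc i) * a k \<le> a i * a (Suc k)" using Suc.prems by (intro step) simp
    also have "\<dots> \<le> a 0 * a (i + Suc k)" using Suc.prems by (intro Suc.IH) simp
    finally show ?case by simp
  qed
  show ?thesis
    using le[of i k] le[of k i] by (cases "i \<le> k") (simp_all add: mult.commute add.commute)
qed

text \<open>The moments of \<open>v\<close> are log-convex by the Cauchy-Schwarz inequality for the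
  form of \<open>A^k\<close>, applied to \<open>v\<close> and \<open>A v\<close>. In spectral terms,
  powers of a nonnegative variable are positively correlated.\<close>

lemma pos_op_moment_mult_le:
  assumes A: "pos_op N A"
  shows "dot N v ((A ^^ i) v) * dot N v ((A ^^ k) v) \<le> dot N v v * dot N v ((A ^^ (i + k)) v)"
proof -
  have "dot N v ((A ^^ i) v) * dot N v ((A ^^ k) v)
      \<le> dot N v ((A ^^ 0) v) * dot N v ((A ^^ (i + k)) v)"
  proof (rule log_convex_mult_le)
    fix k
    show "0 \<le> dot N v ((A ^^ k) v)"
      by (rule pos_op_nonneg[OF pos_op_funpow[OF A]])
    have "(dot N v ((A ^^ Suc k) v))\<^sup>2 = (dot N v ((A ^^ k) (A v)))\<^sup>2"
      by (simp add: funpow_swap1)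
    also have "\<dots> \<le> dot N v ((A ^^ k) v) * dot N (A v) ((A ^^ k) (A v))"
      by (rule pos_op_cauchy_schwarz[OF pos_op_funpow[OF A]])
    also have "dot N (A v) ((A ^^ k) (A v)) = dot N v ((A ^^ Suc (Suc k)) v)"
      by (simp add: pos_op_adjoint[OF A] funpow_swap1)
    finally show "(dot N v ((A ^^ Suc k) v))\<^sup>2
        \<le> dot N v ((A ^^ k) v) * dot N v ((A ^^ Suc (Suc k)) v)" .
  qed
  then show ?thesis by simp
qed

text \<open>Jensen's inequality for the spectral measure of \<open>u\<close>, obtained by splitting
  off one factor \<open>A\<close> at a time with the moment inequality.\<close>

lemma pos_op_power_le_moment:
  assumes A: "pos_op N A" and u: "dot N u u = 1"
  shows "(dot N u (A u)) ^ p \<le> dot N u ((A ^^ p) u)"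
proof (induction p)
  case 0
  then show ?case by (simp add: u)
next
  case (Suc p)
  have "(dot N u (A u)) ^ Suc p \<le> dot N u (A u) * dot N u ((A ^^ p) u)"
    using mult_left_mono[OF Suc pos_op_nonneg[OF A, of u]] by simp
  also have "\<dots> \<le> dot N u ((A ^^ Suc p) u)"
    using pos_op_moment_mult_le[OF A, of u 1 p] u by simp
  finally show ?case .
qed

section \<open>Traces of powers\<close>

definition op_trace :: "nat \<Rightarrow> ((nat \<Rightarrow> real) \<Rightarrow> nat \<Rightarrow> real) \<Rightarrow> real" where
  "op_trace N A = (\<Sum>j<N. dot N (unit_vec_fun j) (A (unit_vec_fun j)))"

lemma pos_op_trace_nonneg: "pos_op N A \<Longrightarrow> 0 \<le> op_trace N A"
  by (simp add: op_trace_def sum_nonneg pos_op_nonneg)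

text \<open>Self-adjointness forces linearity in the entries below \<open>N\<close>, so the form is
  given by a matrix.\<close>

lemma pos_op_dot_eq_sum:
  assumes A: "pos_op N A"
  shows "dot N u (A w) = (\<Sum>j<N. \<Sum>l<N. u j * w l * dot N (unit_vec_fun j) (A (unit_vec_fun l)))"
proof -
  have "A w j = (\<Sum>l<N. w l * dot N (unit_vec_fun j) (A (unit_vec_fun l)))" if "j < N" for j
  proof -
    have "A w j = dot N (unit_vec_fun j) (A w)" using that by (simp add: dot_unit_vec_left)
    also have "\<dots> = dot N (A (unit_vec_fun j)) w" by (simp add: pos_op_adjoint[OF A])
    also have "\<dots> = (\<Sum>l<N. w l * dot N (A (unit_vec_fun j)) (unit_vec_fun l))"
      by (simp add: dot_commute[of _ _ "unit_vec_fun _"] dot_unit_vec_left)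
        (simp add: dot_def mult.commute)
    finally show ?thesis by (simp add: pos_op_adjoint[OF A])
  qed
  then have "dot N u (A w) = (\<Sum>j<N. u j * (\<Sum>l<N. w l * dot N (unit_vec_fun j) (A (unit_vec_fun l))))"
    by (simp add: dot_def)
  then show ?thesis by (simp add: sum_distrib_left mult.assoc)
qed

text \<open>This replaces the comparison of the largest eigenvalue with the trace. Off-diagonal
  entries are at most \<open>sqrt (d j) * sqrt (d l)\<close> in absolute value, which bounds the
  form by a perfect square, to which Cauchy-Schwarz applies.\<close>

lemma pos_op_quadratic_le_trace:
  assumes A: "pos_op N A"
  shows "dot N u (A u) \<le> dot N u u * op_trace N A"
proof -
  define d where "d j = dot N (unit_vec_fun j) (A (unit_vec_fun j))" for j
  have d: "0 \<le> d j" for j by (simp add: d_def pos_op_nonneg[OF A])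
  have ent: "\<bar>dot N (unit_vec_fun j) (A (unit_vec_fun l))\<bar> \<le> sqrt (d j) * sqrt (d l)" for j l
    using real_sqrt_le_mono[OF pos_op_cauchy_schwarz[OF A, of "unit_vec_fun j" "unit_vec_fun l"]]
    by (simp add: d_def real_sqrt_mult)
  have "dot N u (A u) \<le> (\<Sum>j<N. \<Sum>l<N. \<bar>u j\<bar> * \<bar>u l\<bar> * (sqrt (d j) * sqrt (d l)))"
  proof (subst pos_op_dot_eq_sum[OF A], intro sum_mono)
    fix j l
    have "u j * u l * dot N (unit_vec_fun j) (A (unit_vec_fun l))
        \<le> \<bar>u j * u l * dot N (unit_vec_fun j) (A (unit_vec_fun l))\<bar>" by simp
    also have "\<dots> \<le> \<bar>u j\<bar> * \<bar>u l\<bar> * (sqrt (d j) * sqrt (d l))"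
      unfolding abs_mult by (intro mult_left_mono ent) simp
    finally show "u j * u l * dot N (unit_vec_fun j) (A (unit_vec_fun l))
        \<le> \<bar>u j\<bar> * \<bar>u l\<bar> * (sqrt (d j) * sqrt (d l))" .
  qed
  also have "\<dots> = (\<Sum>j<N. \<bar>u j\<bar> * sqrt (d j))\<^sup>2"
    by (simp add: power2_eq_square sum_product mult_ac)
  also have "\<dots> \<le> (\<Sum>j<N. \<bar>u j\<bar>\<^sup>2) * (\<Sum>j<N. (sqrt (d j))\<^sup>2)"
    by (rule Cauchy_Schwarz_ineq_sum)
  also have "\<dots> = dot N u u * op_trace N A"
  proof -
    have "(\<Sum>j<N. (sqrt (d j))\<^sup>2) = op_trace N A"
      using d by (simp add: op_trace_def d_def)
    then show ?thesis by (simp add: dot_def power2_eq_square)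
  qed
  finally show ?thesis .
qed

text \<open>In the order of forms, \<open>A \<le> c\<close> gives \<open>A^2 \<le> c A\<close> (the
  fact \<open>sq\<close>). Applied at the vector \<open>A^m x\<close>, the first yields
  \<open>A^(p+1) \<le> c A^p\<close> for \<open>p = 2m\<close>, the second for
  \<open>p = 2m + 1\<close>.\<close>

lemma pos_op_trace_funpow_le:
  assumes A: "pos_op N A" and ub: "\<And>x. dot N x (A x) \<le> c * dot N x x" and c: "0 \<le> c"
  shows "op_trace N (A ^^ p) \<le> real N * c ^ p"
proof -
  have sq: "dot N (A y) (A y) \<le> c * dot N y (A y)" for y
  proof (cases "dot N (A y) (A y) = 0")
    case True
    then show ?thesis using c pos_op_nonneg[OF A, of y] by simp
  next
    case False
    then have p: "0 < dot N (A y) (A y)" using dot_self_nonneg[of N "A y"] by linarith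
    have "(dot N (A y) (A y))\<^sup>2 = (dot N y (A (A y)))\<^sup>2" by (simp add: pos_op_adjoint[OF A])
    also have "\<dots> \<le> dot N y (A y) * dot N (A y) (A (A y))"
      by (rule pos_op_cauchy_schwarz[OF A])
    also have "\<dots> \<le> dot N y (A y) * (c * dot N (A y) (A y))"
      by (intro mult_left_mono ub pos_op_nonneg[OF A])
    finally show ?thesis using p by (simp add: power2_eq_square mult_ac)
  qed
  have step: "dot N x ((A ^^ Suc p) x) \<le> c * dot N x ((A ^^ p) x)" for x p
  proof (cases "even p")
    case True
    then obtain m where p: "p = m + m" by (metis evenE mult_2)
    have "Suc p = m + Suc m" using p by simp
    then have "dot N x ((A ^^ Suc p) x) = dot N ((A ^^ m) x) (A ((A ^^ m) x))"
      unfolding funpow_add by (simp add: pos_op_funpow_adjoint[OF A] funpow_add funpow_swap1)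
    moreover have "dot N x ((A ^^ p) x) = dot N ((A ^^ m) x) ((A ^^ m) x)"
      unfolding p funpow_add by (simp add: pos_op_funpow_adjoint[OF A])
    ultimately show ?thesis using ub by simp
  next
    case False
    then obtain m where p: "p = m + Suc m" by (metis oddE mult_2 Suc_eq_plus1 add_Suc_right)
    have "Suc p = Suc m + Suc m" using p by simp
    then have "dot N x ((A ^^ Suc p) x) = dot N (A ((A ^^ m) x)) (A ((A ^^ m) x))"
      by (simp add: funpow_add pos_op_adjoint[OF A] pos_op_funpow_adjoint[OF A] funpow_swap1)
    moreover have "dot N x ((A ^^ p) x) = dot N ((A ^^ m) x) (A ((A ^^ m) x))"
      unfolding p funpow_add by (simp add: pos_op_funpow_adjoint[OF A])
    ultimately show ?thesis using sq by simp
  qed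
  have one: "dot N (unit_vec_fun j) ((A ^^ p) (unit_vec_fun j)) \<le> c ^ p" if "j < N" for j
  proof (induction p)
    case 0
    then show ?case using that by (simp add: dot_unit_vec_left) (simp add: unit_vec_fun_def)
  next
    case (Suc p)
    show ?case using order_trans[OF step mult_left_mono[OF Suc c]] by simp
  qed
  have "op_trace N (A ^^ p) \<le> (\<Sum>j<N. c ^ p)"
    unfolding op_trace_def using one by (intro sum_mono) simp
  then show ?thesis by simp
qed

section \<open>Rank-one updates\<close>

definition rank_one_update :: "nat \<Rightarrow> real \<Rightarrow> (nat \<Rightarrow> real) \<Rightarrow> ((nat \<Rightarrow> real) \<Rightarrow> nat \<Rightarrow> real)
    \<Rightarrow> (nat \<Rightarrow> real) \<Rightarrow> nat \<Rightarrow> real" where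
  "rank_one_update N t v A x = (\<lambda>j. A x j - t * dot N v x * v j)"

lemma dot_rank_one_update:
  "dot N y (rank_one_update N t v A x) = dot N y (A x) - t * dot N v x * dot N y v"
  unfolding rank_one_update_def using dot_diff_scale_right[of N y "A x" "t * dot N v x" v] by simp

text \<open>The telescoping identity \<open>A^p - B^p = sum_i B^(p-1-i) (A - B) A^i\<close>, where
  \<open>A - B = t v v^T\<close>.\<close>

lemma dot_funpow_diff:
  assumes B: "pos_op N (rank_one_update N t v A)"
  defines "B \<equiv> rank_one_update N t v A"
  shows "dot N y ((A ^^ p) x) - dot N y ((B ^^ p) x)
       = t * (\<Sum>i<p. dot N y ((B ^^ (p - 1 - i)) v) * dot N v ((A ^^ i) x))"
proof (induction p arbitrary: y)
  case 0
  show ?case by simp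
next
  case (Suc p)
  have B': "pos_op N B" using B by (simp add: B_def)
  have "dot N y ((A ^^ Suc p) x) = dot N y (B ((A ^^ p) x)) + t * dot N v ((A ^^ p) x) * dot N y v"
    by (simp add: B_def dot_rank_one_update)
  also have "dot N y (B ((A ^^ p) x)) = dot N (B y) ((A ^^ p) x)"
    by (simp add: pos_op_adjoint[OF B'])
  finally have "dot N y ((A ^^ Suc p) x) - dot N y ((B ^^ Suc p) x)
      = t * (\<Sum>i<p. dot N (B y) ((B ^^ (p - 1 - i)) v) * dot N v ((A ^^ i) x))
        + t * dot N v ((A ^^ p) x) * dot N y v"
    using Suc.IH[of "B y"] by (simp add: pos_op_adjoint[OF B'])
  also have "(\<Sum>i<p. dot N (B y) ((B ^^ (p - 1 - i)) v) * dot N v ((A ^^ i) x))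
      = (\<Sum>i<p. dot N y ((B ^^ (Suc p - 1 - i)) v) * dot N v ((A ^^ i) x))"
  proof (rule sum.cong[OF refl])
    fix i assume "i \<in> {..<p}"
    then have "Suc p - 1 - i = Suc (p - 1 - i)" by auto
    then show "dot N (B y) ((B ^^ (p - 1 - i)) v) * dot N v ((A ^^ i) x)
        = dot N y ((B ^^ (Suc p - 1 - i)) v) * dot N v ((A ^^ i) x)"
      by (simp add: pos_op_adjoint[OF B'])
  qed
  finally show ?case by (simp add: algebra_simps)
qed

text \<open>Telescoping under the trace gives
  \<open>tr A^(p+1) - tr B^(p+1) = t sum_i <v, B^(p-i) A^i v>\<close>. Replacing
  \<open>B^(p-i)\<close> by \<open>A^(p-i)\<close> costs, by a second telescoping, the bound
  \<open>b \<le> a\<close> and the moment inequality, at most \<open>t (p-i) a_0 a_(p-1)\<close> per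
  term. Summing \<open>p - i\<close> over \<open>i\<close> produces the factor 1/2.\<close>

lemma trace_funpow_rank_one_update_le:
  assumes A: "pos_op N A" and B: "pos_op N (rank_one_update N t v A)" and t: "0 \<le> t"
  shows "op_trace N (rank_one_update N t v A ^^ Suc p)
    \<le> op_trace N (A ^^ Suc p) - t * real (Suc p) * dot N v ((A ^^ p) v)
       + t\<^sup>2 / 2 * dot N v v * (real (Suc p) * real p * dot N v ((A ^^ (p - 1)) v))"
proof -
  define B where "B = rank_one_update N t v A"
  have B': "pos_op N B" using B by (simp add: B_def)
  define a where "a k = dot N v ((A ^^ k) v)" for k
  define b where "b k = dot N v ((B ^^ k) v)" for k
  have a0: "0 \<le> a k" and b0: "0 \<le> b k" for k
    by (simp_all add: a_def b_def pos_op_nonneg[OF pos_op_funpow[OF A]]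
        pos_op_nonneg[OF pos_op_funpow[OF B']])
  have diff: "dot N y ((A ^^ p) x) - dot N y ((B ^^ p) x)
      = t * (\<Sum>i<p. dot N y ((B ^^ (p - 1 - i)) v) * dot N v ((A ^^ i) x))" for p x y
    using dot_funpow_diff[OF B, of y p x] by (simp add: B_def)
  have ba: "b k \<le> a k" for k
  proof -
    have "0 \<le> a k - b k" unfolding a_def b_def diff
      using t a0 b0 by (intro mult_nonneg_nonneg sum_nonneg) (auto simp: a_def b_def)
    then show ?thesis by simp
  qed
  have mixed: "a (k + i) - t * real k * (a 0 * a (k + i - 1)) \<le> dot N v ((B ^^ k) ((A ^^ i) v))" for k i
  proof -
    have "dot N v ((A ^^ k) ((A ^^ i) v)) - dot N v ((B ^^ k) ((A ^^ i) v))
        = t * (\<Sum>j<k. b (k - 1 - j) * a (j + i))"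
      unfolding diff by (simp add: a_def b_def funpow_add)
    also have "\<dots> \<le> t * (\<Sum>j<k. a 0 * a (k + i - 1))"
    proof (intro mult_left_mono[OF sum_mono] t)
      fix j assume j: "j \<in> {..<k}"
      have "b (k - 1 - j) * a (j + i) \<le> a (k - 1 - j) * a (j + i)"
        by (intro mult_right_mono ba a0)
      also have "\<dots> \<le> a 0 * a (k - 1 - j + (j + i))"
        using pos_op_moment_mult_le[OF A, of v "k - 1 - j" "j + i"] by (simp add: a_def)
      also have "k - 1 - j + (j + i) = k + i - 1" using j by auto
      finally show "b (k - 1 - j) * a (j + i) \<le> a 0 * a (k + i - 1)" .
    qed
    moreover have "dot N v ((A ^^ k) ((A ^^ i) v)) = a (k + i)"
      by (simp add: a_def funpow_add)
    ultimately show ?thesis by (simp add: mult.assoc)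
  qed
  have "op_trace N (A ^^ Suc p) - op_trace N (B ^^ Suc p)
      = (\<Sum>j<N. t * (\<Sum>i<Suc p. dot N (unit_vec_fun j) ((B ^^ (p - i)) v)
                              * dot N v ((A ^^ i) (unit_vec_fun j))))"
    unfolding op_trace_def sum_subtractf[symmetric] diff by simp
  also have "\<dots> = t * (\<Sum>i<Suc p. \<Sum>j<N. dot N ((B ^^ (p - i)) v) (unit_vec_fun j)
                              * dot N ((A ^^ i) v) (unit_vec_fun j))"
    unfolding sum_distrib_left[symmetric]
    by (subst sum.swap) (simp only: pos_op_funpow_adjoint[OF A] dot_commute[of N "unit_vec_fun _"])
  also have "\<dots> = t * (\<Sum>i<Suc p. dot N v ((B ^^ (p - i)) ((A ^^ i) v)))"
    unfolding dot_parseval[symmetric] by (simp only: pos_op_funpow_adjoint[OF B'])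
  also have "\<dots> \<ge> t * (\<Sum>i<Suc p. a p - t * real (p - i) * (a 0 * a (p - 1)))"
  proof (intro mult_left_mono[OF sum_mono] t)
    fix i assume "i \<in> {..<Suc p}"
    then have "p - i + i = p" by auto
    then show "a p - t * real (p - i) * (a 0 * a (p - 1)) \<le> dot N v ((B ^^ (p - i)) ((A ^^ i) v))"
      using mixed[of "p - i" i] by simp
  qed
  also have "(\<Sum>i<Suc p. a p - t * real (p - i) * (a 0 * a (p - 1)))
      = real (Suc p) * a p - t * (a 0 * a (p - 1)) * (\<Sum>i<Suc p. real (p - i))"
    by (simp only: sum_subtractf sum_distrib_left sum_constant card_lessThan mult.assoc
        mult.commute[of "real (p - _)"])
  also have "(\<Sum>i<Suc p. real (p - i)) = real (Suc p) * real p / 2"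
  proof -
    have "(\<Sum>i<Suc p. real (p - i)) = (\<Sum>i<Suc p. real i)"
      using sum.nat_diff_reindex[of real "Suc p"] by simp
    also have "\<dots> = real (Suc p) * real p / 2"
      by (induction p) (simp_all add: field_simps)
    finally show ?thesis .
  qed
  finally have "t * (real (Suc p) * a p - t * (a 0 * a (p - 1)) * (real (Suc p) * real p / 2))
      \<le> op_trace N (A ^^ Suc p) - op_trace N (B ^^ Suc p)" .
  moreover have "t * (real (Suc p) * a p - t * (a 0 * a (p - 1)) * (real (Suc p) * real p / 2))
      = t * real (Suc p) * a p - t\<^sup>2 / 2 * a 0 * (real (Suc p) * real p * a (p - 1))"
    by (simp add: right_diff_distrib power2_eq_square)
  ultimately show ?thesis
    unfolding B_def a_def by simp
qed

section \<open>The truncated trace exponential\<close>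

definition trace_exp :: "nat \<Rightarrow> nat \<Rightarrow> ((nat \<Rightarrow> real) \<Rightarrow> nat \<Rightarrow> real) \<Rightarrow> real" where
  "trace_exp N M A = (\<Sum>p\<le>M. op_trace N (A ^^ p) / fact p)"

text \<open>The derivative of \<open>trace_exp N (Suc M)\<close> at \<open>A\<close> in the
  direction \<open>v v^T\<close>. Differentiation lowers the degree by one, hence the two different
  truncations below.\<close>

definition quad_exp :: "nat \<Rightarrow> nat \<Rightarrow> ((nat \<Rightarrow> real) \<Rightarrow> nat \<Rightarrow> real) \<Rightarrow> (nat \<Rightarrow> real) \<Rightarrow> real" where
  "quad_exp N M A v = (\<Sum>p\<le>M. dot N v ((A ^^ p) v) / fact p)"

text \<open>The Golden--Thompson inequality for a rank-one perturbation, to second order in \<open>t\<close>, with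
  the exponential series truncated so that only finite sums occur.\<close>

lemma trace_exp_rank_one_update_le:
  assumes A: "pos_op N A" and B: "pos_op N (rank_one_update N t v A)" and t: "0 \<le> t"
    and v: "dot N v v \<le> K"
  shows "trace_exp N (Suc M) (rank_one_update N t v A)
    \<le> trace_exp N (Suc M) A - (t - t\<^sup>2 / 2 * K) * quad_exp N M A v"
proof -
  define a where "a k = dot N v ((A ^^ k) v)" for k
  have a0: "0 \<le> a k" for k
    by (simp add: a_def pos_op_nonneg[OF pos_op_funpow[OF A]])
  let ?B = "rank_one_update N t v A"
  have summand: "op_trace N (?B ^^ Suc p) / fact (Suc p) \<le> op_trace N (A ^^ Suc p) / fact (Suc p)
     - t * (a p / fact p) + t\<^sup>2 / 2 * dot N v v * (real p * a (p - 1) / fact p)" for p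
  proof -
    have "op_trace N (?B ^^ Suc p) / fact (Suc p) \<le> (op_trace N (A ^^ Suc p) - t * real (Suc p) * a p
       + t\<^sup>2 / 2 * dot N v v * (real (Suc p) * real p * a (p - 1))) / fact (Suc p)"
      using trace_funpow_rank_one_update_le[OF A B t, of p]
      by (intro divide_right_mono) (simp_all only: a_def fact_ge_zero)
    also have "\<dots> = op_trace N (A ^^ Suc p) / fact (Suc p)
     - t * (a p / fact p) + t\<^sup>2 / 2 * dot N v v * (real p * a (p - 1) / fact p)"
    proof -
      have f: "(fact (Suc p) :: real) = real (Suc p) * fact p" by simp
      have "real (Suc p) * y / (real (Suc p) * fact p) = y / fact p" for y by simp
      then show ?thesis
        unfolding f add_divide_distrib diff_divide_distrib
        by (simp only: mult.assoc mult.left_commute[of _ "real (Suc p)"] times_divide_eq_right)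
    qed
    finally show ?thesis .
  qed
  have "trace_exp N (Suc M) ?B = op_trace N (?B ^^ 0) + (\<Sum>p\<le>M. op_trace N (?B ^^ Suc p) / fact (Suc p))"
    unfolding trace_exp_def sum.atMost_Suc_shift by simp
  also have "\<dots> \<le> op_trace N (A ^^ 0) + (\<Sum>p\<le>M. op_trace N (A ^^ Suc p) / fact (Suc p)
     - t * (a p / fact p) + t\<^sup>2 / 2 * dot N v v * (real p * a (p - 1) / fact p))"
    using sum_mono[of "{..M}", OF summand] by simp
  also have "\<dots> = trace_exp N (Suc M) A - t * quad_exp N M A v
     + t\<^sup>2 / 2 * dot N v v * (\<Sum>p\<le>M. real p * a (p - 1) / fact p)"
    unfolding trace_exp_def sum.atMost_Suc_shift quad_exp_def a_def
    by (simp add: sum.distrib sum_subtractf sum_distrib_left)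
  also have "\<dots> \<le> trace_exp N (Suc M) A - t * quad_exp N M A v + t\<^sup>2 / 2 * K * quad_exp N M A v"
  proof -
    \<comment> \<open>Since \<open>p / p! = 1 / (p-1)!\<close>, the second-order sum is the series
      of \<open>quad_exp\<close> without its last term. The summand for \<open>p = 0\<close>
      vanishes, so truncated subtraction does no harm.\<close>
    have "(\<Sum>p\<le>M. real p * a (p - 1) / fact p) \<le> quad_exp N M A v"
    proof (cases M)
      case 0
      then show ?thesis using a0[of 0] by (simp add: quad_exp_def a_def)
    next
      case (Suc m)
      have "(\<Sum>p\<le>M. real p * a (p - 1) / fact p) = (\<Sum>p\<le>m. a p / fact p)"
        unfolding Suc sum.atMost_Suc_shift by (simp del: of_nat_Suc add: of_nat_Suc[symmetric])
      also have "\<dots> \<le> (\<Sum>p\<le>M. a p / fact p)"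
        using a0 by (intro sum_mono2) (auto simp: Suc)
      finally show ?thesis by (simp add: quad_exp_def a_def)
    qed
    moreover have "0 \<le> quad_exp N M A v"
      unfolding quad_exp_def using a0 by (intro sum_nonneg) (simp add: a_def)
    ultimately have "t\<^sup>2 / 2 * dot N v v * (\<Sum>p\<le>M. real p * a (p - 1) / fact p)
        \<le> t\<^sup>2 / 2 * K * quad_exp N M A v"
      using v a0 order_trans[OF dot_self_nonneg v]
      by (intro mult_mono) (auto intro!: sum_nonneg)
    then show ?thesis by simp
  qed
  finally show ?thesis by (simp add: algebra_simps)
qed

section \<open>Lower tail of the sample Gram matrix\<close>

text \<open>The operator \<open>c I - t sum_(i<k) v_i v_i^T\<close>, built by successive updates so
  that each sample is one use of the rank-one trace inequality.\<close>

primrec sample_op :: "nat \<Rightarrow> real \<Rightarrow> real \<Rightarrow> (nat \<Rightarrow> nat \<Rightarrow> real) \<Rightarrow> nat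
    \<Rightarrow> (nat \<Rightarrow> real) \<Rightarrow> nat \<Rightarrow> real" where
  "sample_op N t c v 0 = (\<lambda>x j. c * x j)"
| "sample_op N t c v (Suc k) = rank_one_update N t (v k) (sample_op N t c v k)"

lemma dot_sample_op:
  "dot N y (sample_op N t c v k x) = c * dot N y x - t * (\<Sum>i<k. dot N (v i) x * dot N y (v i))"
proof (induction k)
  case 0
  show ?case
    using dot_scale_left[of N c x y] by (simp add: dot_commute[of N y])
next
  case (Suc k)
  then show ?case by (simp add: dot_rank_one_update algebra_simps)
qed

lemma sample_op_cong: "(\<And>i. i < k \<Longrightarrow> v i = w i) \<Longrightarrow> sample_op N t c v k = sample_op N t c w k"
  by (induction k) simp_all

lemma dot_sample_op_self_le:
  assumes "0 \<le> t"
  shows "dot N x (sample_op N t c v k x) \<le> c * dot N x x"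
  using assms unfolding dot_sample_op
  by (simp add: dot_commute[of N x "v _"] sum_nonneg flip: power2_eq_square)

text \<open>By Cauchy-Schwarz each \<open>v_i v_i^T\<close> is at most \<open>K\<close> in the order
  of forms, so the shift \<open>c\<close> outweighs the whole subtracted sum.\<close>

lemma pos_op_sample_op:
  assumes v: "\<And>i. i < k \<Longrightarrow> dot N (v i) (v i) \<le> K" and t: "0 \<le> t" and c: "t * real k * K \<le> c"
  shows "pos_op N (sample_op N t c v k)"
  unfolding pos_op_def
proof (intro conjI allI)
  fix x y
  have "dot N (sample_op N t c v k x) y = dot N y (sample_op N t c v k x)"
    by (rule dot_commute)
  also have "\<dots> = dot N x (sample_op N t c v k y)"
    unfolding dot_sample_op by (simp add: dot_commute[of N y] mult.commute dot_commute[of N x "v _"])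
  finally show "dot N (sample_op N t c v k x) y = dot N x (sample_op N t c v k y)" .
next
  fix x
  have "(\<Sum>i<k. (dot N (v i) x)\<^sup>2) \<le> (\<Sum>i<k. K * dot N x x)"
  proof (rule sum_mono)
    fix i assume "i \<in> {..<k}"
    then show "(dot N (v i) x)\<^sup>2 \<le> K * dot N x x"
      using v[of i] by (intro order_trans[OF dot_cauchy_schwarz] mult_right_mono) auto
  qed
  then have "t * (\<Sum>i<k. (dot N (v i) x)\<^sup>2) \<le> t * (real k * (K * dot N x x))"
    using t by (intro mult_left_mono) simp_all
  also have "\<dots> \<le> c * dot N x x"
    using mult_right_mono[OF c, of "dot N x x"] by (simp add: mult_ac)
  finally show "0 \<le> dot N x (sample_op N t c v k x)"
    unfolding dot_sample_op by (simp add: dot_commute[of N x "v _"] power2_eq_square)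
qed

lemma trace_exp_nonneg: "pos_op N A \<Longrightarrow> 0 \<le> trace_exp N M A"
  unfolding trace_exp_def
  by (intro sum_nonneg divide_nonneg_nonneg pos_op_trace_nonneg pos_op_funpow) auto

lemma trace_exp_le:
  assumes "pos_op N A" "\<And>x. dot N x (A x) \<le> c * dot N x x" "0 \<le> c"
  shows "trace_exp N M A \<le> real N * (\<Sum>p\<le>M. c ^ p / fact p)"
  unfolding trace_exp_def sum_distrib_left
  by (intro sum_mono) (simp add: divide_right_mono pos_op_trace_funpow_le[OF assms])

lemma sum_power_fact_le_exp: "0 \<le> (c::real) \<Longrightarrow> (\<Sum>p\<le>M. c ^ p / fact p) \<le> exp c"
  using sum_le_suminf[OF summable_exp[of c], of "{..M}"]
  by (simp add: exp_def divide_inverse mult.commute)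

text \<open>Exceptional samples are detected here: one unit vector with a large form value makes the
  trace exponential large, by Jensen's inequality and because the trace dominates the form.\<close>

lemma power_sum_le_trace_exp:
  assumes A: "pos_op N A" and u: "dot N u u = 1" and a: "0 \<le> a" "a \<le> dot N u (A u)"
  shows "(\<Sum>p\<le>M. a ^ p / fact p) \<le> trace_exp N M A"
  unfolding trace_exp_def
proof (intro sum_mono divide_right_mono)
  fix p
  have "a ^ p \<le> (dot N u (A u)) ^ p" using a by (intro power_mono)
  also have "\<dots> \<le> dot N u ((A ^^ p) u)" by (rule pos_op_power_le_moment[OF A u])
  also have "\<dots> \<le> op_trace N (A ^^ p)"
    using pos_op_quadratic_le_trace[OF pos_op_funpow[OF A], of u p] u by simp
  finally show "a ^ p \<le> op_trace N (A ^^ p)" .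
qed simp

text \<open>The argument \<open>Z x\<close> may itself depend on the sample, as iterating the
  operator demands.\<close>

lemma measurable_sample_op_app:
  assumes phi: "\<And>j. j < N \<Longrightarrow> \<phi> j \<in> borel_measurable \<nu>" and k: "k \<le> m"
    and Z: "\<And>j. j < N \<Longrightarrow> (\<lambda>x. Z x j) \<in> borel_measurable (Pi\<^sub>M {..<m} (\<lambda>_. \<nu>))" and l: "l < N"
  shows "(\<lambda>x. sample_op N t c (\<lambda>i j. \<phi> j (x i)) k (Z x) l) \<in> borel_measurable (Pi\<^sub>M {..<m} (\<lambda>_. \<nu>))"
  using k
proof (induction k)
  case 0
  then show ?case using Z[OF l] by simp
next
  case (Suc k)
  have ph: "(\<lambda>x. \<phi> j (x k)) \<in> borel_measurable (Pi\<^sub>M {..<m} (\<lambda>_. \<nu>))" if "j < N" for j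
    using Suc.prems by (intro measurable_compose[OF _ phi[OF that]] measurable_component_singleton) simp
  have "(\<lambda>x. dot N (\<lambda>j. \<phi> j (x k)) (Z x)) \<in> borel_measurable (Pi\<^sub>M {..<m} (\<lambda>_. \<nu>))"
    unfolding dot_def using ph Z by (intro borel_measurable_sum borel_measurable_times) auto
  then show ?case
    using Suc ph[OF l] by (simp add: rank_one_update_def)
qed

lemma measurable_sample_op_funpow:
  assumes phi: "\<And>j. j < N \<Longrightarrow> \<phi> j \<in> borel_measurable \<nu>" and k: "k \<le> m" and l: "l < N"
  shows "(\<lambda>x. (sample_op N t c (\<lambda>i j. \<phi> j (x i)) k ^^ p) u l) \<in> borel_measurable (Pi\<^sub>M {..<m} (\<lambda>_. \<nu>))"
  using l
proof (induction p arbitrary: l)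
  case 0
  then show ?case by simp
next
  case (Suc p)
  show ?case
    unfolding funpow.simps comp_def
    by (rule measurable_sample_op_app[OF phi k Suc.IH Suc.prems])
qed

lemma measurable_trace_exp_sample_op:
  assumes "\<And>j. j < N \<Longrightarrow> \<phi> j \<in> borel_measurable \<nu>" "k \<le> m"
  shows "(\<lambda>x. trace_exp N M (sample_op N t c (\<lambda>i j. \<phi> j (x i)) k))
    \<in> borel_measurable (Pi\<^sub>M {..<m} (\<lambda>_. \<nu>))"
  unfolding trace_exp_def op_trace_def dot_def
  by (intro borel_measurable_sum borel_measurable_divide borel_measurable_times
      measurable_sample_op_funpow assms) auto

section \<open>Expected trace exponential for a bounded orthonormal system\<close>

context
  fixes N :: nat and \<phi> :: "nat \<Rightarrow> 'a \<Rightarrow> real" and \<nu> :: "'a measure" and K :: real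
  assumes prob_nu: "prob_space \<nu>"
    and phi_meas: "\<And>j. j < N \<Longrightarrow> \<phi> j \<in> borel_measurable \<nu>"
    and phi_orth: "\<And>j l. j < N \<Longrightarrow> l < N \<Longrightarrow> (\<integral>y. \<phi> j y * \<phi> l y \<partial>\<nu>) = (if j = l then 1 else 0)"
    and phi_bound: "\<And>y. y \<in> space \<nu> \<Longrightarrow> (\<Sum>j<N. (\<phi> j y)\<^sup>2) \<le> K"
begin

lemma integrable_phi_mult: "j < N \<Longrightarrow> l < N \<Longrightarrow> integrable \<nu> (\<lambda>y. \<phi> j y * \<phi> l y)"
proof -
  assume j: "j < N" and l: "l < N"
  interpret prob_space \<nu> by (rule prob_nu)
  have "norm (\<phi> j y * \<phi> l y) \<le> K" if y: "y \<in> space \<nu>" for y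
  proof -
    have "\<bar>\<phi> i y\<bar> \<le> sqrt K" if "i < N" for i
    proof -
      have "(\<phi> i y)\<^sup>2 \<le> (\<Sum>j<N. (\<phi> j y)\<^sup>2)"
        using that by (intro member_le_sum) auto
      then show ?thesis using phi_bound[OF y] by (metis order_trans real_sqrt_abs real_sqrt_le_iff)
    qed
    from mult_mono[OF this[OF j] this[OF l]] show ?thesis
      using order_trans[OF sum_nonneg phi_bound[OF y]] by (simp add: abs_mult)
  qed
  then show ?thesis
    using j l phi_meas by (intro integrable_const_bound[of _ K] AE_I2 borel_measurable_times) auto
qed

text \<open>Orthonormality says that the random matrix \<open>\<phi> \<phi>^T\<close> has mean
  identity, so the mean of \<open><\<phi>, A^p \<phi>>\<close> is the trace of
  \<open>A^p\<close>.\<close>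

lemma integral_quad_exp:
  assumes A: "pos_op N A"
  shows "integrable \<nu> (\<lambda>y. quad_exp N M A (\<lambda>j. \<phi> j y))"
    and "(\<integral>y. quad_exp N M A (\<lambda>j. \<phi> j y) \<partial>\<nu>) = trace_exp N M A"
proof -
  have eq: "quad_exp N M A (\<lambda>j. \<phi> j y) = (\<Sum>p\<le>M. (\<Sum>j<N. \<Sum>l<N. \<phi> j y * \<phi> l y
      * dot N (unit_vec_fun j) ((A ^^ p) (unit_vec_fun l))) / fact p)" for y
    unfolding quad_exp_def
    by (intro sum.cong refl arg_cong2[of _ _ _ _ "(/)"] pos_op_dot_eq_sum pos_op_funpow A)
  show "integrable \<nu> (\<lambda>y. quad_exp N M A (\<lambda>j. \<phi> j y))"
    unfolding eq
    by (intro Bochner_Integration.integrable_sum integrable_divide_zero integrable_mult_left integrable_phi_mult)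
      auto
  have int: "integrable \<nu> (\<lambda>y. \<phi> j y * \<phi> l y * d)" if "j \<in> {..<N}" "l \<in> {..<N}" for j l d
    using that by (intro integrable_mult_left integrable_phi_mult) auto
  have "(\<integral>y. quad_exp N M A (\<lambda>j. \<phi> j y) \<partial>\<nu>) = (\<Sum>p\<le>M. (\<Sum>j<N. \<Sum>l<N. (\<integral>y. \<phi> j y * \<phi> l y \<partial>\<nu>)
      * dot N (unit_vec_fun j) ((A ^^ p) (unit_vec_fun l))) / fact p)"
    unfolding eq
    by (subst Bochner_Integration.integral_sum, (intro integrable_divide_zero Bochner_Integration.integrable_sum int; assumption),
        intro sum.cong refl, subst integral_divide_zero, intro arg_cong2[of _ _ _ _ "(/)"] refl,
        subst Bochner_Integration.integral_sum, (intro Bochner_Integration.integrable_sum int; assumption),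
        intro sum.cong refl, subst Bochner_Integration.integral_sum, (intro int; assumption)) simp
  also have "\<dots> = (\<Sum>p\<le>M. (\<Sum>j<N. \<Sum>l<N. (if j = l then 1 else 0)
      * dot N (unit_vec_fun j) ((A ^^ p) (unit_vec_fun l))) / fact p)"
    by (intro sum.cong refl arg_cong2[of _ _ _ _ "(/)"] arg_cong2[of _ _ _ _ "(*)"] phi_orth) auto
  also have "\<dots> = trace_exp N M A"
    unfolding trace_exp_def op_trace_def by (simp add: if_distrib[of "\<lambda>a. a * _"] cong: if_cong)
  finally show "(\<integral>y. quad_exp N M A (\<lambda>j. \<phi> j y) \<partial>\<nu>) = trace_exp N M A" .
qed

abbreviation "smp t c k x \<equiv> sample_op N t c (\<lambda>i j. \<phi> j (x i)) k"

lemma pos_op_smp: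
  assumes "x \<in> space (Pi\<^sub>M {..<m} (\<lambda>_. \<nu>))" "k \<le> m" "0 \<le> t" "t * real k * K \<le> c"
  shows "pos_op N (smp t c k x)"
  using assms by (intro pos_op_sample_op[where K = K])
    (auto simp: dot_def power2_eq_square space_PiM PiE_iff intro!: phi_bound[unfolded power2_eq_square])

lemma smp_bounds:
  assumes x: "x \<in> space (Pi\<^sub>M {..<m} (\<lambda>_. \<nu>))" "k \<le> m" "0 \<le> t" "t * real k * K \<le> c" and c: "0 \<le> c"
  shows "0 \<le> trace_exp N M (smp t c k x)" "trace_exp N M (smp t c k x) \<le> real N * exp c"
proof -
  note P = pos_op_smp[OF x]
  show "0 \<le> trace_exp N M (smp t c k x)" by (rule trace_exp_nonneg[OF P])
  have "trace_exp N M (smp t c k x) \<le> real N * (\<Sum>p\<le>M. c ^ p / fact p)"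
    by (intro trace_exp_le P dot_sample_op_self_le x c)
  also have "\<dots> \<le> real N * exp c"
    by (intro mult_left_mono sum_power_fact_le_exp c) simp
  finally show "trace_exp N M (smp t c k x) \<le> real N * exp c" .
qed

lemma integrable_trace_exp_smp:
  assumes "k \<le> m" "0 \<le> t" "t * real k * K \<le> c" "0 \<le> c"
  shows "integrable (Pi\<^sub>M {..<m} (\<lambda>_. \<nu>)) (\<lambda>x. trace_exp N M (smp t c k x))"
proof -
  interpret P: prob_space "Pi\<^sub>M {..<m} (\<lambda>_. \<nu>)"
    by (rule prob_space_PiM) (rule prob_nu)
  show ?thesis
    using smp_bounds[OF _ assms]
    by (intro P.integrable_const_bound[of _ "real N * exp c"] AE_I2 measurable_trace_exp_sample_op phi_meas)
      (auto simp: assms)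
qed

text \<open>With the earlier samples fixed, the rank-one inequality and
  \<open>integral_quad_exp\<close> subtract \<open>g\<close> times the trace exponential of degree
  \<open>M\<close>, not \<open>Suc M\<close>; the missing top term is the additive error.\<close>

lemma expectation_trace_exp_step:
  assumes t: "0 \<le> t" and c: "t * real (Suc k) * K \<le> c" "0 \<le> c" and K: "0 \<le> K"
    and g: "g = t - t\<^sup>2 / 2 * K" "0 \<le> g" "g \<le> 1"
  shows "(\<integral>x. trace_exp N (Suc M) (smp t c (Suc k) x) \<partial>Pi\<^sub>M {..<Suc k} (\<lambda>_. \<nu>))
    \<le> (1 - g) * (\<integral>x. trace_exp N (Suc M) (smp t c k x) \<partial>Pi\<^sub>M {..<k} (\<lambda>_. \<nu>))
       + real N * c ^ Suc M / fact (Suc M)"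
proof -
  interpret nu: prob_space \<nu> by (rule prob_nu)
  interpret product_prob_space "\<lambda>_::nat. \<nu>" UNIV by unfold_locales
  interpret Pk: prob_space "Pi\<^sub>M {..<k} (\<lambda>_. \<nu>)"
    by (rule prob_space_PiM) (rule prob_nu)
  have ck: "t * real k * K \<le> c"
    using c(1) mult_nonneg_nonneg[OF t K] by (simp add: algebra_simps)
  let ?\<delta> = "real N * c ^ Suc M / fact (Suc M)"
  have inner: "(\<integral>y. trace_exp N (Suc M) (smp t c (Suc k) (x(k := y))) \<partial>\<nu>)
      \<le> (1 - g) * trace_exp N (Suc M) (smp t c k x) + ?\<delta>"
    if x: "x \<in> space (Pi\<^sub>M {..<k} (\<lambda>_. \<nu>))" for x
  proof -
    define A where "A = smp t c k x"
    have A: "pos_op N A" unfolding A_def using x ck t by (intro pos_op_smp) auto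
    \<comment> \<open>The first \<open>k\<close> updates do not see the new sample point.\<close>
    have upd: "smp t c (Suc k) (x(k := y)) = rank_one_update N t (\<lambda>j. \<phi> j y) A" for y
      unfolding A_def using sample_op_cong[of k "\<lambda>i j. \<phi> j ((x(k := y)) i)" "\<lambda>i j. \<phi> j (x i)" N t c]
      by simp
    have xy: "x(k := y) \<in> space (Pi\<^sub>M {..<Suc k} (\<lambda>_. \<nu>))" if "y \<in> space \<nu>" for y
      using x that by (auto simp: space_PiM PiE_iff extensional_def)
    have B: "pos_op N (rank_one_update N t (\<lambda>j. \<phi> j y) A)" if "y \<in> space \<nu>" for y
      unfolding upd[symmetric] by (rule pos_op_smp[OF xy[OF that] order_refl t c(1)])
    have pw: "trace_exp N (Suc M) (rank_one_update N t (\<lambda>j. \<phi> j y) A)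
        \<le> trace_exp N (Suc M) A - g * quad_exp N M A (\<lambda>j. \<phi> j y)" if "y \<in> space \<nu>" for y
      unfolding g(1) using phi_bound[OF that]
      by (intro trace_exp_rank_one_update_le[OF A B[OF that] t]) (simp add: dot_def power2_eq_square)
    have "(\<integral>y. trace_exp N (Suc M) (smp t c (Suc k) (x(k := y))) \<partial>\<nu>)
        \<le> (\<integral>y. trace_exp N (Suc M) A - g * quad_exp N M A (\<lambda>j. \<phi> j y) \<partial>\<nu>)"
    proof (rule integral_mono)
      show "integrable \<nu> (\<lambda>y. trace_exp N (Suc M) (smp t c (Suc k) (x(k := y))))"
      proof (rule nu.integrable_const_bound[of _ "real N * exp c"])
        show "AE y in \<nu>. norm (trace_exp N (Suc M) (smp t c (Suc k) (x(k := y)))) \<le> real N * exp c"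
        proof (rule AE_I2)
          fix y assume y: "y \<in> space \<nu>"
          show "norm (trace_exp N (Suc M) (smp t c (Suc k) (x(k := y)))) \<le> real N * exp c"
            using smp_bounds[OF xy[OF y] order_refl t c, of "Suc M"] by (simp del: sample_op.simps)
        qed
        have m: "(\<lambda>y. x(k := y)) \<in> \<nu> \<rightarrow>\<^sub>M Pi\<^sub>M {..<Suc k} (\<lambda>_. \<nu>)"
          using measurable_component_update[of x "{..<k}" "\<lambda>_. \<nu>" k] x by (simp add: lessThan_Suc)
        show "(\<lambda>y. trace_exp N (Suc M) (smp t c (Suc k) (x(k := y)))) \<in> borel_measurable \<nu>"
          using measurable_compose[OF m measurable_trace_exp_sample_op[OF phi_meas order_refl]]
          by simp
      qed
      show "integrable \<nu> (\<lambda>y. trace_exp N (Suc M) A - g * quad_exp N M A (\<lambda>j. \<phi> j y))"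
        using integral_quad_exp(1)[OF A] by simp
    qed (simp only: upd pw)
    also have "\<dots> = trace_exp N (Suc M) A - g * trace_exp N M A"
      using integral_quad_exp[OF A] by (simp add: nu.prob_space)
    also have "\<dots> = (1 - g) * trace_exp N (Suc M) A + g * (op_trace N (A ^^ Suc M) / fact (Suc M))"
    proof -
      have "T + x - g * T = (1 - g) * (T + x) + g * x" for T x :: real by (simp add: algebra_simps)
      then show ?thesis unfolding trace_exp_def sum.atMost_Suc .
    qed
    also have "g * (op_trace N (A ^^ Suc M) / fact (Suc M)) \<le> 1 * (real N * c ^ Suc M / fact (Suc M))"
    proof (intro mult_mono divide_right_mono g)
      show "op_trace N (A ^^ Suc M) \<le> real N * c ^ Suc M"
        unfolding A_def
        by (intro pos_op_trace_funpow_le dot_sample_op_self_le t c A[unfolded A_def])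
    qed (auto intro!: divide_nonneg_nonneg pos_op_trace_nonneg pos_op_funpow A simp del: funpow.simps)
    finally show ?thesis by (simp add: A_def)
  qed
  have "(\<integral>x. trace_exp N (Suc M) (smp t c (Suc k) x) \<partial>Pi\<^sub>M {..<Suc k} (\<lambda>_. \<nu>))
      = (\<integral>x. (\<integral>y. trace_exp N (Suc M) (smp t c (Suc k) (x(k := y))) \<partial>\<nu>) \<partial>Pi\<^sub>M {..<k} (\<lambda>_. \<nu>))"
    unfolding lessThan_Suc
    by (rule product_integral_insert)
      (use integrable_trace_exp_smp[OF order_refl t c, of "Suc M"] in \<open>simp_all add: lessThan_Suc\<close>)
  also have "\<dots> \<le> (\<integral>x. (1 - g) * trace_exp N (Suc M) (smp t c k x) + ?\<delta> \<partial>Pi\<^sub>M {..<k} (\<lambda>_. \<nu>))"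
  proof (rule integral_mono')
    show "integrable (Pi\<^sub>M {..<k} (\<lambda>_. \<nu>)) (\<lambda>x. (1 - g) * trace_exp N (Suc M) (smp t c k x) + ?\<delta>)"
      using integrable_trace_exp_smp[OF order_refl t ck c(2)] by simp
    show "0 \<le> (1 - g) * trace_exp N (Suc M) (smp t c k x) + ?\<delta>"
      if "x \<in> space (Pi\<^sub>M {..<k} (\<lambda>_. \<nu>))" for x
      using g c smp_bounds(1)[OF that order_refl t ck c(2)] by simp
  qed (rule inner)
  also have "\<dots> = (1 - g) * (\<integral>x. trace_exp N (Suc M) (smp t c k x) \<partial>Pi\<^sub>M {..<k} (\<lambda>_. \<nu>)) + ?\<delta>"
    using integrable_trace_exp_smp[OF order_refl t ck c(2)] by (simp add: Pk.prob_space del: fact_Suc)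
  finally show ?thesis .
qed

text \<open>The start is bounded by \<open>N exp c\<close>. As \<open>1 - g \<le> 1\<close>, the
  truncation errors of the steps add up to at most \<open>k\<close> times a single one.\<close>

lemma expectation_trace_exp_le:
  assumes t: "0 \<le> t" and c: "t * real k * K \<le> c" "0 \<le> c" and K: "0 \<le> K"
    and g: "g = t - t\<^sup>2 / 2 * K" "0 \<le> g" "g \<le> 1"
  shows "(\<integral>x. trace_exp N (Suc M) (smp t c k x) \<partial>Pi\<^sub>M {..<k} (\<lambda>_. \<nu>))
    \<le> (1 - g) ^ k * (real N * exp c) + real k * (real N * c ^ Suc M / fact (Suc M))"
  using c(1)
proof (induction k)
  case 0
  interpret P: prob_space "Pi\<^sub>M {..<0::nat} (\<lambda>_. \<nu>)"
    by (rule prob_space_PiM) (rule prob_nu)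
  have "(\<integral>x. trace_exp N (Suc M) (smp t c 0 x) \<partial>Pi\<^sub>M {..<0::nat} (\<lambda>_. \<nu>)) \<le> real N * exp c"
    using smp_bounds(2)[of _ 0 0 t c "Suc M"] t c
    by (intro P.integral_le_const integrable_trace_exp_smp) (auto simp del: sample_op.simps)
  then show ?case by simp
next
  case (Suc k)
  let ?\<delta> = "real N * c ^ Suc M / fact (Suc M)"
  have ck: "t * real k * K \<le> c"
    using Suc.prems mult_nonneg_nonneg[OF t K] by (simp add: algebra_simps)
  have "(\<integral>x. trace_exp N (Suc M) (smp t c (Suc k) x) \<partial>Pi\<^sub>M {..<Suc k} (\<lambda>_. \<nu>))
      \<le> (1 - g) * (\<integral>x. trace_exp N (Suc M) (smp t c k x) \<partial>Pi\<^sub>M {..<k} (\<lambda>_. \<nu>)) + ?\<delta>"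
    by (rule expectation_trace_exp_step[OF t Suc.prems c(2) K g])
  also have "\<dots> \<le> (1 - g) * ((1 - g) ^ k * (real N * exp c) + real k * ?\<delta>) + ?\<delta>"
    using g by (intro add_right_mono mult_left_mono Suc.IH ck) simp
  also have "\<dots> = (1 - g) ^ Suc k * (real N * exp c) + (1 - g) * (real k * ?\<delta>) + ?\<delta>"
    by (simp add: algebra_simps)
  also have "(1 - g) * (real k * ?\<delta>) \<le> 1 * (real k * ?\<delta>)"
    using g c(2) by (intro mult_right_mono) simp_all
  finally show ?case by (simp only: of_nat_Suc distrib_right mult_1_left add.assoc add.commute[of 1])
qed

text \<open>Instead of an event, which would have to be shown measurable, the exceptional samples are
  controlled by a test function \<open>F\<close> that is at least \<open>1\<close> on all of them.\<close>

lemma matrix_chernoff_lower_tail: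
  assumes K: "1 \<le> K" and \<epsilon>: "0 < \<epsilon>"
  obtains F where "integrable (Pi\<^sub>M {..<n} (\<lambda>_. \<nu>)) F"
    "\<And>x. x \<in> space (Pi\<^sub>M {..<n} (\<lambda>_. \<nu>)) \<Longrightarrow> 0 \<le> F x"
    "(\<integral>x. F x \<partial>Pi\<^sub>M {..<n} (\<lambda>_. \<nu>)) \<le> real N * exp (- (real n / (8 * K))) + \<epsilon>"
    "\<And>x u. x \<in> space (Pi\<^sub>M {..<n} (\<lambda>_. \<nu>)) \<Longrightarrow> F x < 1 \<Longrightarrow>
       real n / 2 * dot N u u \<le> (\<Sum>i<n. (dot N (\<lambda>j. \<phi> j (x i)) u)\<^sup>2)"
proof -
  \<comment> \<open>The exponent to be gained is \<open>n (t - t^2 K / 2) - t n / 2\<close>, and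
    \<open>t = 1 / (2 K)\<close> maximises it with value \<open>n / (8 K)\<close>. The shift
    \<open>c\<close> is \<open>t n K\<close>, just enough for positivity, and
    \<open>a = c - t n / 2\<close> is the form value that an exceptional sample reaches.\<close>
  define t where "t = 1 / (2 * K)"
  define c where "c = real n / 2"
  define g where "g = 3 / (8 * K)"
  define a where "a = c - real n / (4 * K)"
  have t: "0 \<le> t" using K by (simp add: t_def)
  have c: "t * real n * K \<le> c" "0 \<le> c" using K by (simp_all add: t_def c_def)
  have g: "g = t - t\<^sup>2 / 2 * K" "0 \<le> g" "g \<le> 1"
    using K by (simp_all add: g_def t_def field_simps power2_eq_square)
  have a: "0 \<le> a"
  proof -
    have "real n / (4 * K) \<le> real n / 2"
      using K by (intro divide_left_mono) auto
    then show ?thesis by (simp add: a_def c_def)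
  qed
  define h where "h M = (\<Sum>p\<le>M. a ^ p / fact p)" for M
  have h1: "1 \<le> h M" for M
    unfolding h_def using member_le_sum[of 0 "{..M}" "\<lambda>p. a ^ p / fact p"] a by simp
  have h_lim: "h \<longlonglongrightarrow> exp a"
    using exp_converges[of a] unfolding sums_def_le h_def by (simp add: divide_inverse mult.commute)
  have \<delta>_lim: "(\<lambda>M. real N * (c ^ M / fact M)) \<longlonglongrightarrow> 0"
    using tendsto_mult_right_zero[OF summable_LIMSEQ_zero[OF summable_exp[of c]], of "real N"]
    by (simp add: divide_inverse mult.commute)
  \<comment> \<open>For fixed \<open>n\<close> the truncation degree tends to infinity. The limit
    lies strictly below the target because of \<open>\<epsilon>\<close>, so a finite degree
    \<open>M\<close> is good enough.\<close>
  have "(\<lambda>M. ((1 - g) ^ n * (real N * exp c) + real n * (real N * (c ^ Suc M / fact (Suc M)))) / h (Suc M))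
      \<longlonglongrightarrow> ((1 - g) ^ n * (real N * exp c) + real n * 0) / exp a"
    by (intro tendsto_divide tendsto_add tendsto_mult_left tendsto_const
        LIMSEQ_Suc[OF \<delta>_lim] LIMSEQ_Suc[OF h_lim]) simp
  moreover have "((1 - g) ^ n * (real N * exp c) + real n * 0) / exp a < real N * exp (- (real n / (8 * K))) + \<epsilon>"
  proof -
    have "(1 - g) ^ n \<le> exp (- g) ^ n"
      using g(3) exp_ge_add_one_self[of "- g"] by (intro power_mono) simp_all
    then have "(1 - g) ^ n * (real N * exp c) \<le> exp (- g) ^ n * (real N * exp c)"
      by (intro mult_right_mono) simp_all
    then have "((1 - g) ^ n * (real N * exp c) + real n * 0) / exp a \<le> exp (- g) ^ n * (real N * exp c) / exp a"
      by (simp add: divide_right_mono)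
    also have "\<dots> = real N * exp (real n * (- g) + c - a)"
      by (simp only: exp_diff exp_add exp_of_nat_mult) (simp add: mult_ac)
    also have "real n * (- g) + c - a = - (real n / (8 * K))"
      using K by (simp add: g_def a_def field_simps)
    finally show ?thesis using \<epsilon> by simp
  qed
  ultimately have "\<forall>\<^sub>F M in sequentially. ((1 - g) ^ n * (real N * exp c)
      + real n * (real N * (c ^ Suc M / fact (Suc M)))) / h (Suc M) < real N * exp (- (real n / (8 * K))) + \<epsilon>"
    by (rule order_tendstoD(2))
  then obtain M where M: "((1 - g) ^ n * (real N * exp c)
      + real n * (real N * (c ^ Suc M / fact (Suc M)))) / h (Suc M) < real N * exp (- (real n / (8 * K))) + \<epsilon>"
    by (meson eventually_happens sequentially_bot)
  define F where "F x = trace_exp N (Suc M) (smp t c n x) / h (Suc M)" for x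
  have hp: "0 < h (Suc M)" using h1[of "Suc M"] by linarith
  show thesis
  proof (rule that[of F])
    show "integrable (Pi\<^sub>M {..<n} (\<lambda>_. \<nu>)) F"
      unfolding F_def using integrable_trace_exp_smp[OF order_refl t c] by simp
    show "0 \<le> F x" if "x \<in> space (Pi\<^sub>M {..<n} (\<lambda>_. \<nu>))" for x
      unfolding F_def using smp_bounds(1)[OF that order_refl t c] hp by simp
    have "(\<integral>x. F x \<partial>Pi\<^sub>M {..<n} (\<lambda>_. \<nu>))
        = (\<integral>x. trace_exp N (Suc M) (smp t c n x) \<partial>Pi\<^sub>M {..<n} (\<lambda>_. \<nu>)) / h (Suc M)"
      unfolding F_def by simp
    also have "\<dots> \<le> ((1 - g) ^ n * (real N * exp c)
        + real n * (real N * (c ^ Suc M / fact (Suc M)))) / h (Suc M)"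
      using expectation_trace_exp_le[OF t c _ g, of M] K hp
      by (intro divide_right_mono) simp_all
    finally show "(\<integral>x. F x \<partial>Pi\<^sub>M {..<n} (\<lambda>_. \<nu>)) \<le> real N * exp (- (real n / (8 * K))) + \<epsilon>"
      using M by simp
    show "real n / 2 * dot N u u \<le> (\<Sum>i<n. (dot N (\<lambda>j. \<phi> j (x i)) u)\<^sup>2)"
      if x: "x \<in> space (Pi\<^sub>M {..<n} (\<lambda>_. \<nu>))" and F: "F x < 1" for x u
    proof (rule ccontr)
      assume neg: "\<not> ?thesis"
      define q where "q = dot N u u"
      have q: "0 < q"
      proof (rule ccontr)
        assume "\<not> 0 < q"
        then have "q = 0" using dot_self_nonneg[of N u] by (simp add: q_def)
        with neg show False by (simp add: q_def sum_nonneg)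
      qed
      define w where "w = (\<lambda>j. (1 / sqrt q) * u j)"
      have dw: "dot N y w = dot N y u / sqrt q" for y
        unfolding w_def dot_commute[of N y] dot_scale_left by simp
      have w1: "dot N w w = 1"
        using q dw[of w] dw[of u] dot_commute[of N w u] by (simp add: q_def[symmetric])
      have "(\<Sum>i<n. (dot N (\<lambda>j. \<phi> j (x i)) w)\<^sup>2) = (\<Sum>i<n. (dot N (\<lambda>j. \<phi> j (x i)) u)\<^sup>2) / q"
        using q by (simp add: dw power_divide sum_divide_distrib)
      also have "\<dots> < real n / 2"
        using neg q by (simp add: q_def[symmetric] field_simps)
      finally have "(\<Sum>i<n. (dot N (\<lambda>j. \<phi> j (x i)) w)\<^sup>2) < real n / 2" .
      then have "t * (\<Sum>i<n. (dot N (\<lambda>j. \<phi> j (x i)) w)\<^sup>2) \<le> t * (real n / 2)"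
        using t by (intro mult_left_mono) auto
      then have "a \<le> dot N w (smp t c n x w)"
        unfolding dot_sample_op using w1
        by (simp add: dot_commute[of N w "\<lambda>j. \<phi> j _"] power2_eq_square a_def t_def)
      then have "h (Suc M) \<le> trace_exp N (Suc M) (smp t c n x)"
        unfolding h_def using a w1 pos_op_smp[OF x order_refl t c(1)]
        by (intro power_sum_le_trace_exp) auto
      then show False using F hp by (simp add: F_def)
    qed
  qed
qed

end

section \<open>Least squares\<close>

lemma gram_mult_vec_index:
  assumes w: "w \<in> carrier_vec N" and j: "j < N"
  shows "vec_index ((transpose_mat (design_matrix \<phi> n N x) * design_matrix \<phi> n N x) *\<^sub>v w) j
    = (\<Sum>k<n. \<phi> j (x k) * dot N (\<lambda>l. \<phi> l (x k)) (\<lambda>l. vec_index w l))"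
proof -
  let ?\<Phi> = "design_matrix \<phi> n N x"
  have P: "?\<Phi> \<in> carrier_mat n N" by (simp add: design_matrix_def)
  have "(transpose_mat ?\<Phi> * ?\<Phi>) *\<^sub>v w = transpose_mat ?\<Phi> *\<^sub>v (?\<Phi> *\<^sub>v w)"
    using P w by (intro assoc_mult_mat_vec[of _ N n _ N]) auto
  then show ?thesis
    using w j by (simp add: design_matrix_def scalar_prod_def dot_def atLeast0LessThan)
qed

lemma design_transpose_mult_index:
  assumes "j < N"
  shows "vec_index (transpose_mat (design_matrix \<phi> n N x) *\<^sub>v Matrix.vec n y) j
    = (\<Sum>k<n. \<phi> j (x k) * y k)"
  using assms by (simp add: design_matrix_def scalar_prod_def atLeast0LessThan)

text \<open>The stability inequality excludes a non-zero kernel vector of the Gram matrix, so its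
  determinant is non-zero and the coefficients come from the inverse, not from the default
  0.\<close>

lemma ols_normal_equations:
  assumes n: "0 < n"
    and stab: "\<And>u. real n / 2 * dot N u u \<le> (\<Sum>k<n. (dot N (\<lambda>j. \<phi> j (x k)) u)\<^sup>2)"
    and j: "j < N"
  shows "(\<Sum>k<n. \<phi> j (x k) * dot N (\<lambda>l. \<phi> l (x k)) (\<lambda>l. vec_index (ols_coeffs \<phi> n N x y) l))
    = (\<Sum>k<n. \<phi> j (x k) * y k)"
proof -
  let ?\<Phi> = "design_matrix \<phi> n N x"
  let ?G = "transpose_mat ?\<Phi> * ?\<Phi>"
  have P: "?\<Phi> \<in> carrier_mat n N" by (simp add: design_matrix_def)
  have G: "?G \<in> carrier_mat N N" using P by auto
  have det: "Determinant.det ?G \<noteq> 0"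
  proof
    assume "Determinant.det ?G = 0"
    then obtain v where v: "v \<in> carrier_vec N" "v \<noteq> 0\<^sub>v N" "?G *\<^sub>v v = 0\<^sub>v N"
      using det_0_iff_vec_prod_zero_field[OF G] by auto
    let ?u = "\<lambda>l. vec_index v l"
    have "(\<Sum>k<n. (dot N (\<lambda>j. \<phi> j (x k)) ?u)\<^sup>2)
        = (\<Sum>k<n. \<Sum>j<N. ?u j * (\<phi> j (x k) * dot N (\<lambda>l. \<phi> l (x k)) ?u))"
      by (intro sum.cong refl) (simp add: power2_eq_square, simp add: dot_def sum_distrib_right mult_ac)
    also have "\<dots> = (\<Sum>j<N. ?u j * vec_index (?G *\<^sub>v v) j)"
      using v(1) by (subst sum.swap) (simp add: gram_mult_vec_index sum_distrib_left del: assoc_mult_mat_vec index_mult_mat_vec)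
    also have "\<dots> = 0" using v(3) by simp
    finally have "real n / 2 * dot N ?u ?u \<le> 0" using stab[of ?u] by simp
    then have "dot N ?u ?u \<le> 0" using n by (simp add: mult_le_0_iff)
    then have "(\<Sum>j<N. ?u j * ?u j) = 0" using dot_self_nonneg[of N ?u] by (simp add: dot_def)
    then have "?u j = 0" if "j < N" for j
      using that by (subst (asm) sum_nonneg_eq_0_iff) auto
    then have "v = 0\<^sub>v N" using v(1) by (intro eq_vecI) auto
    with v(2) show False ..
  qed
  then obtain B where B: "mat_inverse ?G = Some B"
    using mat_inverse(1)[OF G, of "()"] det_non_zero_imp_unit[OF G det, of "()"] by (cases "mat_inverse ?G") auto
  have inv: "?G * B = 1\<^sub>m N" "B \<in> carrier_mat N N" using mat_inverse(2)[OF G B] by auto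
  let ?b = "transpose_mat ?\<Phi> *\<^sub>v Matrix.vec n y"
  have b: "?b \<in> carrier_vec N" using P by auto
  have c: "ols_coeffs \<phi> n N x y = B *\<^sub>v ?b"
    using det B by (simp add: ols_coeffs_def Let_def)
  have "?G *\<^sub>v (B *\<^sub>v ?b) = (?G * B) *\<^sub>v ?b"
    by (rule assoc_mult_mat_vec[OF G inv(2) b, symmetric])
  also have "\<dots> = ?b" using inv(1) b by simp
  finally have eq: "?G *\<^sub>v (B *\<^sub>v ?b) = ?b" .
  have cc: "B *\<^sub>v ?b \<in> carrier_vec N" using inv(2) b by (rule mult_mat_vec_carrier)
  show ?thesis
    unfolding c gram_mult_vec_index[OF cc j, symmetric] eq by (rule design_transpose_mult_index[OF j])
qed

text \<open>With \<open>G\<close> the Gram matrix, \<open>G d = b\<close>, so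
  \<open>n/2 |d|^2 \<le> <d, G d> = <d, b> \<le> |d| |b|\<close>, that is,
  \<open>|d| \<le> (2/n) |b|\<close>.\<close>

lemma ols_coeffs_error:
  fixes c y :: "nat \<Rightarrow> real"
  assumes n: "0 < n"
    and stab: "\<And>u. real n / 2 * dot N u u \<le> (\<Sum>k<n. (dot N (\<lambda>j. \<phi> j (x k)) u)\<^sup>2)"
  defines "d \<equiv> \<lambda>j. vec_index (ols_coeffs \<phi> n N x y) j - c j"
    and "b \<equiv> \<lambda>j. \<Sum>k<n. \<phi> j (x k) * (y k - (\<Sum>l<N. c l * \<phi> l (x k)))"
  shows "dot N d d \<le> 4 / (real n)\<^sup>2 * dot N b b"
proof -
  have bd: "b j = (\<Sum>k<n. \<phi> j (x k) * dot N (\<lambda>l. \<phi> l (x k)) d)" if "j < N" for j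
  proof -
    have "(\<Sum>k<n. \<phi> j (x k) * dot N (\<lambda>l. \<phi> l (x k)) d)
        = (\<Sum>k<n. \<phi> j (x k) * dot N (\<lambda>l. \<phi> l (x k)) (\<lambda>l. vec_index (ols_coeffs \<phi> n N x y) l))
          - (\<Sum>k<n. \<phi> j (x k) * (\<Sum>l<N. c l * \<phi> l (x k)))"
      unfolding sum_subtractf[symmetric]
      by (intro sum.cong refl) (simp add: d_def dot_def right_diff_distrib sum_subtractf mult.commute)
    then show ?thesis
      unfolding ols_normal_equations[OF n, of N \<phi> x j y, OF stab that] b_def
      by (simp add: right_diff_distrib sum_subtractf)
  qed
  have "real n / 2 * dot N d d \<le> (\<Sum>k<n. (dot N (\<lambda>j. \<phi> j (x k)) d)\<^sup>2)" by (rule stab)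
  also have "\<dots> = (\<Sum>k<n. \<Sum>j<N. d j * (\<phi> j (x k) * dot N (\<lambda>l. \<phi> l (x k)) d))"
    by (intro sum.cong refl) (simp add: power2_eq_square, simp add: dot_def sum_distrib_right mult_ac)
  also have "\<dots> = dot N d b"
    by (subst sum.swap) (simp add: dot_def[of N d b] bd sum_distrib_left)
  finally have le: "real n / 2 * dot N d d \<le> dot N d b" .
  show ?thesis
  proof (cases "dot N d d = 0")
    case True
    then show ?thesis by simp
  next
    case False
    then have p: "0 < dot N d d" using dot_self_nonneg[of N d] by linarith
    have "(real n / 2 * dot N d d)\<^sup>2 \<le> (dot N d b)\<^sup>2"
      using le by (intro power_mono) simp_all
    also have "\<dots> \<le> dot N d d * dot N b b" by (rule dot_cauchy_schwarz)
    finally have "dot N d d * ((real n)\<^sup>2 / 4 * dot N d d) \<le> dot N d d * dot N b b"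
      by (simp add: power2_eq_square mult_ac)
    then have "(real n)\<^sup>2 / 4 * dot N d d \<le> dot N b b" using p by simp
    then show ?thesis using n by (simp add: field_simps)
  qed
qed

text \<open>Pythagoras: the residual \<open>e\<close> is orthogonal to all regressors and hence to
  the coefficient error.\<close>

lemma orthonormal_expansion_error:
  assumes e: "square_integrable M e" and phi: "\<And>j. j < N \<Longrightarrow> square_integrable M (\<phi> j)"
    and orth: "\<And>j l. j < N \<Longrightarrow> l < N \<Longrightarrow> (\<integral>x. \<phi> j x * \<phi> l x \<partial>M) = (if j = l then 1 else 0)"
    and perp: "\<And>j. j < N \<Longrightarrow> (\<integral>x. e x * \<phi> j x \<partial>M) = 0"
  shows "(\<integral>x. (e x - (\<Sum>j<N. d j * \<phi> j x))\<^sup>2 \<partial>M) = (\<integral>x. (e x)\<^sup>2 \<partial>M) + dot N d d"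
proof -
  have i1: "integrable M (\<lambda>x. \<Sum>j<N. d j * (e x * \<phi> j x))"
    by (intro Bochner_Integration.integrable_sum integrable_mult_right square_integrable_mult e phi) simp
  have i2: "integrable M (\<lambda>x. d j * d l * (\<phi> j x * \<phi> l x))" if "j \<in> {..<N}" "l \<in> {..<N}" for j l
    using that by (intro integrable_mult_right square_integrable_mult phi) auto
  have i3: "integrable M (\<lambda>x. \<Sum>j<N. \<Sum>l<N. d j * d l * (\<phi> j x * \<phi> l x))"
    by (intro Bochner_Integration.integrable_sum i2)
  have "(\<integral>x. (e x - (\<Sum>j<N. d j * \<phi> j x))\<^sup>2 \<partial>M)
      = (\<integral>x. (e x)\<^sup>2 - 2 * (\<Sum>j<N. d j * (e x * \<phi> j x)) + (\<Sum>j<N. \<Sum>l<N. d j * d l * (\<phi> j x * \<phi> l x)) \<partial>M)"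
  proof (intro Bochner_Integration.integral_cong refl)
    fix x
    have "(\<Sum>j<N. d j * \<phi> j x)\<^sup>2 = (\<Sum>j<N. \<Sum>l<N. d j * d l * (\<phi> j x * \<phi> l x))"
      by (simp add: power2_eq_square sum_product mult_ac)
    moreover have "e x * (\<Sum>j<N. d j * \<phi> j x) = (\<Sum>j<N. d j * (e x * \<phi> j x))"
      by (simp add: sum_distrib_left mult_ac)
    ultimately show "(e x - (\<Sum>j<N. d j * \<phi> j x))\<^sup>2
        = (e x)\<^sup>2 - 2 * (\<Sum>j<N. d j * (e x * \<phi> j x)) + (\<Sum>j<N. \<Sum>l<N. d j * d l * (\<phi> j x * \<phi> l x))"
      by (simp only: power2_diff mult.assoc)
  qed
  also have "\<dots> = (\<integral>x. (e x)\<^sup>2 \<partial>M) - 2 * (\<integral>x. (\<Sum>j<N. d j * (e x * \<phi> j x)) \<partial>M)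
      + (\<integral>x. (\<Sum>j<N. \<Sum>l<N. d j * d l * (\<phi> j x * \<phi> l x)) \<partial>M)"
    using i1 i3 square_integrable_square[OF e] by simp
  also have "(\<integral>x. (\<Sum>j<N. d j * (e x * \<phi> j x)) \<partial>M) = (\<Sum>j<N. d j * (\<integral>x. e x * \<phi> j x \<partial>M))"
    by (subst Bochner_Integration.integral_sum) (auto intro!: integrable_mult_right square_integrable_mult e phi)
  also have "\<dots> = 0" by (simp add: perp)
  also have "(\<integral>x. (\<Sum>j<N. \<Sum>l<N. d j * d l * (\<phi> j x * \<phi> l x)) \<partial>M)
      = (\<Sum>j<N. \<Sum>l<N. d j * d l * (\<integral>x. \<phi> j x * \<phi> l x \<partial>M))"
    by (subst Bochner_Integration.integral_sum, (intro Bochner_Integration.integrable_sum i2; assumption),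
        intro sum.cong refl, subst Bochner_Integration.integral_sum, (intro i2; assumption)) simp
  also have "\<dots> = (\<Sum>j<N. \<Sum>l<N. if j = l then d j * d j else 0)"
    using orth by (intro sum.cong refl) auto
  also have "\<dots> = dot N d d" by (simp add: dot_def)
  finally show ?thesis by simp
qed

section \<open>Signal and noise\<close>

text \<open>For \<open>k \<noteq> l\<close> independence factors the product; for
  \<open>k = l\<close> both factors are functions of one variable and only its law matters.\<close>

lemma (in prob_space)
  assumes X: "indep_vars (\<lambda>_. S) X I" and D: "\<And>i. i \<in> I \<Longrightarrow> distr M S (X i) = \<nu>"
    and g: "integrable \<nu> g" and h: "integrable \<nu> h" and gh: "integrable \<nu> (\<lambda>y. g y * h y)"
    and kl: "k \<in> I" "l \<in> I"
  shows integrable_iid_mult: "integrable M (\<lambda>\<omega>. g (X k \<omega>) * h (X l \<omega>) :: real)"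
    and expectation_iid_mult: "expectation (\<lambda>\<omega>. g (X k \<omega>) * h (X l \<omega>))
      = (if k = l then \<integral>y. g y * h y \<partial>\<nu> else (\<integral>y. g y \<partial>\<nu>) * (\<integral>y. h y \<partial>\<nu>))"
proof -
  have rv: "random_variable S (X i)" if "i \<in> I" for i using X that by (auto simp: indep_vars_def)
  have S: "sets S = sets \<nu>" using D[OF kl(1)] by (metis sets_distr)
  have meas: "q \<in> borel_measurable S" if "integrable \<nu> q" for q :: "_ \<Rightarrow> real"
    using borel_measurable_integrable[OF that] by (simp only: measurable_cong_sets[OF S refl])
  have int: "integrable M (\<lambda>\<omega>. q (X i \<omega>))" and ex: "expectation (\<lambda>\<omega>. q (X i \<omega>)) = (\<integral>y. q y \<partial>\<nu>)"
    if "i \<in> I" "integrable \<nu> q" for i and q :: "_ \<Rightarrow> real"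
    using integrable_distr_eq[OF rv meas, of i q] integral_distr[OF rv meas, of i q] D that by simp_all
  have "integrable M (\<lambda>\<omega>. g (X k \<omega>) * h (X l \<omega>)) \<and> expectation (\<lambda>\<omega>. g (X k \<omega>) * h (X l \<omega>))
      = (if k = l then \<integral>y. g y * h y \<partial>\<nu> else (\<integral>y. g y \<partial>\<nu>) * (\<integral>y. h y \<partial>\<nu>))"
  proof (cases "k = l")
    case True
    then show ?thesis using int[OF kl(1) gh] ex[OF kl(1) gh] by simp
  next
    case False
    define Y where "Y i = (if i = k then g else h)" for i
    have ind: "indep_vars (\<lambda>_. borel) (\<lambda>i \<omega>. Y i (X i \<omega>)) {k, l}"
      using kl meas[OF g] meas[OF h]
      by (intro indep_vars_compose2[OF indep_vars_subset[OF X]]) (auto simp: Y_def)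
    have Yi: "integrable M (\<lambda>\<omega>. Y i (X i \<omega>))" if "i \<in> {k, l}" for i
      using that kl g h by (auto simp: Y_def intro!: int)
    show ?thesis
      using indep_vars_integrable[OF _ ind Yi] indep_vars_lebesgue_integral[OF _ ind Yi] False
        ex[OF kl(1) g] ex[OF kl(2) h]
      by (simp add: Y_def)
  qed
  then show "integrable M (\<lambda>\<omega>. g (X k \<omega>) * h (X l \<omega>))"
    "expectation (\<lambda>\<omega>. g (X k \<omega>) * h (X l \<omega>))
      = (if k = l then \<integral>y. g y * h y \<partial>\<nu> else (\<integral>y. g y \<partial>\<nu>) * (\<integral>y. h y \<partial>\<nu>))" by auto
qed

text \<open>Independence is given for families of preimages, whereas the expectation rules need
  \<open>indep_var\<close>, which speaks of generated sigma-algebras. Preimage families are stable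
  under intersection, which bridges the two.\<close>

lemma (in prob_space) indep_var_compose_indep_set:
  assumes X: "random_variable S X" and Y: "random_variable T Y"
    and ind: "indep_set {X -` A \<inter> space M | A. A \<in> sets S} {Y -` B \<inter> space M | B. B \<in> sets T}"
    and f: "f \<in> S \<rightarrow>\<^sub>M R" and g: "g \<in> T \<rightarrow>\<^sub>M R"
  shows "indep_var R (\<lambda>\<omega>. f (X \<omega>)) R (\<lambda>\<omega>. g (Y \<omega>))"
proof -
  have st: "Int_stable {Z -` A \<inter> space M | A. A \<in> sets R}" for Z
  proof (rule Int_stableI)
    fix a b assume "a \<in> {Z -` A \<inter> space M | A. A \<in> sets R}" "b \<in> {Z -` A \<inter> space M | A. A \<in> sets R}"
    then obtain A B where "a = Z -` A \<inter> space M" "b = Z -` B \<inter> space M" "A \<in> sets R" "B \<in> sets R" by auto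
    then show "a \<inter> b \<in> {Z -` A \<inter> space M | A. A \<in> sets R}"
      by (auto intro!: exI[of _ "A \<inter> B"])
  qed
  have pre: "{(\<lambda>\<omega>. h (Z \<omega>)) -` A \<inter> space M | A. A \<in> sets R} \<subseteq> {Z -` A \<inter> space M | A. A \<in> sets Q}"
    if Z: "random_variable Q Z" and h: "h \<in> Q \<rightarrow>\<^sub>M R" for Z h Q
  proof safe
    fix A assume A: "A \<in> sets R"
    have "(\<lambda>\<omega>. h (Z \<omega>)) -` A \<inter> space M = Z -` (h -` A \<inter> space Q) \<inter> space M"
      using measurable_space[OF Z] by auto
    then show "\<exists>B. (\<lambda>\<omega>. h (Z \<omega>)) -` A \<inter> space M = Z -` B \<inter> space M \<and> B \<in> sets Q"
      using measurable_sets[OF h A] by blast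
  qed
  have "indep_set {(\<lambda>\<omega>. f (X \<omega>)) -` A \<inter> space M | A. A \<in> sets R} {(\<lambda>\<omega>. g (Y \<omega>)) -` A \<inter> space M | A. A \<in> sets R}"
    using ind pre[OF X f] pre[OF Y g] unfolding indep_sets2_eq by (meson subset_iff)
  from indep_set_sigma_sets[OF this st st] show ?thesis
    unfolding indep_var_eq using measurable_compose[OF X f] measurable_compose[OF Y g] by simp
qed

text \<open>After expanding the square, products of signal and noise have mean zero because the
  noise is centred and independent of the design; the remaining terms with
  \<open>k \<noteq> l\<close> vanish because \<open>a\<close> and the noise are centred. Only the
  diagonal survives.\<close>

lemma (in prob_space) expectation_sum_signal_noise_square:
  fixes X :: "nat \<Rightarrow> 'a \<Rightarrow> 'b" and \<eta> :: "nat \<Rightarrow> 'a \<Rightarrow> real"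
  assumes X: "indep_vars (\<lambda>_. \<nu>) X {..<n}" and DX: "\<And>k. k < n \<Longrightarrow> distr M \<nu> (X k) = \<nu>"
    and H: "indep_vars (\<lambda>_. borel) \<eta> {..<n}" and DH: "\<And>k l. k < n \<Longrightarrow> l < n \<Longrightarrow> distr M borel (\<eta> k) = distr M borel (\<eta> l)"
    and H2: "\<And>k. k < n \<Longrightarrow> integrable M (\<lambda>\<omega>. (\<eta> k \<omega>)\<^sup>2)"
    and H0: "\<And>k. k < n \<Longrightarrow> expectation (\<eta> k) = 0"
    and Hv: "\<And>k. k < n \<Longrightarrow> expectation (\<lambda>\<omega>. (\<eta> k \<omega>)\<^sup>2) = s"
    and ind: "indep_set
           {(\<lambda>\<omega>. \<lambda>k\<in>{..<n}. X k \<omega>) -` A \<inter> space M | A. A \<in> sets (Pi\<^sub>M {..<n} (\<lambda>_. \<nu>))}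
           {(\<lambda>\<omega>. \<lambda>k\<in>{..<n}. \<eta> k \<omega>) -` B \<inter> space M | B. B \<in> sets (Pi\<^sub>M {..<n} (\<lambda>_. borel :: real measure))}"
    and a: "integrable \<nu> a" "integrable \<nu> (\<lambda>y. (a y)\<^sup>2)" "(\<integral>y. a y \<partial>\<nu>) = 0"
    and p: "integrable \<nu> p" "integrable \<nu> (\<lambda>y. (p y)\<^sup>2)"
    and ap: "integrable \<nu> (\<lambda>y. a y * p y)"
  shows "integrable M (\<lambda>\<omega>. (\<Sum>k<n. a (X k \<omega>) + p (X k \<omega>) * \<eta> k \<omega>)\<^sup>2)"
    and "expectation (\<lambda>\<omega>. (\<Sum>k<n. a (X k \<omega>) + p (X k \<omega>) * \<eta> k \<omega>)\<^sup>2)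
      = real n * ((\<integral>y. (a y)\<^sup>2 \<partial>\<nu>) + s * (\<integral>y. (p y)\<^sup>2 \<partial>\<nu>))"
proof -
  have rvX: "random_variable \<nu> (X k)" if "k < n" for k using X that by (auto simp: indep_vars_def)
  have rvH: "random_variable borel (\<eta> k)" if "k < n" for k using H that by (auto simp: indep_vars_def)
  let ?X = "\<lambda>\<omega>. \<lambda>k\<in>{..<n}. X k \<omega>" and ?H = "\<lambda>\<omega>. \<lambda>k\<in>{..<n}. \<eta> k \<omega>"
  have mX: "random_variable (Pi\<^sub>M {..<n} (\<lambda>_. \<nu>)) ?X" and mH: "random_variable (Pi\<^sub>M {..<n} (\<lambda>_. borel)) ?H"
    using rvX rvH by (auto intro!: measurable_restrict)
  note mp = borel_measurable_integrable[OF p(1)] and ma = borel_measurable_integrable[OF a(1)]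
  \<comment> \<open>Mixed terms involve two design points and one or two noise values, so
    independence is used between the whole design vector and the whole noise vector.\<close>
  have prod: "integrable M (\<lambda>\<omega>. (q (X k \<omega>) * q' (X l \<omega>)) * u (?H \<omega>))"
    "expectation (\<lambda>\<omega>. (q (X k \<omega>) * q' (X l \<omega>)) * u (?H \<omega>))
      = expectation (\<lambda>\<omega>. q (X k \<omega>) * q' (X l \<omega>)) * expectation (\<lambda>\<omega>. u (?H \<omega>))"
    if kl: "k < n" "l < n" and q: "q \<in> borel_measurable \<nu>" "q' \<in> borel_measurable \<nu>"
      and u: "u \<in> borel_measurable (Pi\<^sub>M {..<n} (\<lambda>_. borel :: real measure))"
      and iq: "integrable M (\<lambda>\<omega>. q (X k \<omega>) * q' (X l \<omega>))" and iu: "integrable M (\<lambda>\<omega>. u (?H \<omega>))"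
    for k l and q q' :: "'b \<Rightarrow> real" and u :: "(nat \<Rightarrow> real) \<Rightarrow> real"
  proof -
    let ?w = "\<lambda>\<xi>. q (\<xi> k) * q' (\<xi> l)"
    have w: "?w \<in> borel_measurable (Pi\<^sub>M {..<n} (\<lambda>_. \<nu>))"
      using kl q by (intro borel_measurable_times) (auto intro: measurable_compose[OF measurable_component_singleton])
    have "indep_var borel (\<lambda>\<omega>. q (X k \<omega>) * q' (X l \<omega>)) borel (\<lambda>\<omega>. u (?H \<omega>))"
      using indep_var_compose_indep_set[OF mX mH ind w u] kl by simp
    from indep_var_integrable[OF this iq iu] indep_var_lebesgue_integral[OF this iq iu]
    show "integrable M (\<lambda>\<omega>. (q (X k \<omega>) * q' (X l \<omega>)) * u (?H \<omega>))"
      "expectation (\<lambda>\<omega>. (q (X k \<omega>) * q' (X l \<omega>)) * u (?H \<omega>))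
        = expectation (\<lambda>\<omega>. q (X k \<omega>) * q' (X l \<omega>)) * expectation (\<lambda>\<omega>. u (?H \<omega>))" by auto
  qed
  have iH: "integrable M (\<eta> k)" if "k < n" for k
    using square_integrable_imp_integrable[OF rvH[OF that] H2[OF that]] .
  have HH: "integrable M (\<lambda>\<omega>. \<eta> k \<omega> * \<eta> l \<omega>)"
    "expectation (\<lambda>\<omega>. \<eta> k \<omega> * \<eta> l \<omega>) = (if k = l then s else 0)" if kl: "k < n" "l < n" for k l
  proof -
    let ?D = "distr M borel (\<eta> k)"
    have i1: "integrable ?D (\<lambda>y. y)" using integrable_distr_eq[OF rvH[OF kl(1)], of "\<lambda>y. y"] iH[OF kl(1)] by simp
    have i2: "integrable ?D (\<lambda>y. y * y)"
      using integrable_distr_eq[OF rvH[OF kl(1)], of "\<lambda>y. y * y"] H2[OF kl(1)] by (simp add: power2_eq_square)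
    have e1: "(\<integral>y. y \<partial>?D) = 0" using integral_distr[OF rvH[OF kl(1)], of "\<lambda>y. y"] H0[OF kl(1)] by simp
    have e2: "(\<integral>y. y * y \<partial>?D) = s"
      using integral_distr[OF rvH[OF kl(1)], of "\<lambda>y. y * y"] Hv[OF kl(1)] by (simp add: power2_eq_square)
    have D: "distr M borel (\<eta> i) = ?D" if "i \<in> {..<n}" for i using DH[of i k] that kl by simp
    show "integrable M (\<lambda>\<omega>. \<eta> k \<omega> * \<eta> l \<omega>)"
      using integrable_iid_mult[OF H D i1 i1 i2, of k l] kl by simp
    show "expectation (\<lambda>\<omega>. \<eta> k \<omega> * \<eta> l \<omega>) = (if k = l then s else 0)"
      using expectation_iid_mult[OF H D i1 i1 i2, of k l] kl unfolding e1 e2 by simp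
  qed
  have DX': "distr M \<nu> (X i) = \<nu>" if "i \<in> {..<n}" for i using DX that by simp
  have aa: "integrable \<nu> (\<lambda>y. a y * a y)" and pp: "integrable \<nu> (\<lambda>y. p y * p y)" and pa: "integrable \<nu> (\<lambda>y. p y * a y)"
    using a p ap by (simp_all add: power2_eq_square mult.commute)
  have mixed: "integrable M (\<lambda>\<omega>. (q (X k \<omega>) * q' (X l \<omega>)) * \<eta> m \<omega>)"
    "expectation (\<lambda>\<omega>. (q (X k \<omega>) * q' (X l \<omega>)) * \<eta> m \<omega>) = 0"
    if "k < n" "l < n" "m < n" "integrable \<nu> q" "integrable \<nu> q'" "integrable \<nu> (\<lambda>y. q y * q' y)" for q q' k l m
    using prod[of k l q q' "\<lambda>\<xi>. \<xi> m"] integrable_iid_mult[OF X DX' that(4,5,6), of k l] that iH[of m] H0[of m]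
    by simp_all
  have quad: "integrable M (\<lambda>\<omega>. (p (X k \<omega>) * p (X l \<omega>)) * (\<eta> k \<omega> * \<eta> l \<omega>))"
    "expectation (\<lambda>\<omega>. (p (X k \<omega>) * p (X l \<omega>)) * (\<eta> k \<omega> * \<eta> l \<omega>)) = (if k = l then s * (\<integral>y. (p y)\<^sup>2 \<partial>\<nu>) else 0)"
    if kl: "k < n" "l < n" for k l
    using prod[of k l p p "\<lambda>\<xi>. \<xi> k * \<xi> l"] integrable_iid_mult[OF X DX' p(1) p(1) pp, of k l]
      expectation_iid_mult[OF X DX' p(1) p(1) pp, of k l] kl HH[OF kl] mp
    by (simp_all add: power2_eq_square)
  have sig: "integrable M (\<lambda>\<omega>. a (X k \<omega>) * a (X l \<omega>))"
    "expectation (\<lambda>\<omega>. a (X k \<omega>) * a (X l \<omega>)) = (if k = l then (\<integral>y. (a y)\<^sup>2 \<partial>\<nu>) else 0)"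
    if kl: "k < n" "l < n" for k l
    using integrable_iid_mult[OF X DX' a(1) a(1) aa, of k l] expectation_iid_mult[OF X DX' a(1) a(1) aa, of k l] kl a(3)
    by (simp_all add: power2_eq_square)
  let ?T = "\<lambda>k l \<omega>. a (X k \<omega>) * a (X l \<omega>) + (a (X k \<omega>) * p (X l \<omega>)) * \<eta> l \<omega>
      + (p (X k \<omega>) * a (X l \<omega>)) * \<eta> k \<omega> + (p (X k \<omega>) * p (X l \<omega>)) * (\<eta> k \<omega> * \<eta> l \<omega>)"
  have expand: "(\<Sum>k<n. a (X k \<omega>) + p (X k \<omega>) * \<eta> k \<omega>)\<^sup>2 = (\<Sum>k<n. \<Sum>l<n. ?T k l \<omega>)" for \<omega>
    unfolding power2_eq_square sum_product by (intro sum.cong refl) (simp add: algebra_simps)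
  have T: "integrable M (?T k l)" "expectation (?T k l) = (if k = l then (\<integral>y. (a y)\<^sup>2 \<partial>\<nu>) + s * (\<integral>y. (p y)\<^sup>2 \<partial>\<nu>) else 0)"
    if kl: "k < n" "l < n" for k l
    using sig[OF kl] quad[OF kl] mixed[OF kl kl(2) a(1) p(1) ap] mixed[OF kl kl(1) p(1) a(1) pa] by simp_all
  show "integrable M (\<lambda>\<omega>. (\<Sum>k<n. a (X k \<omega>) + p (X k \<omega>) * \<eta> k \<omega>)\<^sup>2)"
    unfolding expand by (intro Bochner_Integration.integrable_sum T(1)) auto
  have "expectation (\<lambda>\<omega>. (\<Sum>k<n. a (X k \<omega>) + p (X k \<omega>) * \<eta> k \<omega>)\<^sup>2) = (\<Sum>k<n. \<Sum>l<n. expectation (?T k l))"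
    unfolding expand
    by (subst Bochner_Integration.integral_sum, (intro Bochner_Integration.integrable_sum T(1); simp),
        intro sum.cong refl, subst Bochner_Integration.integral_sum, (intro T(1); simp)) (rule refl)
  also have "\<dots> = (\<Sum>k<n. \<Sum>l<n. if k = l then (\<integral>y. (a y)\<^sup>2 \<partial>\<nu>) + s * (\<integral>y. (p y)\<^sup>2 \<partial>\<nu>) else 0)"
    by (intro sum.cong refl T(2)) auto
  also have "\<dots> = real n * ((\<integral>y. (a y)\<^sup>2 \<partial>\<nu>) + s * (\<integral>y. (p y)\<^sup>2 \<partial>\<nu>))"
    by (simp add: sum.delta)
  finally show "expectation (\<lambda>\<omega>. (\<Sum>k<n. a (X k \<omega>) + p (X k \<omega>) * \<eta> k \<omega>)\<^sup>2)
      = real n * ((\<integral>y. (a y)\<^sup>2 \<partial>\<nu>) + s * (\<integral>y. (p y)\<^sup>2 \<partial>\<nu>))" .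
qed

text \<open>The vector \<open>b\<close> is the right-hand side of the normal equations for the coefficient error of
  least squares.\<close>

lemma (in prob_space) expectation_residual_noise_le:
  fixes X :: "nat \<Rightarrow> 'a \<Rightarrow> 'b" and \<eta> :: "nat \<Rightarrow> 'a \<Rightarrow> real"
  assumes X: "indep_vars (\<lambda>_. \<nu>) X {..<n}" and DX: "\<And>k. k < n \<Longrightarrow> distr M \<nu> (X k) = \<nu>"
    and H: "indep_vars (\<lambda>_. borel) \<eta> {..<n}" and DH: "\<And>k l. k < n \<Longrightarrow> l < n \<Longrightarrow> distr M borel (\<eta> k) = distr M borel (\<eta> l)"
    and H2: "\<And>k. k < n \<Longrightarrow> integrable M (\<lambda>\<omega>. (\<eta> k \<omega>)\<^sup>2)"
    and H0: "\<And>k. k < n \<Longrightarrow> expectation (\<eta> k) = 0"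
    and Hv: "\<And>k. k < n \<Longrightarrow> expectation (\<lambda>\<omega>. (\<eta> k \<omega>)\<^sup>2) = s"
    and ind: "indep_set
           {(\<lambda>\<omega>. \<lambda>k\<in>{..<n}. X k \<omega>) -` A \<inter> space M | A. A \<in> sets (Pi\<^sub>M {..<n} (\<lambda>_. \<nu>))}
           {(\<lambda>\<omega>. \<lambda>k\<in>{..<n}. \<eta> k \<omega>) -` B \<inter> space M | B. B \<in> sets (Pi\<^sub>M {..<n} (\<lambda>_. borel :: real measure))}"
    and nu: "prob_space \<nu>" and e: "square_integrable \<nu> e" and phi: "\<And>j. j < N \<Longrightarrow> square_integrable \<nu> (\<phi> j)"
    and norm: "\<And>j. j < N \<Longrightarrow> (\<integral>y. (\<phi> j y)\<^sup>2 \<partial>\<nu>) = 1"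
    and perp: "\<And>j. j < N \<Longrightarrow> (\<integral>y. e y * \<phi> j y \<partial>\<nu>) = 0"
    and bound: "\<And>y. y \<in> space \<nu> \<Longrightarrow> (\<Sum>j<N. (\<phi> j y)\<^sup>2) \<le> K"
  defines "b \<equiv> \<lambda>\<omega> j. \<Sum>k<n. \<phi> j (X k \<omega>) * (e (X k \<omega>) + \<eta> k \<omega>)"
  shows "integrable M (\<lambda>\<omega>. dot N (b \<omega>) (b \<omega>))"
    and "expectation (\<lambda>\<omega>. dot N (b \<omega>) (b \<omega>)) \<le> real n * (K * (\<integral>y. (e y)\<^sup>2 \<partial>\<nu>) + real N * s)"
proof -
  interpret nu: prob_space \<nu> by (rule nu)
  define a where "a j = (\<lambda>y. \<phi> j y * e y)" for j
  \<comment> \<open>\<open>e\<close> is only square integrable; its product with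
    \<open>\<phi> j\<close> remains so because \<open>K\<close> bounds the squared regressor
    pointwise.\<close>
  have a2: "integrable \<nu> (\<lambda>y. (a j y)\<^sup>2)" if j: "j < N" for j
  proof (rule Bochner_Integration.integrable_bound)
    show "integrable \<nu> (\<lambda>y. K * (e y)\<^sup>2)" using square_integrable_square[OF e] by simp
    show "(\<lambda>y. (a j y)\<^sup>2) \<in> borel_measurable \<nu>"
      unfolding a_def using square_integrable_measurable[OF e] square_integrable_measurable[OF phi[OF j]] by simp
    show "AE y in \<nu>. norm ((a j y)\<^sup>2) \<le> norm (K * (e y)\<^sup>2)"
    proof (rule AE_I2)
      fix y assume y: "y \<in> space \<nu>"
      have "(\<phi> j y)\<^sup>2 \<le> K"
        using j by (intro order_trans[OF member_le_sum bound[OF y]]) auto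
      then have "(a j y)\<^sup>2 \<le> K * (e y)\<^sup>2"
        unfolding a_def power_mult_distrib by (intro mult_right_mono) simp_all
      then show "norm ((a j y)\<^sup>2) \<le> norm (K * (e y)\<^sup>2)" by simp
    qed
  qed
  have sa: "square_integrable \<nu> (a j)" if j: "j < N" for j
    unfolding square_integrable_def
    using a2[OF j] square_integrable_measurable[OF e] square_integrable_measurable[OF phi[OF j]]
    by (simp add: a_def)
  have a0: "(\<integral>y. a j y \<partial>\<nu>) = 0" if "j < N" for j
    using perp[OF that] by (simp add: a_def mult.commute)
  have bj: "(b \<omega> j)\<^sup>2 = (\<Sum>k<n. a j (X k \<omega>) + \<phi> j (X k \<omega>) * \<eta> k \<omega>)\<^sup>2" for \<omega> j
    by (simp add: b_def a_def algebra_simps)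
  have I: "integrable M (\<lambda>\<omega>. (b \<omega> j)\<^sup>2)"
    and E: "expectation (\<lambda>\<omega>. (b \<omega> j)\<^sup>2) = real n * ((\<integral>y. (a j y)\<^sup>2 \<partial>\<nu>) + s)" if j: "j < N" for j
    unfolding bj
    using expectation_sum_signal_noise_square[OF X DX H DH H2 H0 Hv ind
        nu.square_integrable_integrable[OF sa[OF j]] a2[OF j] a0[OF j] nu.square_integrable_integrable[OF phi[OF j]]
        square_integrable_square[OF phi[OF j]] square_integrable_mult[OF sa[OF j] phi[OF j]]] norm[OF j]
    by simp_all
  have dot: "dot N (b \<omega>) (b \<omega>) = (\<Sum>j<N. (b \<omega> j)\<^sup>2)" for \<omega>
    by (simp add: dot_def power2_eq_square)
  show "integrable M (\<lambda>\<omega>. dot N (b \<omega>) (b \<omega>))"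
    unfolding dot by (intro Bochner_Integration.integrable_sum I) simp
  have "expectation (\<lambda>\<omega>. dot N (b \<omega>) (b \<omega>)) = (\<Sum>j<N. expectation (\<lambda>\<omega>. (b \<omega> j)\<^sup>2))"
    unfolding dot by (intro Bochner_Integration.integral_sum I) simp
  also have "\<dots> = real n * ((\<Sum>j<N. \<integral>y. (a j y)\<^sup>2 \<partial>\<nu>) + real N * s)"
    by (simp add: E sum_distrib_left[symmetric] sum.distrib)
  \<comment> \<open>The sum moves under the integral so that \<open>K\<close> bounds all squares at
    once; bounding them one by one would cost a factor \<open>N\<close>.\<close>
  also have "(\<Sum>j<N. \<integral>y. (a j y)\<^sup>2 \<partial>\<nu>) = (\<integral>y. (\<Sum>j<N. (a j y)\<^sup>2) \<partial>\<nu>)"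
    by (rule Bochner_Integration.integral_sum[symmetric]) (simp add: a2)
  also have "\<dots> \<le> (\<integral>y. K * (e y)\<^sup>2 \<partial>\<nu>)"
  proof (rule integral_mono)
    show "integrable \<nu> (\<lambda>y. \<Sum>j<N. (a j y)\<^sup>2)" by (intro Bochner_Integration.integrable_sum a2) simp
    show "integrable \<nu> (\<lambda>y. K * (e y)\<^sup>2)" using square_integrable_square[OF e] by simp
    fix y assume y: "y \<in> space \<nu>"
    have "(\<Sum>j<N. (a j y)\<^sup>2) = (\<Sum>j<N. (\<phi> j y)\<^sup>2) * (e y)\<^sup>2"
      by (simp add: a_def power_mult_distrib sum_distrib_right)
    also have "\<dots> \<le> K * (e y)\<^sup>2" by (intro mult_right_mono bound y) simp
    finally show "(\<Sum>j<N. (a j y)\<^sup>2) \<le> K * (e y)\<^sup>2" .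
  qed
  also have "\<dots> = K * (\<integral>y. (e y)\<^sup>2 \<partial>\<nu>)" by simp
  finally show "expectation (\<lambda>\<omega>. dot N (b \<omega>) (b \<omega>)) \<le> real n * (K * (\<integral>y. (e y)\<^sup>2 \<partial>\<nu>) + real N * s)"
    by (simp add: mult_left_mono)
qed

section \<open>Risk bounds\<close>

text \<open>The inequality \<open>ln z \<le> z - 1\<close> at \<open>z = 2/3\<close> gives
  \<open>ln (3/2) \<ge> 1/3\<close>, and \<open>1 + 5/12 + (5/12)^2 / 2 > 3/2\<close> gives
  \<open>ln (3/2) \<le> 5/12\<close>.\<close>

lemma stability_constant_bounds: "0 \<le> 3 * ln (3 / 2) - (1::real)" "3 * ln (3 / 2) - 1 \<le> (1 / 4 :: real)"
proof -
  have "ln (inverse (3 / 2 :: real)) \<le> inverse (3 / 2) - 1" by (rule ln_le_minus_one) simp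
  then have "- ln (3 / 2 :: real) \<le> inverse (3 / 2) - 1" by (subst (asm) ln_inverse)
  moreover have "inverse (3 / 2 :: real) = 2 / 3" by simp
  ultimately show "0 \<le> 3 * ln (3 / 2) - (1::real)" by linarith
  have "3 / 2 \<le> exp (5 / 12 :: real)"
    using exp_lower_Taylor_quadratic[of "5 / 12 :: real"] by (simp add: power2_eq_square)
  then have "ln (3 / 2) \<le> (5 / 12 :: real)" using ln_le_cancel_iff[of "3 / 2" "exp (5 / 12 :: real)"] by (simp only: ln_exp)
  then show "3 * ln (3 / 2) - 1 \<le> (1 / 4 :: real)" by linarith
qed

text \<open>Hence \<open>\<kappa>\<^sub>r \<le> 1 / (8 (1 + r))\<close>, the constant for which the second-order expansion in
  \<open>t\<close> above suffices; the exact Chernoff exponent is not needed.\<close>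

lemma stability_consequences:
  fixes K r :: real
  assumes K: "1 \<le> K" and r: "0 < r" and n: "2 \<le> n" and le: "8 * (1 + r) * K * ln (real n) \<le> real n"
  shows "4 * K / real n \<le> 1 / 5" "K \<le> real n" "(1 + r) * ln (real n) \<le> real n / (8 * K)"
proof -
  have mono: "real k * ln 2 \<le> ln (real n)" if "2 ^ k \<le> n" for k
  proof -
    have "ln (2 ^ k) \<le> ln (real n)" using that n by (subst ln_le_cancel_iff) (auto simp flip: of_nat_le_iff)
    then show ?thesis by (simp add: ln_realpow)
  qed
  note l2 = ln2_ge_two_thirds
  have l1: "ln 2 \<le> ln (real n)" using mono[of 1] n by simp
  then have lp: "0 < ln (real n)" using l2 by linarith
  have "8 * ln (real n) * 1 \<le> 8 * ln (real n) * ((1 + r) * K)"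
    using K r lp mult_mono[of 1 "1 + r" 1 K] by (intro mult_left_mono) simp_all
  then have n8: "8 * ln (real n) \<le> real n" using le by (simp add: mult_ac)
  \<comment> \<open>Bootstrapping of \<open>8 ln n \<le> n\<close> with
    \<open>ln 2 \<ge> 2/3\<close>: a lower bound on \<open>n\<close> improves the one on
    \<open>ln n\<close>, which improves the one on \<open>n\<close>, until
    \<open>ln n \<ge> 4 ln 2\<close>.\<close>
  have "6 \<le> n" using n8 l1 l2 by linarith
  then have "11 \<le> n" using mono[of 2] n8 l2 by simp
  then have "16 \<le> n" using mono[of 3] n8 l2 by simp
  then have ln_ge: "8 / 3 \<le> ln (real n)" using mono[of 4] l2 by simp
  \<comment> \<open>Here \<open>8 * (8/3) \<ge> 20\<close>; dividing by \<open>n\<close> gives the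
    excess 1/5 in the factor 1.2.\<close>
  have "20 * K \<le> 8 * (1 + r) * K * ln (real n)"
  proof -
    have "1 * (8 / 3) \<le> (1 + r) * ln (real n)" using r ln_ge by (intro mult_mono) auto
    then have "8 * K * (8 / 3) \<le> 8 * K * ((1 + r) * ln (real n))" using K by (intro mult_left_mono) auto
    moreover have "20 * K \<le> 8 * K * (8 / 3)" using K by simp
    moreover have "8 * K * ((1 + r) * ln (real n)) = 8 * (1 + r) * K * ln (real n)" by (simp add: mult_ac)
    ultimately show ?thesis by linarith
  qed
  then have K20: "20 * K \<le> real n" using le by linarith
  then show "4 * K / real n \<le> 1 / 5" using n by (simp add: field_simps)
  show "K \<le> real n" using K20 K by linarith
  show "(1 + r) * ln (real n) \<le> real n / (8 * K)"
    using le K by (simp add: field_simps)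
qed

section \<open>Tensor regressors\<close>

lemma
  fixes \<mu> :: "'d::finite \<Rightarrow> real measure"
  assumes prob_mu: "\<And>i. prob_space (\<mu> i)"
    and psi: "\<And>i a. square_integrable (\<mu> i) (\<psi> i a)"
    and orth: "\<And>i a b. (\<integral>t. \<psi> i a t * \<psi> i b t \<partial>\<mu> i) = (if a = b then 1 else 0)"
  shows square_integrable_tensor_regressor: "square_integrable (prod_measure \<mu>) (tensor_regressor \<psi> \<alpha>)"
    and integral_tensor_regressor_mult: "(\<integral>x. tensor_regressor \<psi> \<alpha> x * tensor_regressor \<psi> \<beta> x \<partial>prod_measure \<mu>)
      = (if \<alpha> = \<beta> then 1 else 0)"
proof -
  interpret mu: prob_space "\<mu> i" for i by (rule prob_mu)
  interpret product_prob_space \<mu> UNIV ..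
  have int: "integrable (\<mu> i) (\<lambda>t. \<psi> i a t * \<psi> i b t)" for i a b
    by (rule square_integrable_mult[OF psi psi])
  have eq: "tensor_regressor \<psi> \<alpha> x * tensor_regressor \<psi> \<beta> x = (\<Prod>i\<in>UNIV. \<psi> i (\<alpha> i) (x i) * \<psi> i (\<beta> i) (x i))"
    for \<alpha> \<beta> x by (simp add: tensor_regressor_def prod.distrib)
  have meas: "(\<lambda>x. \<psi> i a (x i)) \<in> borel_measurable (prod_measure \<mu>)" for i a
    by (rule measurable_compose[OF _ square_integrable_measurable[OF psi]]) simp
  show "square_integrable (prod_measure \<mu>) (tensor_regressor \<psi> \<alpha>)"
    unfolding square_integrable_def
  proof
    show "tensor_regressor \<psi> \<alpha> \<in> borel_measurable (prod_measure \<mu>)"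
      unfolding tensor_regressor_def[abs_def] by (intro borel_measurable_prod meas)
    have "integrable (prod_measure \<mu>) (\<lambda>x. \<Prod>i\<in>UNIV. \<psi> i (\<alpha> i) (x i) * \<psi> i (\<alpha> i) (x i))"
      by (rule product_integrable_prod) (auto intro: int)
    then show "integrable (prod_measure \<mu>) (\<lambda>x. (tensor_regressor \<psi> \<alpha> x)\<^sup>2)"
      by (simp only: power2_eq_square eq)
  qed
  have "(\<integral>x. tensor_regressor \<psi> \<alpha> x * tensor_regressor \<psi> \<beta> x \<partial>prod_measure \<mu>)
      = (\<Prod>i\<in>UNIV. \<integral>t. \<psi> i (\<alpha> i) t * \<psi> i (\<beta> i) t \<partial>\<mu> i)"
    unfolding eq by (rule product_integral_prod) (auto intro: int)
  also have "\<dots> = (if \<alpha> = \<beta> then 1 else 0)"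
    by (auto simp: orth fun_eq_iff prod_zero_iff)
  finally show "(\<integral>x. tensor_regressor \<psi> \<alpha> x * tensor_regressor \<psi> \<beta> x \<partial>prod_measure \<mu>)
      = (if \<alpha> = \<beta> then 1 else 0)" .
qed

text \<open>If \<open>D\<close> is not measurable, the integrals have the junk value \<open>0\<close> and the bounds are trivial.\<close>

lemma (in prob_space) expectation_le_of_bounds:
  assumes Q: "integrable M Q" "\<And>\<omega>. \<omega> \<in> space M \<Longrightarrow> 0 \<le> Q \<omega>" "expectation Q \<le> R\<^sup>2" and R: "0 \<le> R"
    and B: "integrable M B" "\<And>\<omega>. \<omega> \<in> space M \<Longrightarrow> 0 \<le> B \<omega>" "expectation B \<le> \<beta>"
    and D1: "\<And>\<omega>. \<omega> \<in> space M \<Longrightarrow> \<bar>D \<omega>\<bar> \<le> 1"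
    and D2: "\<And>\<omega>. \<omega> \<in> space M \<Longrightarrow> B \<omega> < 1 \<Longrightarrow> (D \<omega>)\<^sup>2 \<le> Q \<omega>"
    and D3: "\<And>\<omega>. \<omega> \<in> space M \<Longrightarrow> B \<omega> < 1 \<Longrightarrow> \<bar>D \<omega>\<bar> \<le> Q \<omega> + 2 * S * sqrt (Q \<omega>)" and S: "0 \<le> S"
  shows "expectation (\<lambda>\<omega>. (D \<omega>)\<^sup>2) \<le> R\<^sup>2 + \<beta>"
    and "expectation (\<lambda>\<omega>. \<bar>D \<omega>\<bar>) \<le> R * (R + 2 * S) + \<beta>"
proof -
  \<comment> \<open>Where \<open>B \<omega> < 1\<close> the bound by \<open>Q\<close> holds;
    elsewhere \<open>B \<omega> \<ge> 1\<close> dominates the trivial bound.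
    \<open>integral_mono'\<close> asks for integrability of the majorant only.\<close>
  have "expectation (\<lambda>\<omega>. (D \<omega>)\<^sup>2) \<le> expectation (\<lambda>\<omega>. Q \<omega> + B \<omega>)"
  proof (rule integral_mono')
    show "integrable M (\<lambda>\<omega>. Q \<omega> + B \<omega>)" using Q B by simp
    fix \<omega> assume w: "\<omega> \<in> space M"
    show "0 \<le> Q \<omega> + B \<omega>" using Q B w by simp
    have "(D \<omega>)\<^sup>2 \<le> 1" using D1[OF w] by (simp add: abs_square_le_1)
    then show "(D \<omega>)\<^sup>2 \<le> Q \<omega> + B \<omega>"
      using D2[OF w] Q(2)[OF w] B(2)[OF w] by (cases "B \<omega> < 1") linarith+
  qed
  then show "expectation (\<lambda>\<omega>. (D \<omega>)\<^sup>2) \<le> R\<^sup>2 + \<beta>" using Q B by simp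
  have sq: "square_integrable M (\<lambda>\<omega>. sqrt (Q \<omega>))"
  proof -
    have "integrable M (\<lambda>\<omega>. (sqrt (Q \<omega>))\<^sup>2)"
      using Q(1) Bochner_Integration.integrable_cong[OF refl, of M "\<lambda>\<omega>. (sqrt (Q \<omega>))\<^sup>2" Q] Q(2) by simp
    then show ?thesis using borel_measurable_integrable[OF Q(1)] by (simp add: square_integrable_def)
  qed
  \<comment> \<open>Jensen's inequality for the square root, as Cauchy-Schwarz against 1.\<close>
  have "(expectation (\<lambda>\<omega>. sqrt (Q \<omega>) * 1))\<^sup>2 \<le> expectation (\<lambda>\<omega>. (sqrt (Q \<omega>))\<^sup>2) * expectation (\<lambda>\<omega>. 1\<^sup>2)"
    by (rule integral_Cauchy_Schwarz[OF sq square_integrable_const])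
  also have "expectation (\<lambda>\<omega>. (sqrt (Q \<omega>))\<^sup>2) = expectation Q"
    using Q by (intro Bochner_Integration.integral_cong) auto
  finally have "(expectation (\<lambda>\<omega>. sqrt (Q \<omega>)))\<^sup>2 \<le> R\<^sup>2" using Q(3) by (simp add: prob_space)
  then have ER: "expectation (\<lambda>\<omega>. sqrt (Q \<omega>)) \<le> R" using R by (rule power2_le_imp_le)
  note isq = square_integrable_integrable[OF sq]
  have "expectation (\<lambda>\<omega>. \<bar>D \<omega>\<bar>) \<le> expectation (\<lambda>\<omega>. Q \<omega> + 2 * S * sqrt (Q \<omega>) + B \<omega>)"
  proof (rule integral_mono')
    show "integrable M (\<lambda>\<omega>. Q \<omega> + 2 * S * sqrt (Q \<omega>) + B \<omega>)" using Q B isq by simp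
    fix \<omega> assume w: "\<omega> \<in> space M"
    have nn: "0 \<le> 2 * S * sqrt (Q \<omega>)" using S Q(2)[OF w] by simp
    show "0 \<le> Q \<omega> + 2 * S * sqrt (Q \<omega>) + B \<omega>" using nn Q(2)[OF w] B(2)[OF w] by linarith
    show "\<bar>D \<omega>\<bar> \<le> Q \<omega> + 2 * S * sqrt (Q \<omega>) + B \<omega>"
      using D1[OF w] D3[OF w] nn Q(2)[OF w] B(2)[OF w] by (cases "B \<omega> < 1") linarith+
  qed
  also have "\<dots> = expectation Q + 2 * S * expectation (\<lambda>\<omega>. sqrt (Q \<omega>)) + expectation B"
    using Q B isq by simp
  also have "\<dots> \<le> R\<^sup>2 + 2 * S * R + \<beta>"
    using Q(3) B(3) ER S by (intro add_mono mult_left_mono) simp_all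
  finally show "expectation (\<lambda>\<omega>. \<bar>D \<omega>\<bar>) \<le> R * (R + 2 * S) + \<beta>"
    by (simp add: power2_eq_square algebra_simps)
qed

theorem theorem6:
  fixes X :: "'d::finite \<Rightarrow> real set"
    and \<mu> :: "'d \<Rightarrow> real measure"
    and f fN :: "('d \<Rightarrow> real) \<Rightarrow> real"
    and \<psi> :: "'d \<Rightarrow> nat \<Rightarrow> real \<Rightarrow> real"
    and L :: "nat \<Rightarrow> ('d \<Rightarrow> nat) set"
    and enum :: "nat \<Rightarrow> 'd \<Rightarrow> nat"
    and n N :: nat
    and r \<sigma> R :: real
    and P :: "'w measure"
    and x :: "nat \<Rightarrow> 'w \<Rightarrow> 'd \<Rightarrow> real"
    and \<eta> :: "nat \<Rightarrow> 'w \<Rightarrow> real"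
  assumes "\<And>i. prob_space (\<mu> i)"
    and "\<And>i. sets (\<mu> i) = sets (restrict_space borel (X i))"
    and "square_integrable (prod_measure \<mu>) f"
    and "prob_space.variance (prod_measure \<mu>) f > 0"
    (* regressors and truncation sets *)
    and "\<And>i a. square_integrable (\<mu> i) (\<psi> i a)"
    and "\<And>i a b. (\<integral>t. \<psi> i a t * \<psi> i b t \<partial>\<mu> i) = (if a = b then 1 else 0)"
    and "\<And>i t. t \<in> X i \<Longrightarrow> \<psi> i 0 t = 1"
    and "L 1 = {\<lambda>_. 0}"
    and "\<And>m. m \<ge> 1 \<Longrightarrow> L m \<subset> L (Suc m)"
    and "\<And>m. m \<ge> 1 \<Longrightarrow> card (L m) = m"
    and "N \<ge> 1"
    and "orthogonal_projection (prod_measure \<mu>)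
           (regressor_span (tensor_regressor \<psi>) (L N)) f fN"
    (* an ordering of L N, i.e. of the columns of the design matrix *)
    and "bij_betw enum {..<N} (L N)"
    (* i.i.d. design from the product measure; i.i.d. noise independent of the design *)
    and "prob_space P"
    and "n \<ge> 2"
    and "prob_space.indep_vars P (\<lambda>_. prod_measure \<mu>) x {..<n}"
    and "\<And>k. k < n \<Longrightarrow> distr P (prod_measure \<mu>) (x k) = prod_measure \<mu>"
    and "prob_space.indep_vars P (\<lambda>_. borel) \<eta> {..<n}"
    and "\<And>k l. k < n \<Longrightarrow> l < n \<Longrightarrow> distr P borel (\<eta> k) = distr P borel (\<eta> l)"
    and "\<And>k. k < n \<Longrightarrow> square_integrable P (\<eta> k)"
    and "\<And>k. k < n \<Longrightarrow> prob_space.expectation P (\<eta> k) = 0"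
    and "\<And>k. k < n \<Longrightarrow> prob_space.variance P (\<eta> k) = \<sigma>\<^sup>2"
    and "prob_space.indep_set P
           {(\<lambda>\<omega>. \<lambda>k\<in>{..<n}. x k \<omega>) -` A \<inter> space P | A. A \<in> sets (Pi\<^sub>M {..<n} (\<lambda>_. prod_measure \<mu>))}
           {(\<lambda>\<omega>. \<lambda>k\<in>{..<n}. \<eta> k \<omega>) -` B \<inter> space P | B. B \<in> sets (Pi\<^sub>M {..<n} (\<lambda>_. borel :: real measure))}"
    (* stability condition and risk bound *)
    and "r > 0"
    and "regressor_sup (prod_measure \<mu>) (tensor_regressor \<psi>) (L N)
           \<le> ennreal ((3 * ln (3 / 2) - 1) / (2 + 2 * r) * (real n / ln (real n)))"
    and "R \<ge> 0"
    and "R\<^sup>2 = 1.2 / prob_space.variance (prod_measure \<mu>) f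
                 * (l2_norm (prod_measure \<mu>) (\<lambda>t. f t - fN t))\<^sup>2
               + 4 * \<sigma>\<^sup>2 / prob_space.variance (prod_measure \<mu>) f * (real N / real n)"
  defines "fhat \<equiv> \<lambda>\<omega>. ols_approx (\<lambda>j. tensor_regressor \<psi> (enum j)) n N
                         (\<lambda>k. x k \<omega>) (\<lambda>k. f (x k \<omega>) + \<eta> k \<omega>)"
  shows "\<forall>S \<in> {sobol_index \<mu>, total_effect_index \<mu>}.
           (MAX U\<in>UNIV. prob_space.expectation P (\<lambda>\<omega>. (S f U - S (fhat \<omega>) U)\<^sup>2))
             \<le> R\<^sup>2 + 2 * real n powr (- r) \<and>
           (\<forall>U. prob_space.expectation P (\<lambda>\<omega>. \<bar>S f U - S (fhat \<omega>) U\<bar>)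
             \<le> R * (R + 2 * sqrt (S f U)) + 2 * real n powr (- r))"
proof -
  note prob_mu = assms(1) and f = assms(3) and var = assms(4) and psi = assms(5) and psi_orth = assms(6)
    and proj = assms(12) and enum = assms(13) and n = assms(15) and indep_x = assms(16) and distr_x = assms(17)
    and indep_eta = assms(18) and distr_eta = assms(19) and eta2 = assms(20) and eta0 = assms(21)
    and eta_var = assms(22) and indep = assms(23) and r = assms(24) and stable = assms(25)
    and R = assms(26) and R2 = assms(27)
  interpret nu: prob_space "prod_measure \<mu>" by (rule prob_space_prod[OF prob_mu])
  interpret P: prob_space P by (rule assms(14))
  define \<phi> where "\<phi> j = tensor_regressor \<psi> (enum j)" for j
  define K where "K = (3 * ln (3 / 2) - 1) / (2 + 2 * r) * (real n / ln (real n))"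
  have phi: "square_integrable (prod_measure \<mu>) (\<phi> j)" for j
    unfolding \<phi>_def by (rule square_integrable_tensor_regressor[OF prob_mu psi psi_orth])
  have orth: "(\<integral>y. \<phi> j y * \<phi> l y \<partial>prod_measure \<mu>) = (if j = l then 1 else 0)" if "j < N" "l < N" for j l
    unfolding \<phi>_def integral_tensor_regressor_mult[OF prob_mu psi psi_orth]
    using bij_betw_imp_inj_on[OF enum] that by (auto simp: inj_on_def)
  have reindex: "(\<Sum>\<alpha>\<in>L N. g \<alpha>) = (\<Sum>j<N. g (enum j))" for g :: "('d \<Rightarrow> nat) \<Rightarrow> real"
    by (rule sum.reindex_bij_betw[OF enum, symmetric])
  have ln_n: "0 < ln (real n)" using n by simp
  have K0: "0 \<le> K"
    unfolding K_def using stability_constant_bounds r ln_n by simp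
  have bound: "(\<Sum>j<N. (\<phi> j y)\<^sup>2) \<le> K" if "y \<in> space (prod_measure \<mu>)" for y
  proof -
    have "ennreal (\<Sum>\<alpha>\<in>L N. (tensor_regressor \<psi> \<alpha> y)\<^sup>2) \<le> ennreal K"
      using SUP_upper[OF that, of "\<lambda>y. ennreal (\<Sum>\<alpha>\<in>L N. (tensor_regressor \<psi> \<alpha> y)\<^sup>2)"] stable
      unfolding regressor_sup_def K_def by (rule order_trans)
    then show ?thesis using K0 by (simp add: reindex \<phi>_def)
  qed
  \<comment> \<open>Integrating the pointwise bound over \<open>N\<close> orthonormal functions
    gives \<open>N\<close> on the left.\<close>
  have NK: "real N \<le> K"
  proof -
    have "real N = (\<integral>y. (\<Sum>j<N. (\<phi> j y)\<^sup>2) \<partial>prod_measure \<mu>)"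
      using orth square_integrable_square[OF phi] by (simp add: power2_eq_square)
    also have "\<dots> \<le> K"
      using bound square_integrable_square[OF phi]
      by (intro nu.integral_le_const AE_I2 Bochner_Integration.integrable_sum) auto
    finally show ?thesis .
  qed
  then have K1: "1 \<le> K" using assms(11) by simp
  have K8: "8 * (1 + r) * K * ln (real n) \<le> real n"
  proof -
    have "8 * (1 + r) * K * ln (real n) = 4 * (3 * ln (3 / 2) - 1) * real n"
    proof -
      have "8 * (1 + r) * (C / (2 + 2 * r) * (real n / ln (real n))) * ln (real n) = 4 * C * real n" for C
        using r ln_n by (simp add: divide_simps)
      then show ?thesis unfolding K_def .
    qed
    also have "\<dots> \<le> 1 * real n"
      using stability_constant_bounds by (intro mult_right_mono) auto
    finally show ?thesis by simp
  qed
  note consequences = stability_consequences[OF K1 r n K8]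

  obtain c where fN: "fN = (\<lambda>y. \<Sum>j<N. c j * \<phi> j y)"
  proof -
    obtain c where "fN = (\<lambda>y. \<Sum>\<alpha>\<in>L N. c \<alpha> * tensor_regressor \<psi> \<alpha> y)"
      using proj by (auto simp: orthogonal_projection_def regressor_span_def)
    then show ?thesis by (intro that[of "\<lambda>j. c (enum j)"]) (simp add: reindex \<phi>_def)
  qed
  define e where "e y = f y - fN y" for y
  have "square_integrable (prod_measure \<mu>) fN"
    unfolding fN by (intro square_integrable_sum square_integrable_scale phi)
  then have e: "square_integrable (prod_measure \<mu>) e"
    unfolding e_def[abs_def] by (rule square_integrable_diff[OF f])
  have perp: "(\<integral>y. e y * \<phi> j y \<partial>prod_measure \<mu>) = 0" if "j < N" for j
  proof -
    have fin: "finite (L N)" using enum bij_betw_finite by blast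
    have "enum j \<in> L N" using bij_betwE[OF enum] that by auto
    then have "\<phi> j = (\<lambda>y. \<Sum>\<alpha>\<in>L N. (if \<alpha> = enum j then 1 else 0) * tensor_regressor \<psi> \<alpha> y)"
      using fin by (intro ext) (simp add: \<phi>_def if_distrib[of "\<lambda>a. a * _"] cong: if_cong)
    then have "\<phi> j \<in> regressor_span (tensor_regressor \<psi>) (L N)"
      by (auto simp: regressor_span_def)
    then show ?thesis using proj by (simp add: orthogonal_projection_def e_def)
  qed
  define V where "V = nu.variance f"
  define E where "E = (\<integral>y. (e y)\<^sup>2 \<partial>prod_measure \<mu>)"
  have V: "0 < V" using var by (simp add: V_def)
  have E0: "0 \<le> E" by (simp add: E_def)
  have l2: "(l2_norm (prod_measure \<mu>) (\<lambda>t. f t - fN t))\<^sup>2 = E"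
    by (simp add: l2_norm_def E_def e_def)

  define b where "b \<omega> j = (\<Sum>k<n. \<phi> j (x k \<omega>) * (e (x k \<omega>) + \<eta> k \<omega>))" for \<omega> j
  \<comment> \<open>It bounds the relative squared error on good samples, yet is nonnegative and
    integrable over all of them, so its expectation can be taken without conditioning.\<close>
  define Q where "Q \<omega> = (E + 4 / (real n)\<^sup>2 * dot N (b \<omega>) (b \<omega>)) / V" for \<omega>
  have eta_sq: "integrable P (\<lambda>\<omega>. (\<eta> k \<omega>)\<^sup>2)" if "k < n" for k
    using eta2[OF that] by (rule square_integrable_square)
  have eta_s: "P.expectation (\<lambda>\<omega>. (\<eta> k \<omega>)\<^sup>2) = \<sigma>\<^sup>2" if "k < n" for k
    using eta_var[OF that] eta0[OF that] by simp
  have phi_norm: "(\<integral>y. (\<phi> j y)\<^sup>2 \<partial>prod_measure \<mu>) = 1" if "j < N" for j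
    using orth[OF that that] by (simp add: power2_eq_square)
  note residual = P.expectation_residual_noise_le[OF indep_x distr_x indep_eta distr_eta eta_sq eta0 eta_s indep
      nu.prob_space_axioms e phi phi_norm perp bound, folded b_def]
  have Q: "integrable P Q" "\<And>\<omega>. 0 \<le> Q \<omega>" "P.expectation Q \<le> R\<^sup>2"
  proof -
    show "integrable P Q" unfolding Q_def using residual(1) by simp
    show "0 \<le> Q \<omega>" for \<omega> unfolding Q_def using E0 V by simp
    have "P.expectation Q = (E + 4 / (real n)\<^sup>2 * P.expectation (\<lambda>\<omega>. dot N (b \<omega>) (b \<omega>))) / V"
      unfolding Q_def using residual(1) by (simp add: P.prob_space)
    also have "\<dots> \<le> (E + 4 / (real n)\<^sup>2 * (real n * (K * E + real N * \<sigma>\<^sup>2))) / V"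
      using residual(2) V unfolding E_def by (intro divide_right_mono add_left_mono mult_left_mono) simp_all
    also have "\<dots> = (E * (1 + 4 * K / real n) + 4 * \<sigma>\<^sup>2 * (real N / real n)) / V"
    proof -
      have "4 / (real n)\<^sup>2 * (real n * z) = 4 * z / real n" for z
        using n by (simp add: power2_eq_square)
      then have "E + 4 / (real n)\<^sup>2 * (real n * (K * E + real N * \<sigma>\<^sup>2))
          = E * (1 + 4 * K / real n) + 4 * \<sigma>\<^sup>2 * (real N / real n)"
        by (simp only:) (simp add: algebra_simps add_divide_distrib)
      then show ?thesis by (rule arg_cong)
    qed
    also have "\<dots> \<le> (E * (1 + 1 / 5) + 4 * \<sigma>\<^sup>2 * (real N / real n)) / V"
      using consequences(1) E0 V by (intro divide_right_mono add_right_mono mult_left_mono add_left_mono) simp_all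
    also have "\<dots> = R\<^sup>2"
      unfolding R2 l2 V_def[symmetric] by (simp add: add_divide_distrib mult_ac)
    finally show "P.expectation Q \<le> R\<^sup>2" .
  qed

  \<comment> \<open>The slack \<open>\<epsilon>\<close> of the tail bound is chosen as
    \<open>n^(-r)\<close>, which accounts for one of the two such terms in the claim.\<close>
  have rn: "0 < real n powr - r" using n by simp
  obtain F where F: "integrable (Pi\<^sub>M {..<n} (\<lambda>_. prod_measure \<mu>)) F"
    "\<And>\<xi>. \<xi> \<in> space (Pi\<^sub>M {..<n} (\<lambda>_. prod_measure \<mu>)) \<Longrightarrow> 0 \<le> F \<xi>"
    "(\<integral>\<xi>. F \<xi> \<partial>Pi\<^sub>M {..<n} (\<lambda>_. prod_measure \<mu>)) \<le> real N * exp (- (real n / (8 * K))) + real n powr - r"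
    "\<And>\<xi> u. \<xi> \<in> space (Pi\<^sub>M {..<n} (\<lambda>_. prod_measure \<mu>)) \<Longrightarrow> F \<xi> < 1 \<Longrightarrow>
       real n / 2 * dot N u u \<le> (\<Sum>i<n. (dot N (\<lambda>j. \<phi> j (\<xi> i)) u)\<^sup>2)"
    using matrix_chernoff_lower_tail[OF nu.prob_space_axioms square_integrable_measurable[OF phi] orth bound K1 rn,
        where n = n] by blast
  \<comment> \<open>From here on \<open>X\<close> is the design vector, no longer the family of
    coordinate spaces.\<close>
  define X where "X \<omega> = (\<lambda>k\<in>{..<n}. x k \<omega>)" for \<omega>
  have rv_x: "x k \<in> P \<rightarrow>\<^sub>M prod_measure \<mu>" if "k < n" for k
    using indep_x that by (auto simp: P.indep_vars_def)
  have X: "X \<in> P \<rightarrow>\<^sub>M Pi\<^sub>M {..<n} (\<lambda>_. prod_measure \<mu>)"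
    unfolding X_def[abs_def] using rv_x by (intro measurable_restrict) auto
  have distr_X: "distr P (Pi\<^sub>M {..<n} (\<lambda>_. prod_measure \<mu>)) X = Pi\<^sub>M {..<n} (\<lambda>_. prod_measure \<mu>)"
  proof -
    have "distr P (Pi\<^sub>M {..<n} (\<lambda>_. prod_measure \<mu>)) X
        = Pi\<^sub>M {..<n} (\<lambda>k. distr P (prod_measure \<mu>) (x k))"
      unfolding X_def[abs_def]
      using n indep_x rv_x by (intro P.indep_vars_iff_distr_eq_PiM'[THEN iffD1]) (auto simp: lessThan_empty_iff)
    also have "\<dots> = Pi\<^sub>M {..<n} (\<lambda>_. prod_measure \<mu>)"
      using distr_x by (intro PiM_cong) auto
    finally show ?thesis .
  qed
  have mF: "F \<in> borel_measurable (Pi\<^sub>M {..<n} (\<lambda>_. prod_measure \<mu>))"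
    using F(1) by (rule borel_measurable_integrable)
  have B: "integrable P (\<lambda>\<omega>. F (X \<omega>))" "\<And>\<omega>. \<omega> \<in> space P \<Longrightarrow> 0 \<le> F (X \<omega>)"
    "P.expectation (\<lambda>\<omega>. F (X \<omega>)) \<le> 2 * real n powr - r"
  proof -
    show "integrable P (\<lambda>\<omega>. F (X \<omega>))" using integrable_distr_eq[OF X mF] F(1) by (simp add: distr_X)
    show "0 \<le> F (X \<omega>)" if "\<omega> \<in> space P" for \<omega> by (rule F(2)[OF measurable_space[OF X that]])
    have "P.expectation (\<lambda>\<omega>. F (X \<omega>)) = (\<integral>\<xi>. F \<xi> \<partial>Pi\<^sub>M {..<n} (\<lambda>_. prod_measure \<mu>))"
      using integral_distr[OF X mF] by (simp add: distr_X)
    also have "\<dots> \<le> real N * exp (- (real n / (8 * K))) + real n powr - r" by (rule F(3))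
    \<comment> \<open>The factor \<open>N \<le> K \<le> n\<close> is paid for by one power of
      \<open>n\<close> from the exponential, which is at most \<open>n^(-(1 + r))\<close>.\<close>
    also have "real N * exp (- (real n / (8 * K))) \<le> real n * exp (- ((1 + r) * ln (real n)))"
      using NK consequences(2,3) by (intro mult_mono) auto
    also have "real n * exp (- ((1 + r) * ln (real n))) = real n powr - r"
    proof -
      have "exp (- ((1 + r) * ln (real n))) = real n powr (- r - 1)"
        using n by (simp add: powr_def algebra_simps)
      also have "\<dots> = real n powr - r / real n" using n by (simp add: powr_diff)
      finally show ?thesis using n by simp
    qed
    finally show "P.expectation (\<lambda>\<omega>. F (X \<omega>)) \<le> 2 * real n powr - r" by simp
  qed

  have fhat: "fhat \<omega> = (\<lambda>t. \<Sum>j<N. vec_index (ols_coeffs \<phi> n N (\<lambda>k. x k \<omega>) (\<lambda>k. f (x k \<omega>) + \<eta> k \<omega>)) j * \<phi> j t)" for \<omega>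
    unfolding fhat_def ols_approx_def \<phi>_def[abs_def] by (rule refl)
  have fhat_sq: "square_integrable (prod_measure \<mu>) (fhat \<omega>)" for \<omega>
    unfolding fhat by (intro square_integrable_sum square_integrable_scale phi)
  have error: "(\<integral>t. (f t - fhat \<omega> t)\<^sup>2 \<partial>prod_measure \<mu>) / V \<le> Q \<omega>"
    if w: "\<omega> \<in> space P" and good: "F (X \<omega>) < 1" for \<omega>
  proof -
    define d where "d j = vec_index (ols_coeffs \<phi> n N (\<lambda>k. x k \<omega>) (\<lambda>k. f (x k \<omega>) + \<eta> k \<omega>)) j - c j" for j
    have stab: "real n / 2 * dot N u u \<le> (\<Sum>k<n. (dot N (\<lambda>j. \<phi> j (x k \<omega>)) u)\<^sup>2)" for u
      using F(4)[OF measurable_space[OF X w] good, of u] by (simp add: X_def)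
    have "f (x k \<omega>) + \<eta> k \<omega> - (\<Sum>l<N. c l * \<phi> l (x k \<omega>)) = e (x k \<omega>) + \<eta> k \<omega>" for k
      by (simp add: e_def fN)
    then have "dot N d d \<le> 4 / (real n)\<^sup>2 * dot N (b \<omega>) (b \<omega>)"
      using ols_coeffs_error[of n N \<phi> "\<lambda>k. x k \<omega>" "\<lambda>k. f (x k \<omega>) + \<eta> k \<omega>" c, OF _ stab] n
      by (simp only: d_def[abs_def] b_def[abs_def])
    moreover have "(\<integral>t. (f t - fhat \<omega> t)\<^sup>2 \<partial>prod_measure \<mu>) = E + dot N d d"
    proof -
      have "f t - fhat \<omega> t = e t - (\<Sum>j<N. d j * \<phi> j t)" for t
        by (simp add: fhat e_def fN d_def left_diff_distrib sum_subtractf)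
      then show ?thesis
        using orthonormal_expansion_error[OF e phi orth perp, of N d] by (simp add: E_def)
    qed
    ultimately show ?thesis unfolding Q_def using V by (intro divide_right_mono) simp_all
  qed

  show ?thesis
  proof
    fix S assume S: "S \<in> {sobol_index \<mu>, total_effect_index \<mu>}"
    note bounds = index_bounds[OF prob_mu f fhat_sq var S, folded V_def]
    have main: "P.expectation (\<lambda>\<omega>. (S f U - S (fhat \<omega>) U)\<^sup>2) \<le> R\<^sup>2 + 2 * real n powr - r"
      "P.expectation (\<lambda>\<omega>. \<bar>S f U - S (fhat \<omega>) U\<bar>) \<le> R * (R + 2 * sqrt (S f U)) + 2 * real n powr - r" for U
    proof -
      have S0: "0 \<le> sqrt (S f U)" using bounds(4) by simp
      have D2: "(S f U - S (fhat \<omega>) U)\<^sup>2 \<le> Q \<omega>" if "\<omega> \<in> space P" "F (X \<omega>) < 1" for \<omega>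
        by (rule order_trans[OF bounds(2) error[OF that]])
      have D3: "\<bar>S f U - S (fhat \<omega>) U\<bar> \<le> Q \<omega> + 2 * sqrt (S f U) * sqrt (Q \<omega>)"
        if "\<omega> \<in> space P" "F (X \<omega>) < 1" for \<omega>
        using S0 error[OF that]
        by (intro order_trans[OF bounds(3)] add_mono mult_left_mono real_sqrt_le_mono) auto
      show "P.expectation (\<lambda>\<omega>. (S f U - S (fhat \<omega>) U)\<^sup>2) \<le> R\<^sup>2 + 2 * real n powr - r"
        "P.expectation (\<lambda>\<omega>. \<bar>S f U - S (fhat \<omega>) U\<bar>) \<le> R * (R + 2 * sqrt (S f U)) + 2 * real n powr - r"
        by (rule P.expectation_le_of_bounds[OF Q(1) Q(2) Q(3) R B bounds(1) D2 D3 S0]; assumption)+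
    qed
    show "(MAX U\<in>UNIV. P.expectation (\<lambda>\<omega>. (S f U - S (fhat \<omega>) U)\<^sup>2)) \<le> R\<^sup>2 + 2 * real n powr - r \<and>
        (\<forall>U. P.expectation (\<lambda>\<omega>. \<bar>S f U - S (fhat \<omega>) U\<bar>)
          \<le> R * (R + 2 * sqrt (S f U)) + 2 * real n powr - r)"
      using main by (auto intro!: Max.boundedI)
  qed
qed

end
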